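(* Let $d=2$, let $r_g<r_{\min}\le r_{\max}$ be constants and $r=r(n)\in[r_{\min},r_{\max}]$. There exist constants $C$ and $c>0$ such that, with high probability as $n\to\infty$, every $A\subset L_1(G)$ with $\pi(A)\ge\frac{C(\log n)^2}{n}$ contains two vertices at (toroidal Euclidean) distance at least $c\sqrt{\deg(A)}$.
   Context: $\Lambda_n^{(2)}$ is the torus $\left[-\frac{\sqrt n}{2},\frac{\sqrt n}{2}\right]^2$; $G$ is the random geometric graph whose vertices form a Poisson point process of intensity $1$ on $\Lambda_n^{(2)}$, with edges between vertices at Euclidean distance at most $r(n)$. $r_g$ is the critical radius above which $G$ has, with high probability, a unique component of size of order $n$, the giant component $L_1(G)$. $\deg(A)=\sum_{x\in A}\deg(x)$ and $\pi(A)=\deg(A)/\deg(L_1(G))$ is the stationary measure of the simple random walk on $L_1(G)$. "With high probability" means with probability tending to $1$ as $n\to\infty$. *)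

theory Defs
  imports "HOL-Probability.Probability"
begin

definition torus_box :: "nat \<Rightarrow> (real \<times> real) set" where
  "torus_box n = {-sqrt (real n)/2 ..< sqrt (real n)/2} \<times> {-sqrt (real n)/2 ..< sqrt (real n)/2}"

definition tdist :: "nat \<Rightarrow> real \<times> real \<Rightarrow> real \<times> real \<Rightarrow> real" where
  "tdist n p q =
     (let s = sqrt (real n); a = \<bar>fst p - fst q\<bar>; b = \<bar>snd p - snd q\<bar>
      in sqrt ((min a (s - a))\<^sup>2 + (min b (s - b))\<^sup>2))"

text \<open>Law of the Poisson point process of intensity 1 on \<Lambda>_n: the number of points
  is Poisson(n) and, given k points, they are i.i.d. uniform on \<Lambda>_n.  The probability
  of an event P about the (finite) vertex set is therefore:\<close>
definition unif_points :: "nat \<Rightarrow> nat \<Rightarrow> (nat \<Rightarrow> real \<times> real) measure" where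
  "unif_points n k = PiM {..<k} (\<lambda>_. uniform_measure lborel (torus_box n))"

definition ppp_prob :: "nat \<Rightarrow> ((real \<times> real) set \<Rightarrow> bool) \<Rightarrow> real" where
  "ppp_prob n P =
     (\<Sum>k. exp (- real n) * real n ^ k / fact k *
        measure (unif_points n k) {\<omega> \<in> space (unif_points n k). P (\<omega> ` {..<k})})"

definition rgg_adj :: "nat \<Rightarrow> real \<Rightarrow> (real \<times> real) set \<Rightarrow> real \<times> real \<Rightarrow> real \<times> real \<Rightarrow> bool" where
  "rgg_adj n r V x y \<longleftrightarrow> x \<in> V \<and> y \<in> V \<and> x \<noteq> y \<and> tdist n x y \<le> r"

definition rgg_edges :: "nat \<Rightarrow> real \<Rightarrow> (real \<times> real) set \<Rightarrow> ((real \<times> real) \<times> (real \<times> real)) set" where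
  "rgg_edges n r V = {(x, y). rgg_adj n r V x y}"

definition component :: "nat \<Rightarrow> real \<Rightarrow> (real \<times> real) set \<Rightarrow> real \<times> real \<Rightarrow> (real \<times> real) set" where
  "component n r V x = {y \<in> V. (x, y) \<in> (rgg_edges n r V)\<^sup>*}"

definition components :: "nat \<Rightarrow> real \<Rightarrow> (real \<times> real) set \<Rightarrow> (real \<times> real) set set" where
  "components n r V = component n r V ` V"

definition is_largest_comp :: "nat \<Rightarrow> real \<Rightarrow> (real \<times> real) set \<Rightarrow> (real \<times> real) set \<Rightarrow> bool" where
  "is_largest_comp n r V L \<longleftrightarrow>
     L \<in> components n r V \<and> (\<forall>L' \<in> components n r V. card L' \<le> card L)"

definition deg :: "nat \<Rightarrow> real \<Rightarrow> (real \<times> real) set \<Rightarrow> real \<times> real \<Rightarrow> nat" where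
  "deg n r V x = card {y \<in> V. rgg_adj n r V x y}"

definition deg_set :: "nat \<Rightarrow> real \<Rightarrow> (real \<times> real) set \<Rightarrow> (real \<times> real) set \<Rightarrow> nat" where
  "deg_set n r V A = (\<Sum>x\<in>A. deg n r V x)"

text \<open>Stationary measure of simple random walk on the component L.\<close>
definition stat_pi :: "nat \<Rightarrow> real \<Rightarrow> (real \<times> real) set \<Rightarrow> (real \<times> real) set \<Rightarrow> (real \<times> real) set \<Rightarrow> real" where
  "stat_pi n r V L A = real (deg_set n r V A) / real (deg_set n r V L)"

definition giant_regime :: "real \<Rightarrow> bool" where
  "giant_regime \<rho> \<longleftrightarrow> (\<exists>\<theta>>0. \<forall>\<epsilon>>0.
     (\<lambda>n. ppp_prob n (\<lambda>V. \<exists>L. is_largest_comp n \<rho> V L \<and> real (card L) \<ge> \<theta> * real n \<and>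
          (\<forall>L' \<in> components n \<rho> V. L' \<noteq> L \<longrightarrow> real (card L') \<le> \<epsilon> * real n)))
     \<longlonglongrightarrow> 1)"

definition r_g :: real where
  "r_g = Inf {r0. \<forall>\<rho>>r0. giant_regime \<rho>}"

end

theory Submission
  imports Defs "HOL-Combinatorics.Multiset_Permutations" "HOL-Real_Asymp.Real_Asymp"
begin

text \<open>
  Cut the torus into cells of bounded area; their occupation numbers are independent Poisson variables.
  A set \<open>A\<close> of toroidal diameter \<open>D\<close> lies in a box of \<open>O(D\<^sup>2 + 1)\<close> cells, and its total degree is at most a
  constant times the sum of the squared occupation numbers over a slightly larger box. Exponential moments of
  truncated squares bound this sum, with high probability and simultaneously for all boxes, by
  \<open>O(D\<^sup>2 + (ln n)\<^sup>2)\<close>. Since the giant component has linear total degree, \<open>\<pi>(A) \<ge> C (ln n)\<^sup>2 / n\<close> with large \<open>C\<close>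
  makes \<open>deg(A)\<close> exceed the logarithmic term, so that \<open>deg(A) = O(D\<^sup>2)\<close>.

  \<open>Inf {}\<close> is an unspecified real, so the hypothesis on \<open>r_g\<close> is meaningful only once some radius is known above
  which every radius is in the giant regime. This is a Peierls argument: clusters of empty cells have
  exponentially decaying size, the boundary between a cluster of occupied cells and a component of its
  complement is a single cluster of empty cells, and a region with a short boundary is small or co-small.
\<close>

section \<open>Boundaries in the square grid\<close>

text \<open>One factor of the squared logarithm is the truncation level 3 ln n of the occupation
  numbers. The other comes from the union bound over all boxes, each of which may fail only with
  probability exp (-3 ln n). Cells come in two sizes. For the degree bound their side is between 1/2
  and 1. For percolation at radius \<rho> it is between \<rho>/3 and 2\<rho>/5: points in adjacent
  cells are then joined by an edge, while an edge spans at most 3 cells in each coordinate, which is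
  why empty cells are linked at range 3. The boundary argument needs a simply connected region, so
  the percolating cells form a square whose opposite sides are not identified. Edges across the seam
  are charged to the O(sqrt n) cells near the sides; this is affordable, because the other
  components only have to be o(n). The giant regime concerns a fixed radius. It is applied at
  \<open>r_min\<close>, and monotonicity of the largest component in the radius carries the linear
  lower bound over to the varying radius r(n).\<close>

definition adj4 :: "nat \<times> nat \<Rightarrow> nat \<times> nat \<Rightarrow> bool" where
  "adj4 u v \<longleftrightarrow> (fst u = fst v \<and> (snd v = Suc (snd u) \<or> snd u = Suc (snd v))) \<or>
                (snd u = snd v \<and> (fst v = Suc (fst u) \<or> fst u = Suc (fst v)))"

definition near :: "nat \<Rightarrow> nat \<times> nat \<Rightarrow> nat \<times> nat \<Rightarrow> bool" where
  "near R u v \<longleftrightarrow> fst u \<le> fst v + R \<and> fst v \<le> fst u + R \<and> snd u \<le> snd v + R \<and> snd v \<le> snd u + R"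

definition grid :: "nat \<Rightarrow> (nat \<times> nat) set" where
  "grid q = {..<q} \<times> {..<q}"

text \<open>Reflexive at every \<open>u\<close>, also outside \<open>S\<close>, so membership in
  \<open>S\<close> needs a premise of its own, as in \<open>conn4_mem\<close>.\<close>

definition conn4 :: "(nat \<times> nat) set \<Rightarrow> nat \<times> nat \<Rightarrow> nat \<times> nat \<Rightarrow> bool" where
  "conn4 S u v \<longleftrightarrow> (u, v) \<in> {(a, b). a \<in> S \<and> b \<in> S \<and> adj4 a b}\<^sup>*"

text \<open>Inner boundary relative to the grid: the outer sides of the square do not count, so a
  separating family of cells may end at a side and need not close up to a circuit.\<close>

definition bdry :: "nat \<Rightarrow> (nat \<times> nat) set \<Rightarrow> (nat \<times> nat) set" where
  "bdry q D = {d \<in> D. \<exists>c \<in> grid q - D. adj4 d c}"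

text \<open>Range 3 matches the reach of an edge of the graph: the boundaries of two complement
  components that such an edge can join then fall into the same class.\<close>

definition bad_rel :: "nat \<Rightarrow> (nat \<times> nat) set \<Rightarrow> ((nat \<times> nat) \<times> (nat \<times> nat)) set" where
  "bad_rel q B = {(a, b). a \<in> grid q \<inter> B \<and> b \<in> grid q \<inter> B \<and> near 3 a b}"

definition bad_class :: "nat \<Rightarrow> (nat \<times> nat) set \<Rightarrow> nat \<times> nat \<Rightarrow> (nat \<times> nat) set" where
  "bad_class q B b = {c \<in> grid q \<inter> B. (b, c) \<in> (bad_rel q B)\<^sup>*}"

text \<open>The product of the projections instead of the bounding box: a row or column that misses
  the projections misses the class, which is what confinement asks for, and the cardinality is at
  most the square of that of the class.\<close>

definition class_rect :: "nat \<Rightarrow> (nat \<times> nat) set \<Rightarrow> nat \<times> nat \<Rightarrow> (nat \<times> nat) set" where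
  "class_rect q B b = fst ` bad_class q B b \<times> snd ` bad_class q B b"

lemma finite_grid [simp]: "finite (grid q)" and card_grid: "card (grid q) = q * q"
  by (simp_all add: grid_def card_cartesian_product)

lemma adj4_sym: "adj4 u v \<Longrightarrow> adj4 v u"
  by (auto simp: adj4_def)

lemma near_sym: "near R u v \<Longrightarrow> near R v u"
  by (auto simp: near_def)

lemma conn4_refl [simp]: "conn4 S u u"
  by (simp add: conn4_def)

lemma conn4_step: "conn4 S u v \<Longrightarrow> v \<in> S \<Longrightarrow> w \<in> S \<Longrightarrow> adj4 v w \<Longrightarrow> conn4 S u w"
  unfolding conn4_def by (rule rtrancl_into_rtrancl) auto

lemma conn4_sym: "conn4 S u v \<Longrightarrow> conn4 S v u"
proof -
  have "sym {(a, b). a \<in> S \<and> b \<in> S \<and> adj4 a b}"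
    by (auto simp: sym_def dest: adj4_sym)
  then show "conn4 S u v \<Longrightarrow> conn4 S v u"
    unfolding conn4_def by (meson sym_rtrancl symD)
qed

lemma conn4_trans: "conn4 S u v \<Longrightarrow> conn4 S v w \<Longrightarrow> conn4 S u w"
  unfolding conn4_def by (rule rtrancl_trans)

lemma conn4_mem: "conn4 S u v \<Longrightarrow> u \<in> S \<Longrightarrow> v \<in> S"
  unfolding conn4_def by (induction rule: rtrancl_induct) auto

lemma conn4_induct [consumes 1, case_names refl step]:
  assumes "conn4 S u v" "P u"
    and "\<And>a b. conn4 S u a \<Longrightarrow> P a \<Longrightarrow> a \<in> S \<Longrightarrow> b \<in> S \<Longrightarrow> adj4 a b \<Longrightarrow> P b"
  shows "P v"
  using assms(1) unfolding conn4_def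
  by (induction rule: rtrancl_induct) (use assms(2,3) in \<open>auto simp: conn4_def\<close>)

lemma conn4_component:
  assumes "x \<in> S" "conn4 S x u" "conn4 S x v"
  shows "conn4 {z. conn4 S x z} u v"
proof -
  have *: "conn4 {z. conn4 S x z} x w" if "conn4 S x w" for w
    using that
  proof (induction rule: conn4_induct)
    case (step a b)
    then show ?case
      using conn4_step[of S x a b] conn4_step[of "{z. conn4 S x z}" x a b] by auto
  qed auto
  show ?thesis
    using *[OF assms(2)] *[OF assms(3)] conn4_sym conn4_trans by blast
qed

section \<open>Closed cochains modulo 2 and connectedness of boundaries\<close>

primrec potential_row :: "(nat \<times> nat \<Rightarrow> nat \<times> nat \<Rightarrow> bool) \<Rightarrow> nat \<Rightarrow> bool" where
  "potential_row f 0 = False"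
| "potential_row f (Suc i) = (potential_row f i \<noteq> f (i, 0) (Suc i, 0))"

text \<open>The integral of \<open>f\<close> modulo 2 along the path from \<open>(0, 0)\<close> to
  \<open>(i, 0)\<close> and on to \<open>(i, j)\<close>.\<close>

primrec potential :: "(nat \<times> nat \<Rightarrow> nat \<times> nat \<Rightarrow> bool) \<Rightarrow> nat \<Rightarrow> nat \<Rightarrow> bool" where
  "potential f i 0 = potential_row f i"
| "potential f i (Suc j) = (potential f i j \<noteq> f (i, j) (i, Suc j))"

text \<open>Inequality of truth values is addition in \<open>\<int>/2\<close>: the face condition says that \<open>f\<close> is a closed 1-cochain.\<close>

lemma grid_cocycle_exact:
  fixes f :: "nat \<times> nat \<Rightarrow> nat \<times> nat \<Rightarrow> bool"
  assumes sym: "\<And>u v. f u v = f v u"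
    and face: "\<And>i j. Suc i < q \<Longrightarrow> Suc j < q \<Longrightarrow>
      (f (i, j) (Suc i, j) \<noteq> f (Suc i, j) (Suc i, Suc j)) =
      (f (i, j) (i, Suc j) \<noteq> f (i, Suc j) (Suc i, Suc j))"
  obtains g :: "nat \<times> nat \<Rightarrow> bool" where "\<And>u v. u \<in> grid q \<Longrightarrow> v \<in> grid q \<Longrightarrow> adj4 u v \<Longrightarrow> f u v = (g u \<noteq> g v)"
proof -
  define g where "g = (\<lambda>(i, j). potential f i j)"
  have vert: "f (i, j) (i, Suc j) = (g (i, j) \<noteq> g (i, Suc j))" for i j
    by (auto simp: g_def)
  \<comment> \<open>Edges in the second direction, and the edges with \<open>j = 0\<close>, are
    right by construction. The face condition moves the identity from an edge to the parallel
    one.\<close>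
  have hor: "f (i, j) (Suc i, j) = (g (i, j) \<noteq> g (Suc i, j))" if "Suc i < q" "j < q" for i j
    using that(2)
  proof (induction j)
    case (Suc j)
    then show ?case using face[of i j] that(1) by (auto simp: g_def)
  qed (auto simp: g_def)
  have "f u v = (g u \<noteq> g v)" if "u \<in> grid q" "v \<in> grid q" "adj4 u v" for u v
    using that vert hor sym by (cases u; cases v) (auto simp: adj4_def grid_def)
  then show thesis using that[of g] by blast
qed

text \<open>The cut edges ending in \<open>X\<close> form a closed cochain. Its potential is constant on \<open>C\<close> and on \<open>D\<close>, so
  either all or none of the cut edges end in \<open>X\<close>.\<close>

lemma bdry_star_connected:
  assumes disj: "C \<inter> D = {}" and grd: "C \<subseteq> grid q" "D \<subseteq> grid q"
    and C: "\<And>u v. u \<in> C \<Longrightarrow> v \<in> C \<Longrightarrow> conn4 C u v"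
    and D: "\<And>u v. u \<in> D \<Longrightarrow> v \<in> D \<Longrightarrow> conn4 D u v"
    and cut: "\<And>d c. d \<in> D \<Longrightarrow> c \<in> grid q - D \<Longrightarrow> adj4 d c \<Longrightarrow> c \<in> C"
    and X: "X \<subseteq> bdry q D" "x0 \<in> X"
    and closed: "\<And>x y. x \<in> X \<Longrightarrow> y \<in> bdry q D \<Longrightarrow> near 1 x y \<Longrightarrow> y \<in> X"
  shows "bdry q D \<subseteq> X"
proof
  fix y0 assume y0: "y0 \<in> bdry q D"
  define f where "f = (\<lambda>u v. (u \<in> D \<and> v \<notin> D \<and> u \<in> X) \<or> (v \<in> D \<and> u \<notin> D \<and> v \<in> X))"
  have key: "(x \<in> X) = (y \<in> X)" if "x \<in> bdry q D" "y \<in> bdry q D" "near 1 x y" for x y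
    using that closed near_sym by blast
  have f_sym: "f u v = f v u" for u v by (auto simp: f_def)
  have face: "(f (i, j) (Suc i, j) \<noteq> f (Suc i, j) (Suc i, Suc j)) =
      (f (i, j) (i, Suc j) \<noteq> f (i, Suc j) (Suc i, Suc j))" if "Suc i < q" "Suc j < q" for i j
  proof -
    define a b c d where "a = (i, j)" "b = (Suc i, j)" "c = (Suc i, Suc j)" "d = (i, Suc j)"
    have ad: "adj4 a b" "adj4 b a" "adj4 b c" "adj4 c b" "adj4 c d" "adj4 d c" "adj4 d a" "adj4 a d"
      by (auto simp: adj4_def a_b_c_d_def)
    have nr: "near 1 u v" if "u \<in> {a, b, c, d}" "v \<in> {a, b, c, d}" for u v
      using that by (auto simp: near_def a_b_c_d_def)
    have g: "{a, b, c, d} \<subseteq> grid q"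
      using that by (auto simp: grid_def a_b_c_d_def)
    \<comment> \<open>The corners of a face are pairwise at range 1, so \<open>closed\<close> gives
      all boundary cells among them the same status \<open>t\<close>. On this face \<open>f\<close>
      is therefore zero or the coboundary of \<open>D\<close>, and both are closed.\<close>
    obtain t where t: "\<And>u. u \<in> {a, b, c, d} \<Longrightarrow> u \<in> bdry q D \<Longrightarrow> (u \<in> X) = t"
    proof (cases "\<exists>u\<in>{a, b, c, d}. u \<in> bdry q D")
      case True
      then obtain u where u: "u \<in> {a, b, c, d}" "u \<in> bdry q D" by blast
      show ?thesis
        by (rule that[of "u \<in> X"], rule key[OF _ u(2) nr[OF _ u(1)]])
    next
      case False
      then show ?thesis using that[of True] by blast
    qed
    have fe: "f u v = (t \<and> ((u \<in> D) \<noteq> (v \<in> D)))"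
      if "u \<in> {a, b, c, d}" "v \<in> {a, b, c, d}" "adj4 u v" "adj4 v u" for u v
    proof -
      have "u \<in> bdry q D" if "u \<in> D" "v \<notin> D"
        unfolding bdry_def using that \<open>adj4 u v\<close> g \<open>v \<in> {a, b, c, d}\<close> by blast
      moreover have "v \<in> bdry q D" if "v \<in> D" "u \<notin> D"
        unfolding bdry_def using that \<open>adj4 v u\<close> g \<open>u \<in> {a, b, c, d}\<close> by blast
      ultimately show ?thesis
        unfolding f_def using t[OF that(1)] t[OF that(2)] by (cases "u \<in> D"; cases "v \<in> D"; simp)
    qed
    have "f a b = (t \<and> ((a \<in> D) \<noteq> (b \<in> D)))" "f b c = (t \<and> ((b \<in> D) \<noteq> (c \<in> D)))"
      "f a d = (t \<and> ((a \<in> D) \<noteq> (d \<in> D)))" "f d c = (t \<and> ((d \<in> D) \<noteq> (c \<in> D)))"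
      by (rule fe; simp add: ad)+
    then have "(f a b \<noteq> f b c) = (f a d \<noteq> f d c)" by blast
    then show ?thesis by (simp add: a_b_c_d_def)
  qed
  obtain g :: "nat \<times> nat \<Rightarrow> bool" where g: "\<And>u v. u \<in> grid q \<Longrightarrow> v \<in> grid q \<Longrightarrow> adj4 u v \<Longrightarrow> f u v = (g u \<noteq> g v)"
    using grid_cocycle_exact[of f q, OF f_sym face] by metis
  have gD: "g u = g v" if "u \<in> D" "v \<in> D" for u v
    using D[OF that]
  proof (induction rule: conn4_induct)
    case (step a b)
    then show ?case using g[of a b] grd by (auto simp: f_def)
  qed auto
  have gC: "g u = g v" if "u \<in> C" "v \<in> C" for u v
    using C[OF that]
  proof (induction rule: conn4_induct)
    case (step a b)
    moreover have "a \<notin> D" "b \<notin> D" using step disj by auto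
    ultimately show ?case using g[of a b] grd by (auto simp: f_def)
  qed auto
  from X obtain c0 where c0: "c0 \<in> grid q - D" "adj4 x0 c0" "x0 \<in> D" by (auto simp: bdry_def)
  from y0 obtain c1 where c1: "c1 \<in> grid q - D" "adj4 y0 c1" "y0 \<in> D" by (auto simp: bdry_def)
  have "c0 \<in> C" "c1 \<in> C" using cut c0 c1 by auto
  then have "g c0 = g c1" "g x0 = g y0" using gC[of c0 c1] gD[of x0 y0] c0 c1 by auto
  moreover have "g x0 \<noteq> g c0" using g[of x0 c0] c0 grd X by (auto simp: f_def)
  ultimately have "f y0 c1" using g[of y0 c1] c1 grd by auto
  then show "y0 \<in> X" using c1 by (auto simp: f_def)
qed

section \<open>Regions with a short boundary\<close>

lemma exists_switch:
  fixes a b :: nat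
  assumes "P a" "\<not> P b"
  obtains i j where "P i" "\<not> P j" "i = Suc j \<or> j = Suc i" "min a b \<le> i" "i \<le> max a b" "min a b \<le> j" "j \<le> max a b"
proof (cases "a \<le> b")
  case True
  define j where "j = (LEAST j. a \<le> j \<and> \<not> P j)"
  have j: "a \<le> j" "\<not> P j" "j \<le> b"
    unfolding j_def using LeastI[of "\<lambda>j. a \<le> j \<and> \<not> P j" b] Least_le[of "\<lambda>j. a \<le> j \<and> \<not> P j" b] True assms by auto
  have "a < j" using j assms by (metis le_neq_implies_less)
  moreover have "P (j - 1)"
    using not_less_Least[of "j - 1" "\<lambda>j. a \<le> j \<and> \<not> P j"] \<open>a < j\<close> unfolding j_def[symmetric] by auto
  ultimately show ?thesis using that[of "j - 1" j] j by auto
next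
  case False
  define j where "j = (LEAST j. b \<le> j \<and> P j)"
  have j: "b \<le> j" "P j" "j \<le> a"
    unfolding j_def using LeastI[of "\<lambda>j. b \<le> j \<and> P j" a] Least_le[of "\<lambda>j. b \<le> j \<and> P j" a] False assms by auto
  have "b < j" using j assms by (metis le_neq_implies_less)
  moreover have "\<not> P (j - 1)"
    using not_less_Least[of "j - 1" "\<lambda>j. b \<le> j \<and> P j"] \<open>b < j\<close> unfolding j_def[symmetric] by auto
  ultimately show ?thesis using that[of j "j - 1"] j by auto
qed

definition in_box :: "nat \<times> nat \<Rightarrow> nat \<times> nat \<Rightarrow> nat \<times> nat \<Rightarrow> bool" where
  "in_box y z u \<longleftrightarrow> min (fst y) (fst z) \<le> fst u \<and> fst u \<le> max (fst y) (fst z) \<and>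
     min (snd y) (snd z) \<le> snd u \<and> snd u \<le> max (snd y) (snd z)"

lemma in_box_commute: "in_box y z u = in_box z y u"
  by (simp add: in_box_def min.commute max.commute)

text \<open>Membership in \<open>D\<close> switches on one of the two legs of the path from
  \<open>y\<close> via \<open>(fst z, snd y)\<close> to \<open>z\<close>, which stays in the box
  spanned by \<open>y\<close> and \<open>z\<close>. The localisation matters: for nearby
  \<open>y\<close> and \<open>z\<close> it keeps the boundary cells found near each other.\<close>

lemma bdry_between:
  assumes "y \<in> D" "z \<notin> D" "y \<in> grid q" "z \<in> grid q"
  shows "\<exists>u\<in>bdry q D. in_box y z u"
proof (cases "(fst z, snd y) \<in> D")
  case True
  obtain i j where ij: "(fst z, i) \<in> D" "(fst z, j) \<notin> D" "i = Suc j \<or> j = Suc i"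
    "min (snd y) (snd z) \<le> i" "i \<le> max (snd y) (snd z)" "min (snd y) (snd z) \<le> j" "j \<le> max (snd y) (snd z)"
    by (rule exists_switch[of "\<lambda>i. (fst z, i) \<in> D" "snd y" "snd z"]) (use True assms in auto)
  have "(fst z, j) \<in> grid q" using ij assms by (auto simp: grid_def)
  then have "(fst z, i) \<in> bdry q D"
    using ij by (auto simp: bdry_def adj4_def intro!: bexI[of _ "(fst z, j)"])
  then show ?thesis by (rule bexI[rotated]) (use ij in \<open>simp add: in_box_def\<close>)
next
  case False
  obtain i j where ij: "(i, snd y) \<in> D" "(j, snd y) \<notin> D" "i = Suc j \<or> j = Suc i"
    "min (fst y) (fst z) \<le> i" "i \<le> max (fst y) (fst z)" "min (fst y) (fst z) \<le> j" "j \<le> max (fst y) (fst z)"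
    by (rule exists_switch[of "\<lambda>i. (i, snd y) \<in> D" "fst y" "fst z"]) (use False assms in auto)
  have "(j, snd y) \<in> grid q" using ij assms by (auto simp: grid_def)
  then have "(i, snd y) \<in> bdry q D"
    using ij by (auto simp: bdry_def adj4_def intro!: bexI[of _ "(j, snd y)"])
  then show ?thesis by (rule bexI[rotated]) (use ij in \<open>simp add: in_box_def\<close>)
qed

lemma exists_not_in_small:
  assumes "finite A" "card A < q"
  shows "\<exists>i<q. i \<notin> A"
proof -
  have "\<not> {..<q} \<subseteq> A" using card_mono[OF assms(1), of "{..<q}"] assms(2) by auto
  then show ?thesis by auto
qed

text \<open>A row or column that misses the boundary of \<open>D\<close> lies inside \<open>D\<close> or outside it, and rows meet columns.\<close>

lemma small_boundary_confines:
  assumes D: "D \<subseteq> grid q" and S: "bdry q D \<subseteq> S" "finite S" "card S < q"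
  shows "D \<subseteq> fst ` S \<times> snd ` S \<or> grid q - D \<subseteq> fst ` S \<times> snd ` S"
proof -
  have "card (fst ` S) < q" "card (snd ` S) < q"
    using S by (meson card_image_le le_less_trans)+
  \<comment> \<open>The projections of \<open>S\<close> have fewer than \<open>q\<close> elements
    and so leave one value of each coordinate free; the crossing of these two lines is the reference
    cell.\<close>
  then obtain i0 j0 where i0: "i0 < q" "i0 \<notin> fst ` S" and j0: "j0 < q" "j0 \<notin> snd ` S"
    using exists_not_in_small[of "fst ` S" q] exists_not_in_small[of "snd ` S" q] S(2) by auto
  have same: "(u \<in> D) = (v \<in> D)"
    if uv: "u \<in> grid q" "v \<in> grid q" "(fst u = fst v \<and> fst u \<notin> fst ` S) \<or> (snd u = snd v \<and> snd u \<notin> snd ` S)" for u v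
  proof (rule ccontr)
    assume neq: "(u \<in> D) \<noteq> (v \<in> D)"
    have "\<exists>w\<in>bdry q D. in_box u v w"
      using bdry_between[of u D v q] bdry_between[of v D u q] uv(1,2) neq in_box_commute[of u v] by auto
    then obtain w where w: "w \<in> bdry q D" "in_box u v w" by auto
    then have "w \<in> S" using S by auto
    then have "fst w \<in> fst ` S" "snd w \<in> snd ` S" by auto
    moreover have "fst w = fst u" if "fst u = fst v" using w(2) that by (simp add: in_box_def)
    moreover have "snd w = snd u" if "snd u = snd v" using w(2) that by (simp add: in_box_def)
    ultimately show False using uv(3) by metis
  qed
  \<comment> \<open>A cell outside the rectangle lies on a line that misses \<open>S\<close>. Along
    it one reaches the free line of the other direction, and along that one the reference
    cell.\<close>
  have *: "(u \<in> D) = ((i0, j0) \<in> D)" if "u \<in> grid q" "u \<notin> fst ` S \<times> snd ` S" for u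
  proof (cases "fst u \<in> fst ` S")
    case True
    then have "snd u \<notin> snd ` S" using that by (cases u) auto
    then have "(u \<in> D) = ((i0, snd u) \<in> D)"
      using same[of u "(i0, snd u)"] that i0 by (auto simp: grid_def)
    also have "\<dots> = ((i0, j0) \<in> D)"
      using same[of "(i0, snd u)" "(i0, j0)"] that i0 j0 by (auto simp: grid_def)
    finally show ?thesis .
  next
    case False
    then have "(u \<in> D) = ((fst u, j0) \<in> D)"
      using same[of u "(fst u, j0)"] that j0 by (auto simp: grid_def)
    also have "\<dots> = ((i0, j0) \<in> D)"
      using same[of "(fst u, j0)" "(i0, j0)"] that i0 j0 by (auto simp: grid_def)
    finally show ?thesis .
  qed
  show ?thesis using * D by blast
qed

section \<open>Classes of bad cells and the good cluster\<close>

lemma sym_bad_rel: "sym ((bad_rel q B)\<^sup>*)"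
  by (rule sym_rtrancl) (auto simp: sym_def bad_rel_def dest: near_sym)

lemma finite_bad_class [simp]: "finite (bad_class q B b)"
  by (rule finite_subset[of _ "grid q"]) (auto simp: bad_class_def)

lemma bad_class_eq:
  assumes "c \<in> bad_class q B b"
  shows "bad_class q B c = bad_class q B b"
proof -
  have bc: "(b, c) \<in> (bad_rel q B)\<^sup>*" using assms by (simp add: bad_class_def)
  then have cb: "(c, b) \<in> (bad_rel q B)\<^sup>*" using symD[OF sym_bad_rel] by blast
  have "(c, d) \<in> (bad_rel q B)\<^sup>* \<longleftrightarrow> (b, d) \<in> (bad_rel q B)\<^sup>*" for d
    using bc cb rtrancl_trans by metis
  then show ?thesis by (simp add: bad_class_def)
qed

lemma bad_class_step:
  "c \<in> bad_class q B b \<Longrightarrow> d \<in> grid q \<inter> B \<Longrightarrow> near 3 c d \<Longrightarrow> d \<in> bad_class q B b"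
  by (auto simp: bad_class_def bad_rel_def intro: rtrancl_into_rtrancl)

lemma bad_class_self: "b \<in> grid q \<inter> B \<Longrightarrow> b \<in> bad_class q B b"
  by (auto simp: bad_class_def)

text \<open>All cells just outside \<open>C\<close> are bad, so the boundary of the complement
  component \<open>D\<close> consists of bad cells. It is connected at range 1, hence contained in
  one bad class, and this class is too small to meet every row or every column.\<close>

lemma complement_component_confined:
  assumes small: "\<And>b. b \<in> grid q \<inter> B \<Longrightarrow> card (bad_class q B b) < q"
    and C: "C \<subseteq> grid q" "C \<noteq> {}" "\<And>u v. u \<in> C \<Longrightarrow> v \<in> C \<Longrightarrow> conn4 C u v"
    and nbr: "\<And>c d. c \<in> C \<Longrightarrow> d \<in> grid q - C \<Longrightarrow> adj4 c d \<Longrightarrow> d \<in> B"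
    and y: "y \<in> grid q - C"
  defines "D \<equiv> {z. conn4 (grid q - C) y z}"
  shows "\<exists>b. b \<in> grid q \<inter> B \<and> bdry q D \<subseteq> bad_class q B b \<and>
    (D \<subseteq> class_rect q B b \<or> C \<subseteq> class_rect q B b)"
proof -
  have D: "D \<subseteq> grid q - C" using conn4_mem[OF _ y] by (auto simp: D_def)
  have yD: "y \<in> D" by (simp add: D_def)
  have cut: "c \<in> C" if "d \<in> D" "c \<in> grid q - D" "adj4 d c" for c d
  proof (rule ccontr)
    assume "c \<notin> C"
    then have "conn4 (grid q - C) y c"
      using that D conn4_step[of "grid q - C" y d c] by (auto simp: D_def)
    then show False using that by (auto simp: D_def)
  qed
  have bB: "bdry q D \<subseteq> grid q \<inter> B"
    using cut nbr D adj4_sym by (fastforce simp: bdry_def)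
  obtain x where x: "x \<in> C" using C by auto
  then obtain b where b: "b \<in> bdry q D"
    using bdry_between[of y D x q] yD D C(1) y by blast
  have sub: "bdry q D \<subseteq> bdry q D \<inter> bad_class q B b"
  proof (rule bdry_star_connected[of C D q])
    show "conn4 D u v" if "u \<in> D" "v \<in> D" for u v
      using conn4_component[OF y, of u v] that by (auto simp: D_def)
    show "b \<in> bdry q D \<inter> bad_class q B b" using bad_class_self[of b q B] b bB by blast
    show "v \<in> bdry q D \<inter> bad_class q B b" if "u \<in> bdry q D \<inter> bad_class q B b" "v \<in> bdry q D" "near 1 u v" for u v
      using that bB bad_class_step[of u q B b v] by (auto simp: near_def)
  qed (use C D cut in auto)
  have "D \<subseteq> class_rect q B b \<or> grid q - D \<subseteq> class_rect q B b"
    unfolding class_rect_def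
  proof (rule small_boundary_confines)
    show "card (bad_class q B b) < q" using small[of b] b bB by blast
  qed (use D sub in auto)
  moreover have "C \<subseteq> grid q - D" using C(1) D by blast
  ultimately have "D \<subseteq> class_rect q B b \<or> C \<subseteq> class_rect q B b" by blast
  then show ?thesis using b bB sub by blast
qed

text \<open>\<open>C\<close> is the cluster of \<open>x\<close>. As \<open>x\<close> avoids all
  rectangles, no rectangle contains \<open>C\<close>, so each complement component must be the
  confined side. The map \<open>\<beta>\<close> names a class confining the component of a cell;
  that nearby cells share their rectangle lets a path of graph edges stay in one rectangle.\<close>

lemma good_cluster_exists:
  assumes "\<forall>b\<in>grid q \<inter> B. card (bad_class q B b) < q"
    and "x \<in> grid q" "\<forall>b\<in>grid q \<inter> B. x \<notin> class_rect q B b"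
  shows "\<exists>C \<beta>. x \<in> C \<and> C \<subseteq> grid q - B \<and> (\<forall>u\<in>C. \<forall>v\<in>C. conn4 C u v) \<and>
    (\<forall>y\<in>grid q - C. \<beta> y \<in> grid q \<inter> B \<and> y \<in> class_rect q B (\<beta> y)) \<and>
    (\<forall>y\<in>grid q - C. \<forall>z\<in>grid q - C. near 3 y z \<longrightarrow> class_rect q B (\<beta> y) = class_rect q B (\<beta> z))"
proof -
  note small = bspec[OF assms(1)] and x = assms(2) bspec[OF assms(3)]
  define C where "C = {z. conn4 (grid q - B) x z}"
  have xB: "x \<in> grid q - B"
    using x(1) x(2)[of x] bad_class_self[of x q B] by (auto simp: class_rect_def mem_Times_iff)
  have xC: "x \<in> C" by (simp add: C_def)
  have CB: "C \<subseteq> grid q - B" using conn4_mem[OF _ xB] by (auto simp: C_def)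
  have conn: "conn4 C u v" if "u \<in> C" "v \<in> C" for u v
    using conn4_component[OF xB] that by (auto simp: C_def)
  have nbr: "d \<in> B" if "c \<in> C" "d \<in> grid q - C" "adj4 c d" for c d
    using that CB conn4_step[of "grid q - B" x c d] by (auto simp: C_def)
  define D where "D = (\<lambda>y. {z. conn4 (grid q - C) y z})"
  have "\<exists>b. b \<in> grid q \<inter> B \<and> bdry q (D y) \<subseteq> bad_class q B b \<and> D y \<subseteq> class_rect q B b"
    if y: "y \<in> grid q - C" for y
  proof -
    have "C \<subseteq> grid q" "C \<noteq> {}" using CB xC by auto
    then have "\<exists>b. b \<in> grid q \<inter> B \<and> bdry q (D y) \<subseteq> bad_class q B b \<and>
        (D y \<subseteq> class_rect q B b \<or> C \<subseteq> class_rect q B b)"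
      unfolding D_def
      by (intro complement_component_confined small conn nbr y)
    then show ?thesis using x xC by blast
  qed
  then obtain \<beta> where \<beta>: "\<And>y. y \<in> grid q - C \<Longrightarrow>
      \<beta> y \<in> grid q \<inter> B \<and> bdry q (D y) \<subseteq> bad_class q B (\<beta> y) \<and> D y \<subseteq> class_rect q B (\<beta> y)"
    by metis
  have self: "y \<in> D y" for y by (simp add: D_def)
  have rect_eq: "class_rect q B (\<beta> y) = class_rect q B (\<beta> z)"
    if y: "y \<in> grid q - C" and z: "z \<in> grid q - C" and yz: "near 3 y z" for y z
  proof -
    \<comment> \<open>If \<open>y\<close> and \<open>z\<close> lie in different components, both
      boundaries have a cell in the box spanned by \<open>y\<close> and \<open>z\<close>, whose
      sides are at most 3; bad cells at range 3 share a class.\<close>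
    have "\<exists>u v. u \<in> bdry q (D y) \<and> v \<in> bdry q (D z) \<and> near 3 u v"
    proof (cases "z \<in> D y")
      case True
      then have "D y = D z"
        unfolding D_def using conn4_trans conn4_sym by blast
      moreover have "x \<notin> D y" using conn4_mem[of _ y x, OF _ y] xC by (auto simp: D_def)
      then obtain u where "u \<in> bdry q (D y)"
        using bdry_between[of y "D y" x q] self y x(1) by blast
      moreover have "near 3 u u" by (simp add: near_def)
      ultimately show ?thesis by metis
    next
      case False
      then have "y \<notin> D z" using conn4_sym[of "grid q - C" z y] by (auto simp: D_def)
      obtain u where u: "u \<in> bdry q (D y)" "in_box y z u"
        using bdry_between[of y "D y" z q] self False y z by blast
      obtain v where v: "v \<in> bdry q (D z)" "in_box z y v"
        using bdry_between[of z "D z" y q] self \<open>y \<notin> D z\<close> y z by blast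
      have "near 3 u v" using u v yz unfolding near_def in_box_def by linarith
      then show ?thesis using u v by blast
    qed
    then obtain u v where u: "u \<in> bdry q (D y)" and v: "v \<in> bdry q (D z)" and uv: "near 3 u v"
      by blast
    have uc: "u \<in> bad_class q B (\<beta> y)" and vc: "v \<in> bad_class q B (\<beta> z)" using u v \<beta> y z by blast+
    then have "v \<in> bad_class q B (\<beta> y)"
      using bad_class_step[OF uc _ uv] by (auto simp: bad_class_def)
    then have "bad_class q B (\<beta> y) = bad_class q B (\<beta> z)"
      using bad_class_eq vc by metis
    then show ?thesis by (simp add: class_rect_def)
  qed
  show ?thesis
    using xC CB conn rect_eq \<beta> self by (intro exI[of _ C] exI[of _ \<beta>]) blast
qed

text \<open>Each rectangle is the image of pairs of related bad cells under \<open>(b, c) \<mapsto> (fst b, snd c)\<close>.\<close>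

lemma card_class_rects_le:
  "card (\<Union>b\<in>grid q \<inter> B. class_rect q B b) \<le> (\<Sum>b\<in>grid q \<inter> B. card (bad_class q B b))"
proof -
  let ?S = "SIGMA b:grid q \<inter> B. bad_class q B b"
  have "(\<Union>b\<in>grid q \<inter> B. class_rect q B b) \<subseteq> (\<lambda>(b, c). (fst b, snd c)) ` ?S"
  proof
    fix z assume "z \<in> (\<Union>b\<in>grid q \<inter> B. class_rect q B b)"
    then obtain b c d where *: "c \<in> bad_class q B b" "d \<in> bad_class q B b" "z = (fst c, snd d)"
      by (auto simp: class_rect_def)
    then have "(c, d) \<in> ?S" using bad_class_eq[OF *(1)] by (auto simp: bad_class_def)
    then show "z \<in> (\<lambda>(b, c). (fst b, snd c)) ` ?S" using * by force
  qed
  then have "card (\<Union>b\<in>grid q \<inter> B. class_rect q B b) \<le> card ?S"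
    by (meson card_image_le card_mono finite_SigmaI finite_Int finite_bad_class finite_grid finite_imageI order_trans)
  then show ?thesis by simp
qed

lemma card_class_rect_le: "card (class_rect q B b) \<le> (card (bad_class q B b))\<^sup>2"
  unfolding class_rect_def card_cartesian_product power2_eq_square
  by (intro mult_mono card_image_le) auto

section \<open>Walks through clusters of empty cells\<close>

definition walk_from :: "nat \<Rightarrow> nat \<times> nat \<Rightarrow> (nat \<times> nat) list \<Rightarrow> bool" where
  "walk_from q x xs \<longleftrightarrow> xs \<noteq> [] \<and> hd xs = x \<and> set xs \<subseteq> grid q \<and> successively (near 3) xs"

definition walks :: "nat \<Rightarrow> nat \<times> nat \<Rightarrow> nat \<Rightarrow> (nat \<times> nat) list set" where
  "walks q x m = {xs. walk_from q x xs \<and> length xs = Suc m}"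

text \<open>A detour \<open>u, v, u\<close> covers one further cell at the cost of two steps.\<close>

lemma bad_class_walk:
  assumes x: "x \<in> grid q \<inter> B" and s: "s < card (bad_class q B x)"
  shows "\<exists>xs\<in>walks q x (2 * s). set xs \<subseteq> B \<and> card (set xs) = Suc s"
proof -
  let ?K = "bad_class q B x"
  have "\<exists>xs\<in>walks q x (2 * s). set xs \<subseteq> ?K \<and> card (set xs) = Suc s"
    using s
  proof (induction s)
    case 0
    have "[x] \<in> walks q x (2 * 0)" "set [x] \<subseteq> ?K"
      using x bad_class_self[OF x] by (auto simp: walks_def walk_from_def)
    then show ?case by (intro bexI[of _ "[x]"]) auto
  next
    case (Suc s)
    then obtain xs where xs: "xs \<in> walks q x (2 * s)" "set xs \<subseteq> ?K" "card (set xs) = Suc s"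
      by auto
    have xin: "x \<in> set xs" using xs(1) by (auto simp: walks_def walk_from_def)
    obtain w where w: "w \<in> ?K" "w \<notin> set xs"
      using xs(2,3) Suc.prems by (metis card_mono finite_set not_le subsetI)
    have "(x, w) \<in> (bad_rel q B)\<^sup>*" using w by (simp add: bad_class_def)
    then have "\<exists>u v. u \<in> set xs \<and> v \<notin> set xs \<and> v \<in> ?K \<and> near 3 u v"
      using w(2)
    proof (induction rule: rtrancl_induct)
      case base
      then show ?case using xin by simp
    next
      case (step y z)
      show ?case
      proof (cases "y \<in> set xs")
        case True
        then have "z \<in> ?K" using bad_class_step[of y q B x z] xs(2) step(2) by (auto simp: bad_rel_def)
        then show ?thesis using True step unfolding bad_rel_def by blast
      qed (use step in auto)
    qed
    then obtain u v where uv: "u \<in> set xs" "v \<notin> set xs" "v \<in> ?K" "near 3 u v" by blast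
    obtain ys zs where split: "xs = ys @ u # zs" using uv(1) by (meson split_list)
    let ?xs = "ys @ u # v # u # zs"
    have set': "set ?xs = insert v (set xs)" using split by auto
    have "successively (near 3) (ys @ u # zs)" using xs(1) split by (simp add: walks_def walk_from_def)
    then have "successively (near 3) ?xs"
      using uv(4) near_sym[OF uv(4)] by (auto simp: successively_append_iff successively_Cons)
    moreover have "hd ?xs = x" using xs(1) split by (cases ys) (auto simp: walks_def walk_from_def)
    moreover have "set ?xs \<subseteq> grid q" using set' xs(1) uv(3) by (auto simp: walks_def walk_from_def bad_class_def)
    moreover have "length ?xs = Suc (2 * Suc s)" using xs(1) split by (auto simp: walks_def)
    ultimately have "?xs \<in> walks q x (2 * Suc s)" by (simp add: walks_def walk_from_def)
    moreover have "set ?xs \<subseteq> ?K" "card (set ?xs) = Suc (Suc s)"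
      unfolding set' using xs uv by auto
    ultimately show ?case by blast
  qed
  then show ?thesis by (auto simp: bad_class_def)
qed

lemma card_near_le: "card {v. near R u v} \<le> (2 * R + 1)\<^sup>2" and finite_near: "finite {v. near R u v}"
proof -
  have sub: "{v. near R u v} \<subseteq> {fst u - R..fst u + R} \<times> {snd u - R..snd u + R}"
    by (auto simp: near_def)
  then show "finite {v. near R u v}" by (rule finite_subset) simp
  have "card {v. near R u v} \<le> card ({fst u - R..fst u + R} \<times> {snd u - R..snd u + R})"
    by (rule card_mono[OF _ sub]) simp
  also have "\<dots> \<le> (2 * R + 1) * (2 * R + 1)"
    unfolding card_cartesian_product by (intro mult_mono) auto
  finally show "card {v. near R u v} \<le> (2 * R + 1)\<^sup>2" by (simp only: power2_eq_square)
qed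

lemma walks_Suc: "walks q x (Suc m) \<subseteq> (\<lambda>(xs, v). xs @ [v]) ` (SIGMA xs:walks q x m. {v. near 3 (last xs) v})"
proof
  fix ys assume ys: "ys \<in> walks q x (Suc m)"
  obtain xs v where eq: "ys = xs @ [v]" using ys by (cases ys rule: rev_cases) (auto simp: walks_def)
  have "xs \<noteq> []" using ys eq by (auto simp: walks_def)
  then have "xs \<in> walks q x m" "near 3 (last xs) v"
    using ys eq by (auto simp: walks_def walk_from_def successively_append_iff)
  then show "ys \<in> (\<lambda>(xs, v). xs @ [v]) ` (SIGMA xs:walks q x m. {v. near 3 (last xs) v})"
    using eq by force
qed

text \<open>A step of range 3 has at most 49 = 7^2 targets.\<close>

lemma card_walks_le: "finite (walks q x m) \<and> card (walks q x m) \<le> 49 ^ m"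
proof (induction m)
  case 0
  have "walks q x 0 \<subseteq> {[x]}"
    by (auto simp: walks_def walk_from_def length_Suc_conv)
  then show ?case using card_mono[of "{[x]}" "walks q x 0"] finite_subset by auto
next
  case (Suc m)
  let ?S = "SIGMA xs:walks q x m. {v. near 3 (last xs) v}"
  have fin: "finite ?S" using Suc finite_near by auto
  have "card (walks q x (Suc m)) \<le> card ((\<lambda>(xs, v). xs @ [v]) ` ?S)"
    by (rule card_mono[OF _ walks_Suc]) (use fin in auto)
  also have "\<dots> \<le> card ?S" by (rule card_image_le[OF fin])
  also have "\<dots> = (\<Sum>xs\<in>walks q x m. card {v. near 3 (last xs) v})"
    using Suc finite_near by (subst card_SigmaI) auto
  also have "\<dots> \<le> (\<Sum>xs\<in>walks q x m. 49)"
    using card_near_le[of 3] by (intro sum_mono) simp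
  also have "\<dots> \<le> 49 ^ Suc m" using Suc by simp
  finally show ?case using finite_subset[OF walks_Suc] fin by auto
qed

text \<open>Locality of walks: it confines the cells on which \<open>empty_walk\<close> depends and
  thereby yields independence at a distance.\<close>

lemma walk_near:
  assumes "xs \<in> walks q x m" "y \<in> set xs"
  shows "near (3 * m) x y"
  using assms
proof (induction m arbitrary: xs y)
  case 0
  then show ?case by (auto simp: walks_def walk_from_def length_Suc_conv near_def)
next
  case (Suc m)
  obtain ys v where *: "xs = ys @ [v]" "ys \<in> walks q x m" "near 3 (last ys) v"
    using subsetD[OF walks_Suc Suc.prems(1)] by (elim imageE SigmaE) auto
  have "ys \<noteq> []" using *(2) by (auto simp: walks_def)
  then have "near (3 * m) x (last ys)" using Suc.IH *(2) by auto
  moreover have "near (3 * m) x y" if "y \<in> set ys" using Suc.IH *(2) that by auto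
  ultimately show ?case using Suc.prems(2) * by (auto simp: near_def)
qed

section \<open>Poisson occupation numbers of cells\<close>

definition cell_of :: "nat \<Rightarrow> nat \<Rightarrow> real \<times> real \<Rightarrow> nat \<times> nat" where
  "cell_of n q p = (nat \<lfloor>(fst p + sqrt n / 2) / (sqrt n / q)\<rfloor>, nat \<lfloor>(snd p + sqrt n / 2) / (sqrt n / q)\<rfloor>)"

text \<open>The restriction to \<open>torus_box n\<close> matters because \<open>nat\<close> maps
  the negative indices left of and below the square to 0.\<close>

definition cell_box :: "nat \<Rightarrow> nat \<Rightarrow> nat \<times> nat \<Rightarrow> (real \<times> real) set" where
  "cell_box n q v = {p \<in> torus_box n. cell_of n q p = v}"

lemma cell_coord:
  fixes s x :: real
  assumes "0 < s" "0 < q"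
  shows "-s/2 \<le> x \<and> x < s/2 \<and> nat \<lfloor>(x + s/2) / (s / real q)\<rfloor> = i \<longleftrightarrow>
    i < q \<and> - s/2 + real i * (s / q) \<le> x \<and> x < - s/2 + (real i + 1) * (s / q)"
proof -
  define y where "y = (x + s/2) / (s / q)"
  have sq: "s / q > 0" using assms by simp
  have x: "x = - s/2 + y * (s/q)" using sq assms by (simp add: y_def)
  have s: "s/2 = - s/2 + q * (s/q)" using assms by (simp add: field_simps)
  have 1: "-s/2 \<le> x \<longleftrightarrow> 0 \<le> y" unfolding x using sq mult_le_cancel_right_pos[OF sq, of 0 y] by simp
  have 2: "x < s/2 \<longleftrightarrow> y < q" unfolding x
    by (subst s) (use sq in \<open>simp only: add_less_cancel_left mult_less_cancel_right_pos\<close>)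
  have 3: "- s/2 + real i * (s / q) \<le> x \<longleftrightarrow> i \<le> y" unfolding x
    using mult_le_cancel_right_pos[OF sq, of "real i" y] by linarith
  have 4: "x < - s/2 + (real i + 1) * (s / q) \<longleftrightarrow> y < i + 1" unfolding x
    using mult_less_cancel_right_pos[OF sq, of y "real i + 1"] by linarith
  have "0 \<le> y \<and> y < q \<and> nat \<lfloor>y\<rfloor> = i \<longleftrightarrow> i < q \<and> i \<le> y \<and> y < i + 1"
    by (safe; linarith)
  then show ?thesis unfolding 1 2 3 4 y_def[symmetric] .
qed

lemma cell_box_eq:
  assumes "0 < n" "0 < q"
  shows "cell_box n q (i, j) = (if (i, j) \<in> grid q then
     {- sqrt n / 2 + real i * (sqrt n / q) ..< - sqrt n / 2 + (real i + 1) * (sqrt n / q)} \<times>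
     {- sqrt n / 2 + real j * (sqrt n / q) ..< - sqrt n / 2 + (real j + 1) * (sqrt n / q)} else {})"
proof -
  have s: "sqrt n > 0" using assms by simp
  have "p \<in> cell_box n q (i, j) \<longleftrightarrow>
      (-sqrt n/2 \<le> fst p \<and> fst p < sqrt n/2 \<and> nat \<lfloor>(fst p + sqrt n/2) / (sqrt n / real q)\<rfloor> = i) \<and>
      (-sqrt n/2 \<le> snd p \<and> snd p < sqrt n/2 \<and> nat \<lfloor>(snd p + sqrt n/2) / (sqrt n / real q)\<rfloor> = j)" for p
    by (cases p) (auto simp: cell_box_def torus_box_def cell_of_def)
  then have "p \<in> cell_box n q (i, j) \<longleftrightarrow>
     (i < q \<and> - sqrt n/2 + real i * (sqrt n / q) \<le> fst p \<and> fst p < - sqrt n/2 + (real i + 1) * (sqrt n / q)) \<and>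
     (j < q \<and> - sqrt n/2 + real j * (sqrt n / q) \<le> snd p \<and> snd p < - sqrt n/2 + (real j + 1) * (sqrt n / q))" for p
    unfolding cell_coord[OF s assms(2)] .
  then show ?thesis by (intro set_eqI) (auto simp: grid_def)
qed

lemma cell_of_in_grid:
  assumes "0 < n" "0 < q" "p \<in> torus_box n"
  shows "cell_of n q p \<in> grid q"
proof -
  have "p \<in> cell_box n q (cell_of n q p)" using assms(3) by (simp add: cell_box_def)
  then show ?thesis using cell_box_eq[OF assms(1,2), of "fst (cell_of n q p)" "snd (cell_of n q p)"]
    by (auto split: if_splits)
qed

section \<open>The law of the occupation numbers\<close>

lemma sets_interval_times [measurable]: "{a..<b} \<times> {c..<d} \<in> sets (lborel :: (real \<times> real) measure)"
  by (simp flip: borel_prod)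

lemma emeasure_interval_times:
  assumes "a \<le> b" "c \<le> d"
  shows "emeasure lborel ({a..<b} \<times> {c..<d} :: (real \<times> real) set) = ennreal ((b - a) * (d - c))"
proof -
  have "emeasure (lborel \<Otimes>\<^sub>M lborel) ({a..<b} \<times> {c..<d}) = emeasure lborel {a..<b} * emeasure lborel {c..<d}"
    by (rule lborel.emeasure_pair_measure_Times) auto
  then show ?thesis using assms by (simp add: lborel_prod ennreal_mult)
qed

lemma sets_torus_box [measurable]: "torus_box n \<in> sets lborel"
  unfolding torus_box_def by (rule sets_interval_times)

lemma emeasure_torus_box: "emeasure lborel (torus_box n) = ennreal n"
  unfolding torus_box_def by (subst emeasure_interval_times) simp_all

lemma prob_space_uniform_torus:
  assumes "0 < n"
  shows "prob_space (uniform_measure lborel (torus_box n))"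
  by (rule prob_space_uniform_measure) (use assms in \<open>auto simp: emeasure_torus_box\<close>)

lemma prob_space_unif_points:
  assumes "0 < n"
  shows "prob_space (unif_points n k)"
  unfolding unif_points_def using prob_space_uniform_torus[OF assms] by (intro prob_space_PiM)

lemma measure_uniform_cell:
  assumes "0 < n" "0 < q" "v \<in> grid q"
  shows "emeasure (uniform_measure lborel (torus_box n)) (cell_box n q v) = ennreal (1 / (real q)\<^sup>2)"
    and "cell_box n q v \<in> sets lborel"
proof -
  obtain i j where v: "v = (i, j)" by force
  have eq: "cell_box n q v = {- sqrt n / 2 + real i * (sqrt n / q) ..< - sqrt n / 2 + (real i + 1) * (sqrt n / q)} \<times>
     {- sqrt n / 2 + real j * (sqrt n / q) ..< - sqrt n / 2 + (real j + 1) * (sqrt n / q)}"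
    using cell_box_eq[OF assms(1,2), of i j] assms(3) v by simp
  show m: "cell_box n q v \<in> sets lborel" unfolding eq by (rule sets_interval_times)
  have le: "- sqrt n / 2 + real i * (sqrt n / q) \<le> - sqrt n / 2 + (real i + 1) * (sqrt n / q)" for i
    by (intro add_left_mono mult_right_mono) auto
  have diff: "(- sqrt n / 2 + (real i + 1) * (sqrt n / q)) - (- sqrt n / 2 + real i * (sqrt n / q)) = sqrt n / q" for i
    by (simp add: distrib_right add_divide_distrib)
  have "emeasure lborel (cell_box n q v) = ennreal (sqrt n / q * (sqrt n / q))"
    unfolding eq by (subst emeasure_interval_times[OF le le]) (simp only: diff)
  also have "sqrt n / q * (sqrt n / q) = real n / (real q)\<^sup>2"
    by (simp add: power2_eq_square)
  finally have e: "emeasure lborel (cell_box n q v) = ennreal (real n / (real q)\<^sup>2)" .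
  have "torus_box n \<inter> cell_box n q v = cell_box n q v" by (auto simp: cell_box_def)
  then show "emeasure (uniform_measure lborel (torus_box n)) (cell_box n q v) = ennreal (1 / (real q)\<^sup>2)"
    using assms m e
    by (subst emeasure_uniform_measure) (simp_all add: sets_torus_box[simplified] emeasure_torus_box divide_ennreal)
qed

definition cell_lists :: "nat \<Rightarrow> nat \<Rightarrow> (nat \<times> nat) list set" where
  "cell_lists q k = {xs. set xs \<subseteq> grid q \<and> length xs = k}"

definition counts :: "nat \<Rightarrow> nat \<Rightarrow> nat \<Rightarrow> (nat \<Rightarrow> real \<times> real) \<Rightarrow> nat \<times> nat \<Rightarrow> nat" where
  "counts n q k \<omega> = count (mset (map (\<lambda>i. cell_of n q (\<omega> i)) [0..<k]))"

text \<open>The product measure lives on the whole plane; requiring all points in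
  \<open>torus_box n\<close> discards a null set on which cell indices are meaningless.\<close>

definition box_event :: "nat \<Rightarrow> nat \<Rightarrow> nat \<Rightarrow> ((nat \<times> nat \<Rightarrow> nat) \<Rightarrow> bool) \<Rightarrow> (nat \<Rightarrow> real \<times> real) set" where
  "box_event n q k F = {\<omega> \<in> space (unif_points n k). (\<forall>i<k. \<omega> i \<in> torus_box n) \<and> F (counts n q k \<omega>)}"

definition count_law :: "nat \<Rightarrow> nat \<Rightarrow> (nat \<times> nat \<Rightarrow> nat) pmf" where
  "count_law n q = Pi_pmf (grid q) 0 (\<lambda>_. poisson_pmf (real n / (real q)\<^sup>2))"

lemma finite_cell_lists [simp]: "finite (cell_lists q k)"
  unfolding cell_lists_def by (rule finite_lists_length_eq) simp

text \<open>The event is a disjoint union, over finitely many lists of cells, of product boxes of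
  mass \<open>1 / q\<^sup>2\<close> per point. This makes it measurable whatever \<open>F\<close>
  is.\<close>

lemma measure_box_event:
  assumes "0 < n" "0 < q"
  shows "box_event n q k F \<in> sets (unif_points n k)"
    and "measure (unif_points n k) (box_event n q k F) =
      card {xs \<in> cell_lists q k. F (count (mset xs))} * (1 / (real q)\<^sup>2) ^ k"
proof -
  interpret U: prob_space "uniform_measure lborel (torus_box n)"
    by (rule prob_space_uniform_torus[OF assms(1)])
  interpret PU: product_prob_space "\<lambda>_. uniform_measure lborel (torus_box n)" "{..<k}"
    by unfold_locales
  interpret M: prob_space "unif_points n k" by (rule prob_space_unif_points[OF assms(1)])
  let ?L = "{xs \<in> cell_lists q k. F (count (mset xs))}"
  define E where "E = (\<lambda>xs. PiE {..<k} (\<lambda>i. cell_box n q (xs ! i)))"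
  have mem: "xs ! i \<in> grid q" if "xs \<in> cell_lists q k" "i < k" for xs i
    using that nth_mem[of i xs] by (auto simp: cell_lists_def)
  have E_sets: "E xs \<in> sets (unif_points n k)" if "xs \<in> cell_lists q k" for xs
    unfolding E_def unif_points_def
    by (rule sets_PiM_I_finite) (use measure_uniform_cell(2)[OF assms mem[OF that]] in auto)
  have E_meas: "measure (unif_points n k) (E xs) = (1 / (real q)\<^sup>2) ^ k" if "xs \<in> cell_lists q k" for xs
  proof -
    have "emeasure (unif_points n k) (E xs) =
        (\<Prod>i<k. emeasure (uniform_measure lborel (torus_box n)) (cell_box n q (xs ! i)))"
      unfolding E_def unif_points_def
      by (rule PU.emeasure_PiM) (use measure_uniform_cell(2)[OF assms mem[OF that]] in auto)
    also have "\<dots> = (\<Prod>i<k. ennreal (1 / (real q)\<^sup>2))"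
      by (intro prod.cong refl measure_uniform_cell(1)[OF assms] mem[OF that]) auto
    also have "\<dots> = ennreal ((1 / (real q)\<^sup>2) ^ k)" by (simp add: ennreal_power)
    finally show ?thesis by (simp add: measure_def)
  qed
  have eq: "box_event n q k F = (\<Union>xs\<in>?L. E xs)"
  proof (intro equalityI subsetI)
    fix \<omega> assume \<omega>: "\<omega> \<in> box_event n q k F"
    define xs where "xs = map (\<lambda>i. cell_of n q (\<omega> i)) [0..<k]"
    have "cell_of n q (\<omega> i) \<in> grid q" if "i < k" for i
      using \<omega> that by (intro cell_of_in_grid[OF assms]) (auto simp: box_event_def)
    then have "set xs \<subseteq> grid q" by (auto simp: xs_def simp del: split_paired_All)
    then have "xs \<in> ?L" using \<omega>
      by (simp add: box_event_def cell_lists_def xs_def counts_def)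
    moreover have "\<omega> \<in> E xs"
      using \<omega> by (auto simp: box_event_def E_def xs_def cell_box_def unif_points_def space_PiM PiE_def extensional_def)
    ultimately show "\<omega> \<in> (\<Union>xs\<in>?L. E xs)" by blast
  next
    fix \<omega> assume "\<omega> \<in> (\<Union>xs\<in>?L. E xs)"
    then obtain xs where xs: "xs \<in> ?L" "\<omega> \<in> E xs" by blast
    have cells: "\<omega> i \<in> torus_box n \<and> cell_of n q (\<omega> i) = xs ! i" if "i < k" for i
      using xs(2) that by (auto simp: E_def cell_box_def PiE_def Pi_def)
    have "map (\<lambda>i. cell_of n q (\<omega> i)) [0..<k] = xs"
      using cells xs(1) by (intro nth_equalityI) (auto simp: cell_lists_def)
    then show "\<omega> \<in> box_event n q k F"
      using xs cells by (auto simp: box_event_def counts_def E_def unif_points_def space_PiM PiE_def)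
  qed
  show "box_event n q k F \<in> sets (unif_points n k)"
    unfolding eq using E_sets by (intro sets.finite_UN) auto
  have disj: "disjoint_family_on E ?L"
    unfolding disjoint_family_on_def
  proof (intro ballI impI equals0I)
    fix xs ys \<omega> assume *: "xs \<in> ?L" "ys \<in> ?L" "xs \<noteq> ys" "\<omega> \<in> E xs \<inter> E ys"
    then have "xs ! i = ys ! i" if "i < k" for i
      using that by (auto simp: E_def cell_box_def PiE_def Pi_def)
    then show False using * by (auto simp: cell_lists_def intro: nth_equalityI)
  qed
  have "measure (unif_points n k) (box_event n q k F) = (\<Sum>xs\<in>?L. measure (unif_points n k) (E xs))"
    unfolding eq by (rule M.finite_measure_finite_Union[OF _ _ disj]) (use E_sets in auto)
  also have "\<dots> = card ?L * (1 / (real q)\<^sup>2) ^ k" by (simp add: E_meas)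
  finally show "measure (unif_points n k) (box_event n q k F) = card ?L * (1 / (real q)\<^sup>2) ^ k" .
qed

text \<open>The multinomial identity behind Poisson splitting: the product of the factorials of the
  counts is \<open>fact (size A)\<close> divided by the number of orderings of \<open>A\<close>, so
  the product of Poisson weights is the Poisson(n) weight of the total times the probability of
  \<open>A\<close> for uniform cells.\<close>

lemma pmf_count_law:
  assumes "0 < n" "0 < q" "set_mset A \<subseteq> grid q"
  shows "pmf (count_law n q) (count A) =
    exp (- real n) * real n ^ size A / fact (size A) * (card (permutations_of_multiset A) * (1 / (real q)\<^sup>2) ^ size A)"
proof -
  let ?a = "real n / (real q)\<^sup>2"
  have a: "?a > 0" using assms by simp
  have "pmf (count_law n q) (count A) = (\<Prod>v\<in>grid q. ?a ^ count A v / fact (count A v) * exp (- ?a))"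
    unfolding count_law_def
    by (subst pmf_Pi') (use assms a in \<open>auto simp: not_in_iff[symmetric] simp del: divide_divide_eq_left\<close>)
  also have "\<dots> = (\<Prod>v\<in>grid q. ?a ^ count A v) / (\<Prod>v\<in>grid q. fact (count A v)) * (\<Prod>v\<in>grid q. exp (- ?a))"
    by (simp only: prod.distrib prod_dividef)
  also have "(\<Prod>v\<in>grid q. exp (- ?a)) = exp (- real n)"
    using assms by (simp add: exp_of_nat_mult[symmetric] card_grid power2_eq_square)
  also have "(\<Prod>v\<in>grid q. ?a ^ count A v) = ?a ^ (\<Sum>v\<in>grid q. count A v)"
    by (rule power_sum[symmetric])
  also have "(\<Sum>v\<in>grid q. count A v) = size A"
    unfolding size_multiset_overloaded_eq
    by (rule sum.mono_neutral_right) (use assms in \<open>auto simp: not_in_iff\<close>)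
  also have "(\<Prod>v\<in>grid q. fact (count A v) :: real) = (\<Prod>v\<in>set_mset A. fact (count A v))"
    by (rule prod.mono_neutral_right) (use assms in \<open>auto simp: not_in_iff\<close>)
  also have "\<dots> = fact (size A) / card (permutations_of_multiset A)"
  proof -
    have "real (card (permutations_of_multiset A) * (\<Prod>x\<in>set_mset A. fact (count A x))) = real (fact (size A))"
      by (subst card_permutations_of_multiset_aux) simp
    then have eq: "real (card (permutations_of_multiset A)) * (\<Prod>v\<in>set_mset A. fact (count A v)) = fact (size A)"
      by simp
    then have "real (card (permutations_of_multiset A)) \<noteq> 0" by (auto simp: eq_commute[of 0])
    then show ?thesis using eq by (simp add: field_simps)
  qed
  finally show ?thesis by (simp add: power_divide power_one_over field_simps)
qed

text \<open>For each total number of points the lists of cells are grouped by their multiset, which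
  is the same as a count function. The series form lets the result be combined termwise with
  \<open>ppp_prob\<close>.\<close>

lemma poisson_splitting:
  assumes "0 < n" "0 < q"
  shows "(\<lambda>k. exp (- real n) * real n ^ k / fact k * measure (unif_points n k) (box_event n q k F))
    sums measure_pmf.prob (count_law n q) {c. F c}"
proof -
  let ?p = "count_law n q"
  define N where "N = (\<lambda>k. {c. F c \<and> (\<Sum>v\<in>grid q. c v) = k})"
  have "exp (- real n) * real n ^ k / fact k * measure (unif_points n k) (box_event n q k F) = measure_pmf.prob ?p (N k)" for k
  proof -
    define As where "As = {A \<in> mset ` cell_lists q k. F (count A)}"
    have As: "set_mset A \<subseteq> grid q" "size A = k" "F (count A)" if "A \<in> As" for A
      using that by (auto simp: As_def cell_lists_def)
    have fin: "finite As" by (simp add: As_def)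
    have lists_eq: "{xs \<in> cell_lists q k. F (count (mset xs))} = (\<Union>A\<in>As. permutations_of_multiset A)"
    proof (intro equalityI subsetI)
      fix xs assume "xs \<in> (\<Union>A\<in>As. permutations_of_multiset A)"
      then have "mset xs \<in> As" by (auto simp: permutations_of_multiset_def)
      from As[OF this] show "xs \<in> {xs \<in> cell_lists q k. F (count (mset xs))}"
        by (auto simp: cell_lists_def)
    qed (auto simp: As_def permutations_of_multiset_def)
    have "card {xs \<in> cell_lists q k. F (count (mset xs))} = (\<Sum>A\<in>As. card (permutations_of_multiset A))"
      unfolding lists_eq by (rule card_UN_disjoint) (use fin in \<open>auto dest: permutations_of_multisetD\<close>)
    then have "exp (- real n) * real n ^ k / fact k * measure (unif_points n k) (box_event n q k F) =
        (\<Sum>A\<in>As. exp (- real n) * real n ^ k / fact k * (card (permutations_of_multiset A) * (1 / (real q)\<^sup>2) ^ k))"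
      by (simp add: measure_box_event[OF assms] sum_distrib_left sum_distrib_right mult.assoc)
    also have "\<dots> = (\<Sum>A\<in>As. pmf ?p (count A))"
      by (rule sum.cong) (use As pmf_count_law[OF assms] in auto)
    also have "\<dots> = (\<Sum>c\<in>count ` As. pmf ?p c)"
      by (subst sum.reindex) (auto simp: inj_on_def multiset_eq_iff fun_eq_iff)
    also have "\<dots> = measure_pmf.prob ?p (count ` As)"
      by (rule measure_measure_pmf_finite[symmetric]) (use fin in auto)
    \<comment> \<open>\<open>N k\<close> also contains functions that are nonzero outside the grid.
      They are no counts of multisets of cells, but \<open>Pi_pmf\<close> with default value 0 gives
      them mass 0.\<close>
    also have "\<dots> = measure_pmf.prob ?p (N k)"
    proof (rule measure_prob_cong_0)
      fix c assume c: "c \<in> count ` As - N k"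
      then obtain A where A: "A \<in> As" "c = count A" by auto
      have "(\<Sum>v\<in>grid q. count A v) = size A"
        unfolding size_multiset_overloaded_eq
        by (rule sum.mono_neutral_right) (use As(1)[OF A(1)] in \<open>auto simp: not_in_iff\<close>)
      then have "c \<in> N k" using A As[OF A(1)] by (simp add: N_def)
      then show "pmf ?p c = 0" using c by simp
    next
      fix c assume c: "c \<in> N k - count ` As"
      show "pmf ?p c = 0"
      proof (rule ccontr)
        assume "pmf ?p c \<noteq> 0"
        then have out: "\<forall>v. v \<notin> grid q \<longrightarrow> c v = 0"
          by (auto simp: count_law_def pmf_Pi split: if_splits)
        have "{v. c v > 0} \<subseteq> grid q" using out by (metis (mono_tags, lifting) mem_Collect_eq neq0_conv subsetI)
        then have "finite {v. c v > 0}" by (rule finite_subset) simp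
        then have cnt: "count (Abs_multiset c) = c" by (rule count_Abs_multiset)
        define A where "A = Abs_multiset c"
        have sub: "set_mset A \<subseteq> grid q"
        proof
          fix v assume "v \<in># A"
          then have "c v \<noteq> 0" using cnt by (metis A_def count_eq_zero_iff)
          then show "v \<in> grid q" using out by metis
        qed
        have "size A = (\<Sum>v\<in>grid q. count A v)"
          unfolding size_multiset_overloaded_eq
          by (rule sum.mono_neutral_left) (use sub in \<open>auto simp: not_in_iff\<close>)
        then have "size A = k" using c cnt by (simp add: A_def N_def)
        obtain xs where xs: "mset xs = A" using ex_mset by blast
        then have "xs \<in> cell_lists q k" using sub \<open>size A = k\<close> by (auto simp: cell_lists_def)
        then have "A \<in> mset ` cell_lists q k" using xs by blast
        moreover have "F (count A)" using c cnt by (simp add: A_def N_def)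
        ultimately have "A \<in> As" by (simp add: As_def)
        then show False using c cnt by (metis A_def DiffE image_eqI)
      qed
    qed
    finally show ?thesis .
  qed
  moreover have "(\<lambda>k. measure_pmf.prob ?p (N k)) sums measure_pmf.prob ?p (\<Union>k. N k)"
    by (rule measure_pmf.finite_measure_UNION) (auto simp: N_def disjoint_family_on_def)
  moreover have "(\<Union>k. N k) = {c. F c}" by (auto simp: N_def)
  ultimately show ?thesis by simp
qed

section \<open>From occupation numbers to the point process\<close>

lemma poisson_weights_sums: "(\<lambda>k. exp (- real n) * real n ^ k / fact k) sums 1"
proof -
  have "(\<lambda>k. exp (- real n) * (real n ^ k /\<^sub>R fact k)) sums (exp (- real n) * exp (real n))"
    by (intro sums_mult exp_converges)
  then show ?thesis by (simp add: exp_minus field_simps)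
qed

definition ppp_term :: "nat \<Rightarrow> ((real \<times> real) set \<Rightarrow> bool) \<Rightarrow> nat \<Rightarrow> real" where
  "ppp_term n P k = exp (- real n) * real n ^ k / fact k *
        measure (unif_points n k) {\<omega> \<in> space (unif_points n k). P (\<omega> ` {..<k})}"

lemma ppp_term_bounds:
  assumes "0 < n"
  shows "0 \<le> ppp_term n P k" "ppp_term n P k \<le> exp (- real n) * real n ^ k / fact k"
proof -
  interpret prob_space "unif_points n k" by (rule prob_space_unif_points[OF assms])
  show "0 \<le> ppp_term n P k" by (simp add: ppp_term_def)
  show "ppp_term n P k \<le> exp (- real n) * real n ^ k / fact k"
    unfolding ppp_term_def by (intro mult_left_le) auto
qed

lemma ppp_term_sums:
  assumes "0 < n"
  shows "ppp_term n P sums ppp_prob n P"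
proof -
  have "summable (ppp_term n P)"
    by (rule summable_comparison_test'[OF sums_summable[OF poisson_weights_sums[of n]], of 0])
       (use ppp_term_bounds[OF assms] in auto)
  then show ?thesis by (simp add: summable_sums ppp_prob_def ppp_term_def[abs_def])
qed

lemma ppp_prob_le_1:
  assumes "0 < n"
  shows "ppp_prob n P \<le> 1"
  by (rule sums_le[OF _ ppp_term_sums[OF assms] poisson_weights_sums[of n]])
     (use ppp_term_bounds[OF assms] in auto)

text \<open>Only an inequality for the number of points: coincident sample points collapse in the
  vertex set but are counted separately. Emptiness of a cell is unaffected by this.\<close>

definition cell_counts_of :: "nat \<Rightarrow> nat \<Rightarrow> (real \<times> real) set \<Rightarrow> (nat \<times> nat \<Rightarrow> nat) \<Rightarrow> bool" where
  "cell_counts_of n q V c \<longleftrightarrow> finite V \<and> V \<subseteq> torus_box n \<and>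
     (\<forall>v. card {p \<in> V. cell_of n q p = v} \<le> c v) \<and> (\<forall>v. c v = 0 \<longleftrightarrow> (\<forall>p\<in>V. cell_of n q p \<noteq> v))"

lemma counts_cell_counts_of:
  assumes "\<forall>i<k. \<omega> i \<in> torus_box n"
  shows "cell_counts_of n q (\<omega> ` {..<k}) (counts n q k \<omega>)"
proof -
  have cnt: "counts n q k \<omega> v = card {i \<in> {..<k}. cell_of n q (\<omega> i) = v}" for v
  proof -
    have "counts n q k \<omega> v = length (filter (\<lambda>i. cell_of n q (\<omega> i) = v) [0..<k])"
      unfolding counts_def count_mset count_list_eq_length_filter filter_map length_map comp_def
      by (simp only: eq_commute[of v])
    also have "\<dots> = card (set (filter (\<lambda>i. cell_of n q (\<omega> i) = v) [0..<k]))"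
      by (rule distinct_card[symmetric]) simp
    finally show ?thesis by (simp add: atLeast0LessThan lessThan_def Collect_conj_eq[symmetric])
  qed
  have "card {p \<in> \<omega> ` {..<k}. cell_of n q p = v} \<le> card {i \<in> {..<k}. cell_of n q (\<omega> i) = v}" for v
  proof -
    have "{p \<in> \<omega> ` {..<k}. cell_of n q p = v} = \<omega> ` {i \<in> {..<k}. cell_of n q (\<omega> i) = v}" by auto
    then show ?thesis using card_image_le[of "{i \<in> {..<k}. cell_of n q (\<omega> i) = v}" \<omega>] by simp
  qed
  then show ?thesis using assms unfolding cell_counts_of_def cnt by auto
qed

text \<open>The bridge from discrete estimates to \<open>ppp_prob\<close>: the bound P(G and F)
  \<ge> P(G) + P(F) - 1 for each number of points, summed against the Poisson weights.\<close>

lemma ppp_prob_lower_bound: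
  assumes "0 < n" "0 < q"
    and meas: "\<And>k. {\<omega> \<in> space (unif_points n k). P (\<omega> ` {..<k})} \<in> sets (unif_points n k)"
    and imp: "\<And>V c. cell_counts_of n q V c \<Longrightarrow> F c \<Longrightarrow> G V \<Longrightarrow> P V"
  shows "ppp_prob n P \<ge> ppp_prob n G + measure_pmf.prob (count_law n q) {c. F c} - 1"
proof -
  define w where "w = (\<lambda>k. exp (- real n) * real n ^ k / fact k)"
  have w: "w k \<ge> 0" for k by (simp add: w_def)
  have le: "ppp_term n G k + w k * measure (unif_points n k) (box_event n q k F) - w k \<le> ppp_term n P k" for k
  proof -
    interpret M: prob_space "unif_points n k" by (rule prob_space_unif_points[OF assms(1)])
    let ?G = "{\<omega> \<in> space (unif_points n k). G (\<omega> ` {..<k})}"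
    let ?P = "{\<omega> \<in> space (unif_points n k). P (\<omega> ` {..<k})}"
    let ?F = "box_event n q k F"
    have sub: "?G \<inter> ?F \<subseteq> ?P"
      using imp[OF counts_cell_counts_of[of k _ n q]] by (auto simp: box_event_def)
    have F: "?F \<in> M.events" by (rule measure_box_event[OF assms(1,2)])
    have "M.prob ?G + M.prob ?F - 1 \<le> M.prob ?P"
    proof (cases "?G \<in> M.events")
      case True
      have "M.prob ?G + M.prob ?F = M.prob (?G \<union> ?F) + M.prob (?G \<inter> ?F)"
        using measure_Un3[of ?G "unif_points n k" ?F] True F by (simp add: M.fmeasurable_eq_sets)
      then show ?thesis using M.finite_measure_mono[OF sub meas] M.prob_le_1[of "?G \<union> ?F"] by linarith
    next
      \<comment> \<open>A nonmeasurable set has \<open>measure\<close> 0, so in this case the bound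
        reduces to P(F) \<le> 1.\<close>
      case False
      then have "M.prob ?G = 0" by (rule measure_notin_sets)
      then show ?thesis using M.prob_le_1[of ?F] measure_nonneg[of "unif_points n k" ?P] by linarith
    qed
    then have "w k * (M.prob ?G + M.prob ?F - 1) \<le> w k * M.prob ?P" by (rule mult_left_mono[OF _ w])
    then show ?thesis by (simp add: ppp_term_def w_def algebra_simps)
  qed
  have "(\<lambda>k. ppp_term n G k + w k * measure (unif_points n k) (box_event n q k F) - w k) sums
      (ppp_prob n G + measure_pmf.prob (count_law n q) {c. F c} - 1)"
    unfolding w_def
    by (intro sums_diff sums_add ppp_term_sums poisson_splitting poisson_weights_sums assms)
  from sums_le[OF le this ppp_term_sums[OF assms(1)]] show ?thesis .
qed

section \<open>Tails, square sums and independence of the counts\<close>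

lemma poisson_mgf:
  fixes a t :: real
  assumes "0 < a"
  shows "integrable (poisson_pmf a) (\<lambda>c. exp (t * real c))"
    and "measure_pmf.expectation (poisson_pmf a) (\<lambda>c. exp (t * real c)) = exp (a * (exp t - 1))"
proof -
  have sums: "(\<lambda>c. pmf (poisson_pmf a) c * exp (t * real c)) sums exp (a * (exp t - 1))"
  proof -
    have "(\<lambda>c. exp (- a) * ((a * exp t) ^ c /\<^sub>R fact c)) sums (exp (- a) * exp (a * exp t))"
      by (intro sums_mult exp_converges)
    also have "exp (- a) * exp (a * exp t) = exp (a * (exp t - 1))"
      by (simp add: exp_add[symmetric] algebra_simps)
    also have "(\<lambda>c. exp (- a) * ((a * exp t) ^ c /\<^sub>R fact c)) = (\<lambda>c. pmf (poisson_pmf a) c * exp (t * real c))"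
      using assms by (auto simp: fun_eq_iff power_mult_distrib exp_of_nat2_mult[symmetric] field_simps)
    finally show ?thesis .
  qed
  have "(\<integral>\<^sup>+c. ennreal (exp (t * real c)) \<partial>measure_pmf (poisson_pmf a)) =
      (\<integral>\<^sup>+c. ennreal (pmf (poisson_pmf a) c * exp (t * real c)) \<partial>count_space UNIV)"
    by (simp add: nn_integral_measure_pmf ennreal_mult)
  also have "\<dots> = (\<Sum>c. ennreal (pmf (poisson_pmf a) c * exp (t * real c)))"
    by (rule nn_integral_count_space_nat)
  also have "\<dots> = ennreal (exp (a * (exp t - 1)))"
    by (rule suminf_ennreal_eq[OF _ sums]) simp
  finally have nn: "(\<integral>\<^sup>+c. ennreal (exp (t * real c)) \<partial>measure_pmf (poisson_pmf a)) = ennreal (exp (a * (exp t - 1)))" .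
  show int: "integrable (poisson_pmf a) (\<lambda>c. exp (t * real c))"
    by (rule integrableI_nn_integral_finite[OF _ _ nn]) auto
  show "measure_pmf.expectation (poisson_pmf a) (\<lambda>c. exp (t * real c)) = exp (a * (exp t - 1))"
    using nn_integral_eq_integral[OF int] nn by simp
qed

lemma poisson_tail:
  assumes "0 < a"
  shows "measure_pmf.prob (poisson_pmf a) {c. real c \<ge> M} \<le> exp (a * (exp 1 - 1) - M)"
proof -
  have "measure_pmf.prob (poisson_pmf a) {c. real c \<ge> M} =
      measure_pmf.prob (poisson_pmf a) {c \<in> space (poisson_pmf a). exp (1 * real c) \<ge> exp M}"
    by simp
  also have "\<dots> \<le> measure_pmf.expectation (poisson_pmf a) (\<lambda>c. exp (1 * real c)) / exp M"
    by (rule integral_Markov_inequality_measure[where A = "{}"]) (use poisson_mgf(1)[OF assms, of 1] in auto)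
  also have "\<dots> = exp (a * (exp 1 - 1) - M)"
    unfolding poisson_mgf(2)[OF assms] by (simp add: exp_diff)
  finally show ?thesis .
qed

context
  fixes n q :: nat and a :: real
  assumes n: "0 < n" and q: "0 < q"
  defines "a \<equiv> real n / (real q)\<^sup>2"
begin

lemma cell_mean_pos: "0 < a"
  using n q by (simp add: a_def)

lemma count_law_eq: "count_law n q = Pi_pmf (grid q) 0 (\<lambda>_. poisson_pmf a)"
  by (simp add: count_law_def a_def)

lemma prob_large_count:
  "measure_pmf.prob (count_law n q) {c. \<exists>v\<in>grid q. real (c v) \<ge> M} \<le> (real q)\<^sup>2 * exp (a * (exp 1 - 1) - M)"
proof -
  have one: "measure_pmf.prob (count_law n q) {c. real (c v) \<ge> M} \<le> exp (a * (exp 1 - 1) - M)"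
    if "v \<in> grid q" for v
  proof -
    have "measure_pmf.prob (count_law n q) {c. real (c v) \<ge> M} =
        measure_pmf.prob (map_pmf (\<lambda>c. c v) (count_law n q)) {c. real c \<ge> M}"
      by (simp add: vimage_def)
    also have "map_pmf (\<lambda>c. c v) (count_law n q) = poisson_pmf a"
      using that by (simp add: count_law_eq Pi_pmf_component)
    finally show ?thesis using poisson_tail[OF cell_mean_pos] by simp
  qed
  have "{c. \<exists>v\<in>grid q. real (c v) \<ge> M} = (\<Union>v\<in>grid q. {c. real (c v) \<ge> M})" by auto
  then have "measure_pmf.prob (count_law n q) {c. \<exists>v\<in>grid q. real (c v) \<ge> M} \<le>
      (\<Sum>v\<in>grid q. measure_pmf.prob (count_law n q) {c. real (c v) \<ge> M})"
    by (simp add: measure_pmf.finite_measure_subadditive_finite)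
  also have "\<dots> \<le> (\<Sum>v\<in>grid q. exp (a * (exp 1 - 1) - M))"
    by (intro sum_mono one)
  finally show ?thesis by (simp add: card_grid power2_eq_square)
qed

text \<open>For \<open>c \<le> M\<close> one has \<open>c\<^sup>2 / M \<le> c\<close>, which makes the exponential moment of the truncated square finite,
  and \<open>exp x \<le> 1 + x exp x\<close> shows that it exceeds 1 only by \<open>O(1/M)\<close>.\<close>

lemma prob_large_square_sum:
  assumes T: "T \<subseteq> grid q" and M: "0 < M"
  defines "K \<equiv> 2 * exp (a * (exp 2 - 1))"
  shows "measure_pmf.prob (count_law n q)
      {c. (\<forall>v\<in>T. real (c v) \<le> M) \<and> (\<Sum>v\<in>T. (real (c v))\<^sup>2) \<ge> K * card T + M * x} \<le> exp (- x)"
proof -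
  \<comment> \<open>Above \<open>M\<close> the factor is reset to 1, because
    \<open>exp (c\<^sup>2 / M)\<close> has infinite expectation under a Poisson law. On the event in
    question no cell of \<open>T\<close> exceeds \<open>M\<close>, and the product over the grid is
    the exponential of the square sum divided by \<open>M\<close>.\<close>
  define f where "f = (\<lambda>v (c::nat). if v \<in> T \<and> real c \<le> M then exp ((real c)\<^sup>2 / M) else 1)"
  define g where "g = (\<lambda>c::nat. 1 + 2 / M * exp (2 * real c))"
  have f1: "1 \<le> f v c" for v c using M by (simp add: f_def)
  have fg: "f v c \<le> g c" for v c
  proof (cases "v \<in> T \<and> real c \<le> M")
    case True
    define y where "y = (real c)\<^sup>2 / M"
    have y0: "0 \<le> y" using M by (simp add: y_def)
    have yc: "y \<le> real c"
      using True M mult_left_mono[of "real c" M "real c"] by (simp add: y_def power2_eq_square divide_le_eq)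
    have "1 + (- y) \<le> exp (- y)" by (rule exp_ge_add_one_self)
    then have "(1 - y) * exp y \<le> exp (- y) * exp y" by (intro mult_right_mono) auto
    then have "exp y \<le> 1 + y * exp y" by (simp add: exp_minus algebra_simps)
    also have "y * exp y \<le> y * exp (real c)" using y0 yc by (intro mult_left_mono) auto
    also have "\<dots> \<le> (2 * exp (real c) / M) * exp (real c)"
    proof (rule mult_right_mono)
      have "1 + real c + (real c)\<^sup>2 / 2 \<le> exp (real c)" by (rule exp_lower_Taylor_quadratic) simp
      then have "(real c)\<^sup>2 \<le> 2 * exp (real c)" by (simp add: field_simps)
      then show "y \<le> 2 * exp (real c) / M" using M by (simp add: y_def divide_right_mono)
    qed simp
    also have "\<dots> = 2 / M * exp (2 * real c)" by (simp add: exp_add[symmetric])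
    finally show ?thesis using True by (simp add: f_def g_def y_def)
  qed (use M in \<open>auto simp: f_def g_def\<close>)
  have g_int: "integrable (poisson_pmf a) g"
    unfolding g_def using poisson_mgf(1)[OF cell_mean_pos, of 2] by auto
  have f_int: "integrable (poisson_pmf a) (f v)" for v
  proof (rule Bochner_Integration.integrable_bound[OF g_int])
    have "\<bar>f v c\<bar> \<le> \<bar>g c\<bar>" for c using f1[of v c] fg[of v c] by linarith
    then show "AE c in poisson_pmf a. norm (f v c) \<le> norm (g c)" by (auto intro!: AE_I2)
  qed auto
  have "measure_pmf.expectation (poisson_pmf a) (f v) \<le> measure_pmf.expectation (poisson_pmf a) g" for v
    by (intro integral_mono f_int g_int fg)
  \<comment> \<open>The origin of \<open>K\<close>: it is twice the moment
    \<open>exp (a * (exp 2 - 1))\<close> of \<open>exp (2 * c)\<close>. The factor 2 comes from the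
    estimate \<open>c\<^sup>2 \<le> 2 * exp c\<close> used for \<open>fg\<close>.\<close>
  moreover have "measure_pmf.expectation (poisson_pmf a) g = 1 + K / M"
    unfolding g_def K_def using poisson_mgf[OF cell_mean_pos, of 2] by simp
  ultimately have Ef: "measure_pmf.expectation (poisson_pmf a) (f v) \<le> exp (K / M)" for v
    using exp_ge_add_one_self[of "K / M"] order_trans by metis
  have Ef1: "measure_pmf.expectation (poisson_pmf a) (f v) = 1" if "v \<notin> T" for v
    using that by (simp add: f_def)
  have Ef0: "0 \<le> measure_pmf.expectation (poisson_pmf a) (f v)" for v
    by (rule Bochner_Integration.integral_nonneg) (use f1[of v] in \<open>auto intro: order_trans[OF zero_le_one]\<close>)
  let ?F = "\<lambda>c. \<Prod>v\<in>grid q. f v (c v)"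
  have F_int: "integrable (count_law n q) ?F"
    unfolding count_law_eq by (rule integrable_prod_Pi_pmf) (use f_int in auto)
  have "measure_pmf.expectation (count_law n q) ?F = (\<Prod>v\<in>grid q. measure_pmf.expectation (poisson_pmf a) (f v))"
    unfolding count_law_eq
    by (rule expectation_prod_Pi_pmf) (use f_int f1 in \<open>auto intro: order_trans[OF zero_le_one]\<close>)
  also have "\<dots> \<le> (\<Prod>v\<in>grid q. if v \<in> T then exp (K / M) else 1)"
    by (intro prod_mono) (use Ef Ef1 Ef0 in auto)
  also have "\<dots> = (\<Prod>v\<in>T. exp (K / M))"
    using T by (intro prod.mono_neutral_cong_right) auto
  also have "\<dots> = exp (K * card T / M)" by (simp add: exp_of_nat_mult[symmetric] mult.commute)
  finally have EF: "measure_pmf.expectation (count_law n q) ?F \<le> exp (K * card T / M)" .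
  have "measure_pmf.prob (count_law n q)
      {c. (\<forall>v\<in>T. real (c v) \<le> M) \<and> (\<Sum>v\<in>T. (real (c v))\<^sup>2) \<ge> K * card T + M * x} \<le>
      measure_pmf.prob (count_law n q) {c \<in> space (count_law n q). ?F c \<ge> exp (K * card T / M + x)}"
  proof (rule measure_pmf.finite_measure_mono)
    have "?F c \<ge> exp (K * card T / M + x)"
      if le: "\<forall>v\<in>T. real (c v) \<le> M" and ge: "(\<Sum>v\<in>T. (real (c v))\<^sup>2) \<ge> K * card T + M * x" for c
    proof -
      have "?F c = (\<Prod>v\<in>T. f v (c v))"
        by (rule prod.mono_neutral_right) (use T in \<open>auto simp: f_def\<close>)
      also have "\<dots> = (\<Prod>v\<in>T. exp ((real (c v))\<^sup>2 / M))"
        by (rule prod.cong) (use le in \<open>auto simp: f_def\<close>)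
      also have "\<dots> = exp ((\<Sum>v\<in>T. (real (c v))\<^sup>2) / M)"
        using T by (simp add: exp_sum finite_subset sum_divide_distrib)
      also have "\<dots> \<ge> exp (K * card T / M + x)"
      proof -
        have "K * card T / M + x = (K * card T + M * x) / M" using M by (simp add: add_divide_distrib)
        also have "\<dots> \<le> (\<Sum>v\<in>T. (real (c v))\<^sup>2) / M" using ge M by (intro divide_right_mono) auto
        finally show ?thesis by simp
      qed
      finally show ?thesis .
    qed
    then show "{c. (\<forall>v\<in>T. real (c v) \<le> M) \<and> (\<Sum>v\<in>T. (real (c v))\<^sup>2) \<ge> K * card T + M * x} \<subseteq>
        {c \<in> space (count_law n q). ?F c \<ge> exp (K * card T / M + x)}" by auto
  qed simp
  also have "\<dots> \<le> measure_pmf.expectation (count_law n q) ?F / exp (K * card T / M + x)"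
    by (rule integral_Markov_inequality_measure[where A = "{}"])
       (use F_int f1 in \<open>auto intro!: AE_I2 prod_nonneg intro: order_trans[OF zero_le_one]\<close>)
  also have "\<dots> \<le> exp (K * card T / M) / exp (K * card T / M + x)"
    by (intro divide_right_mono EF) auto
  also have "\<dots> = exp (- x)" by (simp add: exp_add exp_minus field_simps)
  finally show ?thesis .
qed

lemma prob_empty_cells:
  assumes "S \<subseteq> grid q"
  shows "measure_pmf.prob (count_law n q) {c. \<forall>v\<in>S. c v = 0} = exp (- a) ^ card S"
proof -
  have "{c. \<forall>v\<in>S. c v = (0::nat)} = Pi (grid q) (\<lambda>v. if v \<in> S then {0} else UNIV)"
    using assms by (auto simp: Pi_def split: if_splits)
  then have "measure_pmf.prob (count_law n q) {c. \<forall>v\<in>S. c v = 0} =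
      (\<Prod>v\<in>grid q. measure_pmf.prob (poisson_pmf a) (if v \<in> S then {0} else UNIV))"
    by (simp add: count_law_eq measure_Pi_pmf_Pi)
  also have "\<dots> = (\<Prod>v\<in>S. measure_pmf.prob (poisson_pmf a) (if v \<in> S then {0} else UNIV))"
    by (rule prod.mono_neutral_right) (use assms in auto)
  also have "\<dots> = (\<Prod>v\<in>S. exp (- a))"
    by (rule prod.cong) (use cell_mean_pos in \<open>auto simp: measure_pmf_single\<close>)
  finally show ?thesis by simp
qed

text \<open>Locality of \<open>P\<close> and \<open>Q\<close> is expressed by invariance under
  changes elsewhere. The product law over the grid is then split into independent parts over
  \<open>S\<close> and over its complement.\<close>

lemma count_law_indep:
  assumes S: "S \<subseteq> grid q"
    and P: "\<And>c c'. (\<And>v. v \<in> S \<Longrightarrow> c v = c' v) \<Longrightarrow> P c = P c'"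
    and Q: "\<And>c c'. (\<And>v. v \<notin> S \<Longrightarrow> c v = c' v) \<Longrightarrow> Q c = Q c'"
  shows "measure_pmf.prob (count_law n q) {c. P c \<and> Q c} =
    measure_pmf.prob (count_law n q) {c. P c} * measure_pmf.prob (count_law n q) {c. Q c}"
proof -
  let ?A = "Pi_pmf S 0 (\<lambda>_. poisson_pmf a)" and ?B = "Pi_pmf (grid q - S) 0 (\<lambda>_. poisson_pmf a)"
  let ?h = "\<lambda>(f, g) x. if x \<in> S then f x else g x"
  have fin: "finite S" by (rule finite_subset[OF S finite_grid])
  have "grid q = S \<union> (grid q - S)" using S by auto
  then have eq: "count_law n q = map_pmf ?h (pair_pmf ?A ?B)"
    using Pi_pmf_union[of S "grid q - S" 0 "\<lambda>_. poisson_pmf a"] fin by (simp add: count_law_eq)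
  have Ph: "P (?h (f, g)) = P f" for f g by (rule P) simp
  have Qh: "Q (?h (f, g)) = Q g" for f g by (rule Q) simp
  have key: "measure_pmf.prob (pair_pmf ?A ?B) {fg. R (fst fg) \<and> R' (snd fg)} =
      measure_pmf.prob ?A {f. R f} * measure_pmf.prob ?B {g. R' g}" for R R'
  proof -
    \<comment> \<open>Intersecting with the supports makes both factors countable, as
      \<open>measure_pmf_prob_product\<close> requires; the space of all functions is
      uncountable.\<close>
    have "measure_pmf.prob (pair_pmf ?A ?B) {fg. R (fst fg) \<and> R' (snd fg)} =
        measure_pmf.prob (pair_pmf ?A ?B) (({f. R f} \<inter> set_pmf ?A) \<times> ({g. R' g} \<inter> set_pmf ?B))"
      by (rule measure_prob_cong_0) (auto simp: set_pmf_iff pmf_pair)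
    also have "\<dots> = measure_pmf.prob ?A ({f. R f} \<inter> set_pmf ?A) * measure_pmf.prob ?B ({g. R' g} \<inter> set_pmf ?B)"
      by (rule measure_pmf_prob_product) auto
    finally show ?thesis by (simp add: measure_Int_set_pmf)
  qed
  have 1: "measure_pmf.prob (count_law n q) {c. P c \<and> Q c} = measure_pmf.prob ?A {f. P f} * measure_pmf.prob ?B {g. Q g}"
    unfolding eq measure_map_pmf key[symmetric] by (rule arg_cong[where f = "measure _"]) (use Ph Qh in auto)
  have "?h -` {c. P c} = {fg. P (fst fg) \<and> True}" using Ph by auto
  then have 2: "measure_pmf.prob (count_law n q) {c. P c} = measure_pmf.prob ?A {f. P f}"
    unfolding eq measure_map_pmf using key[of P "\<lambda>_. True"] by simp
  have "?h -` {c. Q c} = {fg. True \<and> Q (snd fg)}" using Qh by auto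
  then have 3: "measure_pmf.prob (count_law n q) {c. Q c} = measure_pmf.prob ?B {g. Q g}"
    unfolding eq measure_map_pmf using key[of "\<lambda>_. True" Q] by simp
  show ?thesis unfolding 1 2 3 ..
qed

end

text \<open>Chebyshev with a dependency set \<open>N\<close>: covariances are at most 1 on
  \<open>N\<close> and vanish off it, so the variance of the count is at most
  \<open>card N\<close>.\<close>

lemma chebyshev_indicator_sum:
  fixes p :: "'a pmf" and E :: "'i \<Rightarrow> 'a set"
  assumes "finite I" "N \<subseteq> I \<times> I"
    and indep: "\<And>i j. i \<in> I \<Longrightarrow> j \<in> I \<Longrightarrow> (i, j) \<notin> N \<Longrightarrow>
      measure_pmf.prob p (E i \<inter> E j) = measure_pmf.prob p (E i) * measure_pmf.prob p (E j)"
    and mu: "(\<Sum>i\<in>I. measure_pmf.prob p (E i)) \<le> \<mu>" and t: "\<mu> < t"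
  shows "measure_pmf.prob p {x. real (card {i \<in> I. x \<in> E i}) \<ge> t} \<le> card N / (t - \<mu>)\<^sup>2"
proof -
  define m where "m = (\<Sum>i\<in>I. measure_pmf.prob p (E i))"
  define Z where "Z = (\<lambda>i x. indicator (E i) x - measure_pmf.prob p (E i))"
  have int: "integrable p (\<lambda>x. Z i x * Z j x)" for i j
  proof (rule measure_pmf.integrable_const_bound[where B = 1])
    have "\<bar>Z i x\<bar> \<le> 1" for i x
      using measure_pmf.prob_le_1[of p "E i"] measure_nonneg[of p "E i"]
      by (auto simp: Z_def indicator_def)
    then show "AE x in p. norm (Z i x * Z j x) \<le> 1"
      by (auto intro!: AE_I2 mult_le_one simp: abs_mult)
  qed auto
  have intE: "integrable p (indicator (E i) :: 'a \<Rightarrow> real)" for i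
    by (rule measure_pmf.integrable_const_bound[where B = 1]) (auto intro!: AE_I2)
  have cov: "measure_pmf.expectation p (\<lambda>x. Z i x * Z j x) =
      measure_pmf.prob p (E i \<inter> E j) - measure_pmf.prob p (E i) * measure_pmf.prob p (E j)" for i j
  proof -
    have "(\<lambda>x. Z i x * Z j x) = (\<lambda>x. indicator (E i \<inter> E j) x - measure_pmf.prob p (E j) * indicator (E i) x
        - measure_pmf.prob p (E i) * indicator (E j) x + measure_pmf.prob p (E i) * measure_pmf.prob p (E j))"
      by (auto simp: fun_eq_iff Z_def algebra_simps indicator_inter_arith)
    moreover have "integrable p (indicator (E i \<inter> E j) :: 'a \<Rightarrow> real)"
      by (rule measure_pmf.integrable_const_bound[where B = 1]) (auto intro!: AE_I2)
    ultimately show ?thesis using intE by (simp add: mult.commute)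
  qed
  define X where "X = (\<lambda>x. \<Sum>i\<in>I. Z i x)"
  have X2: "(X x)\<^sup>2 = (\<Sum>i\<in>I. \<Sum>j\<in>I. Z i x * Z j x)" for x
    by (simp add: X_def power2_eq_square sum_product)
  have X2_int: "integrable p (\<lambda>x. (X x)\<^sup>2)"
    unfolding X2 by (intro Bochner_Integration.integrable_sum int)
  have "measure_pmf.expectation p (\<lambda>x. (X x)\<^sup>2) = (\<Sum>i\<in>I. \<Sum>j\<in>I. measure_pmf.expectation p (\<lambda>x. Z i x * Z j x))"
    unfolding X2 by (subst Bochner_Integration.integral_sum, (intro Bochner_Integration.integrable_sum int)?)+
      (auto intro!: sum.cong Bochner_Integration.integral_sum int)
  also have "\<dots> = (\<Sum>ij\<in>I \<times> I. measure_pmf.expectation p (\<lambda>x. Z (fst ij) x * Z (snd ij) x))"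
    by (simp add: sum.cartesian_product case_prod_beta)
  also have "\<dots> \<le> (\<Sum>ij\<in>I \<times> I. if ij \<in> N then 1 else 0)"
  proof (rule sum_mono)
    fix ij assume "ij \<in> I \<times> I"
    moreover have "measure_pmf.prob p (E i \<inter> E j) \<le> 1 + measure_pmf.prob p (E i) * measure_pmf.prob p (E j)" for i j
      by (rule order_trans[OF measure_pmf.prob_le_1]) simp
    ultimately show "measure_pmf.expectation p (\<lambda>x. Z (fst ij) x * Z (snd ij) x) \<le> (if ij \<in> N then 1 else 0)"
      using indep[of "fst ij" "snd ij"] by (auto simp: cov diff_le_eq)
  qed
  also have "\<dots> = card N"
    using assms(1,2) by (simp add: sum.If_cases Int_absorb1)
  finally have EX2: "measure_pmf.expectation p (\<lambda>x. (X x)\<^sup>2) \<le> card N" .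
  have "measure_pmf.prob p {x. real (card {i \<in> I. x \<in> E i}) \<ge> t} \<le>
      measure_pmf.prob p {x \<in> space p. (X x)\<^sup>2 \<ge> (t - \<mu>)\<^sup>2}"
  proof (rule measure_pmf.finite_measure_mono)
    have "(X x)\<^sup>2 \<ge> (t - \<mu>)\<^sup>2" if "real (card {i \<in> I. x \<in> E i}) \<ge> t" for x
    proof -
      have "(\<Sum>i\<in>I. indicator (E i) x) = real (card {i \<in> I. x \<in> E i})"
        using assms(1) by (simp add: indicator_def sum.If_cases Int_def)
      then have "X x = real (card {i \<in> I. x \<in> E i}) - m"
        by (simp add: X_def Z_def m_def sum_subtractf)
      then have "t - \<mu> \<le> X x" using that mu by (simp add: m_def)
      then show ?thesis using t by (intro power_mono) auto
    qed
    then show "{x. real (card {i \<in> I. x \<in> E i}) \<ge> t} \<subseteq> {x \<in> space p. (X x)\<^sup>2 \<ge> (t - \<mu>)\<^sup>2}" by auto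
  qed simp
  also have "\<dots> \<le> measure_pmf.expectation p (\<lambda>x. (X x)\<^sup>2) / (t - \<mu>)\<^sup>2"
    by (rule integral_Markov_inequality_measure[where A = "{}"]) (use X2_int t in auto)
  also have "\<dots> \<le> card N / (t - \<mu>)\<^sup>2"
    by (intro divide_right_mono EX2) auto
  finally show ?thesis .
qed

section \<open>Percolation of occupied cells\<close>

text \<open>A local certificate that the class of \<open>x\<close> has more than \<open>s\<close>
  empty cells. The \<open>2 * s\<close> steps leave room for the detours of
  \<open>bad_class_walk\<close>.\<close>

definition empty_walk :: "nat \<Rightarrow> nat \<times> nat \<Rightarrow> nat \<Rightarrow> (nat \<times> nat \<Rightarrow> nat) \<Rightarrow> bool" where
  "empty_walk q x s c \<longleftrightarrow> (\<exists>xs\<in>walks q x (2 * s). card (set xs) = Suc s \<and> (\<forall>v\<in>set xs. c v = 0))"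

text \<open>The first clause bounds every class by \<open>k\<close>. In the second, a bad cell is
  counted once for each \<open>s\<close> below the size of its class, so the number of pairs
  dominates the sum of class sizes and with it, by \<open>card_class_rects_le\<close>, the area of
  all rectangles.\<close>

definition percolating :: "nat \<Rightarrow> nat \<Rightarrow> (nat \<times> nat \<Rightarrow> nat) \<Rightarrow> bool" where
  "percolating q k c \<longleftrightarrow> (\<forall>x\<in>grid q. \<not> empty_walk q x k c) \<and>
     real (card {i \<in> grid q \<times> {..<k}. empty_walk q (fst i) (snd i) c}) < (real q)\<^sup>2 / 2"

text \<open>Union bound over at most \<open>49 ^ (2 * s)\<close> walks, with 2401 = 49^2; one spare
  factor 2401 gives both powers the exponent \<open>Suc s\<close>.\<close>

lemma prob_empty_walk:
  assumes "0 < n" "0 < q" "x \<in> grid q"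
  shows "measure_pmf.prob (count_law n q) {c. empty_walk q x s c} \<le> (2401 * exp (- (real n / (real q)\<^sup>2))) ^ Suc s"
proof -
  let ?d = "exp (- (real n / (real q)\<^sup>2))"
  let ?W = "{xs \<in> walks q x (2 * s). card (set xs) = Suc s}"
  have fin: "finite ?W" using card_walks_le[of q x "2 * s"] by simp
  have "{c. empty_walk q x s c} = (\<Union>xs\<in>?W. {c. \<forall>v\<in>set xs. c v = 0})"
    by (auto simp: empty_walk_def)
  then have "measure_pmf.prob (count_law n q) {c. empty_walk q x s c} \<le>
      (\<Sum>xs\<in>?W. measure_pmf.prob (count_law n q) {c. \<forall>v\<in>set xs. c v = 0})"
    using measure_pmf.finite_measure_subadditive_finite[OF fin, of "\<lambda>xs. {c. \<forall>v\<in>set xs. c v = 0}" "count_law n q"]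
    by simp
  also have "\<dots> = (\<Sum>xs\<in>?W. ?d ^ Suc s)"
    by (rule sum.cong[OF refl], subst prob_empty_cells[OF assms(1,2)])
       (auto simp: walks_def walk_from_def)
  also have "\<dots> = real (card ?W) * ?d ^ Suc s" by simp
  also have "\<dots> \<le> 2401 ^ Suc s * ?d ^ Suc s"
  proof (rule mult_right_mono)
    have "card ?W \<le> card (walks q x (2 * s))"
      by (rule card_mono) (use card_walks_le[of q x "2 * s"] in auto)
    also have "\<dots> \<le> 49 ^ (2 * s)" using card_walks_le[of q x "2 * s"] by simp
    also have "\<dots> = (49\<^sup>2) ^ s" by (simp only: power_mult)
    also have "\<dots> \<le> 2401 ^ Suc s" by simp
    finally show "real (card ?W) \<le> 2401 ^ Suc s" using of_nat_le_iff[of "card ?W" "2401 ^ Suc s", where ?'a = real] by simp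
  qed simp
  finally show ?thesis by (simp only: power_mult_distrib)
qed

text \<open>The two events look at cells within \<open>6 * s\<close> of \<open>x\<close> and
  \<open>6 * t\<close> of \<open>y\<close>; these regions are disjoint when \<open>x\<close> and
  \<open>y\<close> are not within \<open>12 * k\<close>.\<close>

lemma empty_walk_indep:
  assumes "0 < n" "0 < q" "s \<le> k" "t \<le> k" "\<not> near (12 * k) x y"
  shows "measure_pmf.prob (count_law n q) ({c. empty_walk q x s c} \<inter> {c. empty_walk q y t c}) =
    measure_pmf.prob (count_law n q) {c. empty_walk q x s c} * measure_pmf.prob (count_law n q) {c. empty_walk q y t c}"
proof -
  let ?S = "{v \<in> grid q. near (6 * s) x v}"
  have loc: "empty_walk q z u c = empty_walk q z u c'" if "\<And>v. v \<in> grid q \<Longrightarrow> near (6 * u) z v \<Longrightarrow> c v = c' v" for z u c c'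
  proof -
    have "c v = c' v" if "xs \<in> walks q z (2 * u)" "v \<in> set xs" for xs v
      using walk_near[OF that] \<open>\<And>v. v \<in> grid q \<Longrightarrow> near (6 * u) z v \<Longrightarrow> c v = c' v\<close>[of v] that
      by (auto simp: walks_def walk_from_def)
    then show ?thesis by (auto simp: empty_walk_def)
  qed
  have "measure_pmf.prob (count_law n q) {c. empty_walk q x s c \<and> empty_walk q y t c} =
    measure_pmf.prob (count_law n q) {c. empty_walk q x s c} * measure_pmf.prob (count_law n q) {c. empty_walk q y t c}"
  proof (rule count_law_indep[OF assms(1,2), of ?S])
    show "empty_walk q x s c = empty_walk q x s c'" if "\<And>v. v \<in> ?S \<Longrightarrow> c v = c' v" for c c'
      using that by (intro loc) auto
    show "empty_walk q y t c = empty_walk q y t c'" if "\<And>v. v \<notin> ?S \<Longrightarrow> c v = c' v" for c c'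
    proof (rule loc)
      fix v assume v: "near (6 * t) y v"
      have "\<not> near (6 * s) x v"
      proof
        assume "near (6 * s) x v"
        then have "near (12 * k) x y" using v assms(3,4) unfolding near_def by linarith
        then show False using assms(5) by simp
      qed
      then show "c v = c' v" using that by simp
    qed
  qed auto
  then show ?thesis by (simp add: Collect_conj_eq)
qed

text \<open>With 1/5 as ratio the geometric series sums to at most 1/4, so the expected number of
  pairs is at most half the threshold in \<open>percolating\<close>. Chebyshev then has a gap of
  \<open>q\<^sup>2 / 4\<close>, and each pair depends on at most
  \<open>k * (24 * k + 1)\<^sup>2\<close> others.\<close>

lemma prob_percolating:
  assumes "0 < n" "0 < q" and dense: "2401 * exp (- (real n / (real q)\<^sup>2)) \<le> 1 / 5"
  shows "measure_pmf.prob (count_law n q) {c. percolating q k c} \<ge>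
    1 - (real q)\<^sup>2 * (1 / 5) ^ Suc k - 16 * (real k)\<^sup>2 * (24 * real k + 1)\<^sup>2 / (real q)\<^sup>2"
proof -
  let ?p = "count_law n q"
  let ?E = "\<lambda>xs. {c. empty_walk q (fst xs) (snd xs) c}"
  let ?I = "grid q \<times> {..<k}"
  let ?N = "{(i, j) \<in> ?I \<times> ?I. near (12 * k) (fst i) (fst j)}"
  have E: "measure_pmf.prob ?p {c. empty_walk q x s c} \<le> (1 / 5) ^ Suc s" if "x \<in> grid q" for x s
    by (rule order_trans[OF prob_empty_walk[OF assms(1,2) that] power_mono[OF dense]]) simp
  have A: "measure_pmf.prob ?p {c. \<exists>x\<in>grid q. empty_walk q x k c} \<le> (real q)\<^sup>2 * (1 / 5) ^ Suc k"
  proof -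
    have "{c. \<exists>x\<in>grid q. empty_walk q x k c} = (\<Union>x\<in>grid q. {c. empty_walk q x k c})" by auto
    then have "measure_pmf.prob ?p {c. \<exists>x\<in>grid q. empty_walk q x k c} \<le>
        (\<Sum>x\<in>grid q. measure_pmf.prob ?p {c. empty_walk q x k c})"
      by (simp add: measure_pmf.finite_measure_subadditive_finite)
    also have "\<dots> \<le> (\<Sum>x\<in>grid q. (1 / 5) ^ Suc k)" by (intro sum_mono E)
    finally show ?thesis by (simp add: card_grid power2_eq_square)
  qed
  have mean: "(\<Sum>i\<in>?I. measure_pmf.prob ?p (?E i)) \<le> (real q)\<^sup>2 / 4"
  proof -
    have "(\<Sum>i\<in>?I. measure_pmf.prob ?p (?E i)) \<le> (\<Sum>i\<in>?I. (1 / 5) ^ Suc (snd i))"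
      by (intro sum_mono E) auto
    also have "\<dots> = (\<Sum>x\<in>grid q. \<Sum>s<k. (1 / 5 :: real) ^ Suc s)"
      by (subst sum.cartesian_product) (auto intro!: sum.cong)
    also have "\<dots> \<le> (\<Sum>x\<in>grid q. 1 / 4)"
    proof (rule sum_mono)
      have "(\<Sum>s<k. (1 / 5 :: real) ^ Suc s) = 1 / 5 * (\<Sum>s<k. (1 / 5) ^ s)" by (simp add: sum_distrib_left)
      also have "\<dots> = 1 / 5 * ((1 - (1 / 5) ^ k) / (1 - 1 / 5))" by (subst sum_gp_strict) simp
      also have "\<dots> \<le> 1 / 4" by simp
      finally show "(\<Sum>s<k. (1 / 5 :: real) ^ Suc s) \<le> 1 / 4" .
    qed
    also have "\<dots> = (real q)\<^sup>2 / 4" by (simp add: card_grid power2_eq_square)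
    finally show ?thesis .
  qed
  have cardN: "card ?N \<le> (q * q * k) * (k * (24 * k + 1)\<^sup>2)"
  proof -
    have fin: "finite {v \<in> grid q. near (12 * k) x v}" for x by simp
    have sub: "?N \<subseteq> (SIGMA i:?I. {v \<in> grid q. near (12 * k) (fst i) v} \<times> {..<k})" by auto
    have "card ?N \<le> card (SIGMA i:?I. {v \<in> grid q. near (12 * k) (fst i) v} \<times> {..<k})"
      by (rule card_mono[OF _ sub]) auto
    also have "\<dots> = (\<Sum>i\<in>?I. card {v \<in> grid q. near (12 * k) (fst i) v} * k)"
      by (subst card_SigmaI) (auto simp: card_cartesian_product)
    also have "\<dots> \<le> (\<Sum>i\<in>?I. (24 * k + 1)\<^sup>2 * k)"
    proof (intro sum_mono mult_right_mono)
      fix i :: "(nat \<times> nat) \<times> nat"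
      have "card {v \<in> grid q. near (12 * k) (fst i) v} \<le> card {v. near (12 * k) (fst i) v}"
        by (rule card_mono[OF finite_near]) auto
      then show "card {v \<in> grid q. near (12 * k) (fst i) v} \<le> (24 * k + 1)\<^sup>2"
        using card_near_le[of "12 * k" "fst i"] by simp
    qed simp
    also have "\<dots> = (q * q * k) * (k * (24 * k + 1)\<^sup>2)"
      by (simp add: card_grid card_cartesian_product mult_ac)
    finally show ?thesis .
  qed
  have B: "measure_pmf.prob ?p {c. real (card {i \<in> ?I. c \<in> ?E i}) \<ge> (real q)\<^sup>2 / 2} \<le>
      16 * (real k)\<^sup>2 * (24 * real k + 1)\<^sup>2 / (real q)\<^sup>2"
  proof -
    have "measure_pmf.prob ?p {c. real (card {i \<in> ?I. c \<in> ?E i}) \<ge> (real q)\<^sup>2 / 2} \<le>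
        card ?N / ((real q)\<^sup>2 / 2 - (real q)\<^sup>2 / 4)\<^sup>2"
    proof (rule chebyshev_indicator_sum)
      show "measure_pmf.prob ?p (?E i \<inter> ?E j) = measure_pmf.prob ?p (?E i) * measure_pmf.prob ?p (?E j)"
        if "i \<in> ?I" "j \<in> ?I" "(i, j) \<notin> ?N" for i j
        by (rule empty_walk_indep[OF assms(1,2), of _ k]) (use that in auto)
    qed (use mean assms in auto)
    also have "\<dots> \<le> real ((q * q * k) * (k * (24 * k + 1)\<^sup>2)) / ((real q)\<^sup>2 / 2 - (real q)\<^sup>2 / 4)\<^sup>2"
      by (intro divide_right_mono of_nat_mono cardN) simp
    also have "\<dots> = 16 * (real k)\<^sup>2 * (24 * real k + 1)\<^sup>2 / (real q)\<^sup>2"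
      using assms(2) by (simp add: power2_eq_square field_simps)
    finally show ?thesis .
  qed
  have "{c. \<not> percolating q k c} = {c. \<exists>x\<in>grid q. empty_walk q x k c} \<union> {c. real (card {i \<in> ?I. c \<in> ?E i}) \<ge> (real q)\<^sup>2 / 2}"
    by (auto simp: percolating_def not_less)
  then have "measure_pmf.prob ?p {c. \<not> percolating q k c} \<le>
     measure_pmf.prob ?p {c. \<exists>x\<in>grid q. empty_walk q x k c} + measure_pmf.prob ?p {c. real (card {i \<in> ?I. c \<in> ?E i}) \<ge> (real q)\<^sup>2 / 2}"
    by (simp add: measure_Un_le)
  moreover have "measure_pmf.prob ?p {c. percolating q k c} = 1 - measure_pmf.prob ?p {c. \<not> percolating q k c}"
    using measure_pmf.prob_compl[of "{c. percolating q k c}" ?p] by (simp add: Compl_eq_Diff_UNIV[symmetric] Collect_neg_eq)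
  ultimately show ?thesis using A B by linarith
qed

text \<open>The rectangles cover less than half of the grid. Hence some cell avoids them all and
  starts a cluster, and since the complement of this cluster lies in the rectangles, the cluster
  fills at least half.\<close>

lemma percolating_cluster:
  assumes perc: "percolating q k c" and kq: "k < q"
  defines "B \<equiv> {v. c v = 0}"
  shows "\<exists>C \<beta>. C \<subseteq> grid q - B \<and> real (card C) \<ge> (real q)\<^sup>2 / 2 \<and> (\<forall>u\<in>C. \<forall>v\<in>C. conn4 C u v) \<and>
    (\<forall>y\<in>grid q - C. y \<in> class_rect q B (\<beta> y) \<and> card (class_rect q B (\<beta> y)) \<le> k\<^sup>2) \<and>
    (\<forall>y\<in>grid q - C. \<forall>z\<in>grid q - C. near 3 y z \<longrightarrow> class_rect q B (\<beta> y) = class_rect q B (\<beta> z))"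
proof -
  have walk: "empty_walk q b s c" if "b \<in> grid q \<inter> B" "s < card (bad_class q B b)" for b s
    using bad_class_walk[OF that] by (auto simp: empty_walk_def B_def)
  have small: "card (bad_class q B b) \<le> k" if "b \<in> grid q \<inter> B" for b
    using walk[OF that, of k] perc that by (force simp: percolating_def not_less[symmetric])
  let ?Z = "\<Union>b\<in>grid q \<inter> B. class_rect q B b"
  let ?W = "{i \<in> grid q \<times> {..<k}. empty_walk q (fst i) (snd i) c}"
  have "(SIGMA b:grid q \<inter> B. {..<card (bad_class q B b)}) \<subseteq> ?W"
  proof
    fix i assume "i \<in> (SIGMA b:grid q \<inter> B. {..<card (bad_class q B b)})"
    then have i: "fst i \<in> grid q \<inter> B" "snd i < card (bad_class q B (fst i))" by auto
    then show "i \<in> ?W" using walk[OF i] small[OF i(1)] by (simp add: mem_Times_iff)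
  qed
  then have "card (SIGMA b:grid q \<inter> B. {..<card (bad_class q B b)}) \<le> card ?W"
    by (rule card_mono[rotated]) (auto intro: finite_subset[of _ "grid q \<times> {..<k}"])
  then have "card ?Z \<le> card ?W"
    using card_class_rects_le[of q B] by simp
  then have Z: "real (card ?Z) < (real q)\<^sup>2 / 2" using perc by (simp add: percolating_def)
  have ZG: "?Z \<subseteq> grid q" by (auto simp: class_rect_def bad_class_def grid_def)
  have "card ?Z < card (grid q)" using Z kq by (simp add: card_grid power2_eq_square) (smt (verit) of_nat_0_le_iff of_nat_less_iff of_nat_mult mult_nonneg_nonneg)
  then obtain x where x: "x \<in> grid q" "x \<notin> ?Z"
    using ZG by (metis card_mono finite_grid finite_subset not_le subsetI)
  have small': "\<forall>b\<in>grid q \<inter> B. card (bad_class q B b) < q"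
    using small kq le_less_trans by blast
  have x': "\<forall>b\<in>grid q \<inter> B. x \<notin> class_rect q B b" using x(2) by blast
  from good_cluster_exists[OF small' x(1) x'] obtain C \<beta> where C: "x \<in> C" "C \<subseteq> grid q - B"
    "\<forall>u\<in>C. \<forall>v\<in>C. conn4 C u v"
    "\<forall>y\<in>grid q - C. \<beta> y \<in> grid q \<inter> B \<and> y \<in> class_rect q B (\<beta> y)"
    "\<forall>y\<in>grid q - C. \<forall>z\<in>grid q - C. near 3 y z \<longrightarrow> class_rect q B (\<beta> y) = class_rect q B (\<beta> z)"
    by (elim exE conjE)
  have "grid q - C \<subseteq> ?Z" using C(4) by blast
  then have "card (grid q) - card C \<le> card ?Z"
    using C(2) by (metis (no_types, lifting) card_Diff_subset card_mono finite_grid finite_subset ZG Diff_subset order_trans)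
  then have "real (card (grid q)) \<le> real (card ?Z) + real (card C)" by linarith
  then have "real (card C) \<ge> (real q)\<^sup>2 / 2" using Z by (simp add: card_grid power2_eq_square)
  moreover have "card (class_rect q B (\<beta> y)) \<le> k\<^sup>2" if "y \<in> grid q - C" for y
    by (rule order_trans[OF card_class_rect_le power_mono]) (use small bspec[OF C(4) that] in auto)
  ultimately show ?thesis using C by (intro exI[of _ C] exI[of _ \<beta>]) blast
qed

section \<open>Cells and toroidal distance\<close>

text \<open>Circular distance modulo \<open>q\<close>, written with sums because subtraction on
  \<open>nat\<close> truncates.\<close>

definition cnear :: "nat \<Rightarrow> nat \<Rightarrow> nat \<Rightarrow> nat \<Rightarrow> bool" where
  "cnear q R i j \<longleftrightarrow> (i \<le> j + R \<and> j \<le> i + R) \<or> i + q \<le> j + R \<or> j + q \<le> i + R"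

definition torus_near :: "nat \<Rightarrow> nat \<Rightarrow> nat \<times> nat \<Rightarrow> nat \<times> nat \<Rightarrow> bool" where
  "torus_near q R u v \<longleftrightarrow> cnear q R (fst u) (fst v) \<and> cnear q R (snd u) (snd v)"

definition torus_ball :: "nat \<Rightarrow> nat \<Rightarrow> nat \<times> nat \<Rightarrow> (nat \<times> nat) set" where
  "torus_ball q R u = {v \<in> grid q. torus_near q R u v}"

lemma cnear_trans:
  assumes "i < q" "j < q" "k < q" "cnear q R i j" "cnear q K j k"
  shows "cnear q (R + K) i k"
proof -
  consider "i \<le> j + R" "j \<le> i + R" | "i + q \<le> j + R" | "j + q \<le> i + R" using assms(4) by (auto simp: cnear_def)
  then show ?thesis
    by cases (use assms(1-3,5) in \<open>auto simp: cnear_def\<close>)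
qed

lemma cnear_sym: "cnear q R i j = cnear q R j i"
  by (auto simp: cnear_def)

lemma torus_near_sym: "torus_near q R u v = torus_near q R v u"
  by (simp add: torus_near_def cnear_sym)

lemma torus_near_trans:
  assumes "u \<in> grid q" "v \<in> grid q" "w \<in> grid q" "torus_near q R u v" "torus_near q K v w"
  shows "torus_near q (R + K) u w"
  using assms cnear_trans by (auto simp: torus_near_def grid_def mem_Times_iff)

lemma card_cnear:
  assumes "i < q"
  shows "card {j. j < q \<and> cnear q R i j} \<le> 2 * R + 1"
proof -
  have "{j. j < q \<and> cnear q R i j} \<subseteq> (\<lambda>d. nat ((int i + d) mod int q)) ` {- int R..int R}"
  proof
    fix j assume "j \<in> {j. j < q \<and> cnear q R i j}"
    then have j: "j < q" and c: "cnear q R i j" by auto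
    have "\<exists>d\<in>{- int R..int R}. (int i + d) mod int q = int j"
    proof -
      consider "i \<le> j + R" "j \<le> i + R" | "i + q \<le> j + R" | "j + q \<le> i + R"
        using c by (auto simp: cnear_def)
      then show ?thesis
      proof cases
        case 1
        then show ?thesis using j by (intro bexI[of _ "int j - int i"]) auto
      next
        case 2
        then show ?thesis using j assms by (intro bexI[of _ "int j - int i - int q"]) (auto simp: mod_pos_neg_trivial)
      next
        case 3
        then show ?thesis using j assms by (intro bexI[of _ "int j + int q - int i"]) auto
      qed
    qed
    then obtain d where "d \<in> {- int R..int R}" "(int i + d) mod int q = int j" by blast
    then show "j \<in> (\<lambda>d. nat ((int i + d) mod int q)) ` {- int R..int R}" by force
  qed
  then have "card {j. j < q \<and> cnear q R i j} \<le> card {- int R..int R}"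
    by (meson card_image_le card_mono finite_atLeastAtMost_int finite_imageI order_trans)
  then show ?thesis by simp
qed

lemma finite_torus_ball [simp]: "finite (torus_ball q R u)"
  by (simp add: torus_ball_def)

lemma card_torus_ball:
  assumes "u \<in> grid q"
  shows "card (torus_ball q R u) \<le> (2 * R + 1)\<^sup>2"
proof -
  have "torus_ball q R u = {j. j < q \<and> cnear q R (fst u) j} \<times> {j. j < q \<and> cnear q R (snd u) j}"
    by (auto simp: torus_ball_def torus_near_def grid_def)
  then have "card (torus_ball q R u) = card {j. j < q \<and> cnear q R (fst u) j} * card {j. j < q \<and> cnear q R (snd u) j}"
    by (simp add: card_cartesian_product)
  also have "\<dots> \<le> (2 * R + 1) * (2 * R + 1)"
    by (intro mult_mono card_cnear) (use assms in \<open>auto simp: grid_def\<close>)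
  finally show ?thesis by (simp only: power2_eq_square)
qed

section \<open>Distances and cell indices\<close>

lemma tdist_commute: "tdist n x y = tdist n y x"
  by (simp add: tdist_def Let_def abs_minus_commute)

lemma abs_le_sqrt_sum_squares: "\<bar>x\<bar> \<le> sqrt (x\<^sup>2 + y\<^sup>2)" "\<bar>y\<bar> \<le> sqrt (x\<^sup>2 + y\<^sup>2)"
  by (auto intro!: real_le_rsqrt)

lemma tdist_coord_le:
  assumes "tdist n x y \<le> D"
  shows "min \<bar>fst x - fst y\<bar> (sqrt n - \<bar>fst x - fst y\<bar>) \<le> D"
    and "min \<bar>snd x - snd y\<bar> (sqrt n - \<bar>snd x - snd y\<bar>) \<le> D"
  using assms abs_le_sqrt_sum_squares(1)[of "min \<bar>fst x - fst y\<bar> (sqrt n - \<bar>fst x - fst y\<bar>)" "min \<bar>snd x - snd y\<bar> (sqrt n - \<bar>snd x - snd y\<bar>)"]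
    abs_le_sqrt_sum_squares(2)[of "min \<bar>snd x - snd y\<bar> (sqrt n - \<bar>snd x - snd y\<bar>)" "min \<bar>fst x - fst y\<bar> (sqrt n - \<bar>fst x - fst y\<bar>)"]
  unfolding tdist_def Let_def by linarith+

lemma cell_coord_bounds:
  fixes s x :: real
  assumes "0 < s" "0 < q" "-s/2 \<le> x" "x < s/2"
  defines "i \<equiv> nat \<lfloor>(x + s/2) / (s / real q)\<rfloor>"
  shows "- s/2 + real i * (s / q) \<le> x" "x < - s/2 + (real i + 1) * (s / q)" "i < q"
  using cell_coord[OF assms(1,2), of x i] assms(3,4) by (auto simp: i_def)

text \<open>No extra cell is lost to rounding: cells are half-open, so the index difference is
  strictly below \<open>R + 1\<close>, hence at most \<open>R\<close>. Each way of attaining the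
  circular minimum yields one clause of \<open>cnear\<close>.\<close>

lemma cnear_of_coord:
  fixes s x y D :: real
  assumes sq: "0 < s" "0 < q" and x: "-s/2 \<le> x" "x < s/2" and y: "-s/2 \<le> y" "y < s/2"
    and D: "min \<bar>x - y\<bar> (s - \<bar>x - y\<bar>) \<le> D" "D \<le> real R * (s / q)"
  shows "cnear q R (nat \<lfloor>(x + s/2) / (s / real q)\<rfloor>) (nat \<lfloor>(y + s/2) / (s / real q)\<rfloor>)"
proof -
  define i j l where "i = nat \<lfloor>(x + s/2) / (s / real q)\<rfloor>" "j = nat \<lfloor>(y + s/2) / (s / real q)\<rfloor>" "l = s / q"
  have l: "l > 0" using sq by (simp add: i_j_l_def)
  have s: "s = q * l" using sq by (simp add: i_j_l_def)
  note b = cell_coord_bounds[OF sq x, folded i_j_l_def] cell_coord_bounds[OF sq y, folded i_j_l_def]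
  have xy: "x - y < (real i + 1 - real j) * l" "y - x < (real j + 1 - real i) * l"
    using b by (simp_all add: algebra_simps)
  have Dl: "D \<le> real R * l" using D(2) by (simp add: i_j_l_def)
  have cancel: "u < v" if "u * l < v * l" for u v :: real using that l by (simp add: mult_less_cancel_right_pos)
  have lo: "x - y > (real i - 1 - real j) * l" "y - x > (real j - 1 - real i) * l"
    using b by (simp_all add: algebra_simps)
  consider "\<bar>x - y\<bar> \<le> D" | "s - (x - y) \<le> D" | "s - (y - x) \<le> D" using D(1) by linarith
  then have "cnear q R i j"
  proof cases
    case 1
    then have "(real i - 1 - real j) * l < real R * l" "(real j - 1 - real i) * l < real R * l"
      using lo Dl by linarith+
    then have "real i - 1 - real j < real R" "real j - 1 - real i < real R" using cancel by blast+
    then show ?thesis by (auto simp: cnear_def)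
  next
    case 2
    then have "real q * l - real R * l < (real i + 1 - real j) * l" using xy Dl s by linarith
    then have "(real q - real R) * l < (real i + 1 - real j) * l" by (simp add: algebra_simps)
    then have "real q - real R < real i + 1 - real j" by (rule cancel)
    then show ?thesis by (auto simp: cnear_def)
  next
    case 3
    then have "real q * l - real R * l < (real j + 1 - real i) * l" using xy Dl s by linarith
    then have "(real q - real R) * l < (real j + 1 - real i) * l" by (simp add: algebra_simps)
    then have "real q - real R < real j + 1 - real i" by (rule cancel)
    then show ?thesis by (auto simp: cnear_def)
  qed
  then show ?thesis by (simp add: i_j_l_def)
qed

lemma torus_near_of_tdist:
  assumes "0 < n" "0 < q" "x \<in> torus_box n" "y \<in> torus_box n" "tdist n x y \<le> D" "D \<le> real R * (sqrt n / q)"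
  shows "torus_near q R (cell_of n q x) (cell_of n q y)"
  unfolding torus_near_def cell_of_def fst_conv snd_conv
  using assms tdist_coord_le[OF assms(5)]
  by (intro conjI; intro cnear_of_coord[where D = D]) (auto simp: torus_box_def)

text \<open>Two cells with a common side form a rectangle with sides \<open>l\<close> and
  \<open>2 * l\<close>, whose diagonal is \<open>sqrt 5 * l\<close>; the toroidal distance is at
  most the planar one.\<close>

lemma tdist_of_adjacent_cells:
  assumes "0 < n" "0 < q" "x \<in> torus_box n" "y \<in> torus_box n"
    and cells: "cell_of n q x = cell_of n q y \<or> adj4 (cell_of n q x) (cell_of n q y)"
  shows "tdist n x y \<le> sqrt 5 * (sqrt n / q)"
proof -
  define s l where "s = sqrt n" "l = sqrt n / q"
  have s: "s > 0" "l > 0" using assms by (auto simp: s_l_def)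
  obtain i j where x: "cell_of n q x = (i, j)" by force
  obtain i' j' where y: "cell_of n q y = (i', j')" by force
  have lq: "l = s / q" by (simp add: s_l_def)
  have ij: "i = nat \<lfloor>(fst x + s/2) / (s / real q)\<rfloor>" "j = nat \<lfloor>(snd x + s/2) / (s / real q)\<rfloor>"
    "i' = nat \<lfloor>(fst y + s/2) / (s / real q)\<rfloor>" "j' = nat \<lfloor>(snd y + s/2) / (s / real q)\<rfloor>"
    using x y by (simp_all add: cell_of_def s_l_def)
  have bnd: "- s/2 \<le> fst x" "fst x < s/2" "- s/2 \<le> snd x" "snd x < s/2"
    "- s/2 \<le> fst y" "fst y < s/2" "- s/2 \<le> snd y" "snd y < s/2"
    using assms(3,4) by (simp_all add: torus_box_def s_l_def mem_Times_iff)
  note bx = cell_coord_bounds(1,2)[OF s(1) assms(2) bnd(1,2), folded ij lq] cell_coord_bounds(1,2)[OF s(1) assms(2) bnd(3,4), folded ij lq]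
  note byy = cell_coord_bounds(1,2)[OF s(1) assms(2) bnd(5,6), folded ij lq] cell_coord_bounds(1,2)[OF s(1) assms(2) bnd(7,8), folded ij lq]
  define u v where "u = \<bar>fst x - fst y\<bar>" "v = \<bar>snd x - snd y\<bar>"
  have u0: "0 \<le> u" "0 \<le> v" by (simp_all add: u_v_def)
  have u_s: "u < s" "v < s" using bnd by (auto simp: u_v_def)
  have "(u \<le> l \<and> v \<le> 2 * l) \<or> (u \<le> 2 * l \<and> v \<le> l)"
  proof -
    have "i = i' \<Longrightarrow> u \<le> l" "j = j' \<Longrightarrow> v \<le> l"
      using bx byy by (auto simp: u_v_def algebra_simps abs_le_iff)
    moreover have "i' = Suc i \<or> i = Suc i' \<or> i = i' \<Longrightarrow> u \<le> 2 * l"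
      using bx byy s by (auto simp: u_v_def algebra_simps abs_le_iff)
    moreover have "j' = Suc j \<or> j = Suc j' \<or> j = j' \<Longrightarrow> v \<le> 2 * l"
      using bx byy s by (auto simp: u_v_def algebra_simps abs_le_iff)
    ultimately show ?thesis using cells x y by (auto simp: adj4_def)
  qed
  then have "u\<^sup>2 + v\<^sup>2 \<le> 5 * l\<^sup>2"
  proof
    assume *: "u \<le> l \<and> v \<le> 2 * l"
    then have "u\<^sup>2 \<le> l\<^sup>2" "v\<^sup>2 \<le> (2 * l)\<^sup>2"
      using u0 power_mono[of u l 2] power_mono[of v "2 * l" 2] by blast+
    then show ?thesis by (simp add: power_mult_distrib)
  next
    assume *: "u \<le> 2 * l \<and> v \<le> l"
    then have "u\<^sup>2 \<le> (2 * l)\<^sup>2" "v\<^sup>2 \<le> l\<^sup>2"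
      using u0 power_mono[of u "2 * l" 2] power_mono[of v l 2] by blast+
    then show ?thesis by (simp add: power_mult_distrib)
  qed
  \<comment> \<open>\<open>u < s\<close> keeps \<open>s - u\<close> positive; otherwise squaring
    would not respect the minimum.\<close>
  moreover have "(min u (s - u))\<^sup>2 \<le> u\<^sup>2" "(min v (s - v))\<^sup>2 \<le> v\<^sup>2"
    using u_s u0 power_mono[of "min u (s - u)" u 2] power_mono[of "min v (s - v)" v 2] by auto
  ultimately have "(min u (s - u))\<^sup>2 + (min v (s - v))\<^sup>2 \<le> 5 * l\<^sup>2" by linarith
  then have "sqrt ((min u (s - u))\<^sup>2 + (min v (s - v))\<^sup>2) \<le> sqrt (5 * l\<^sup>2)" by (rule real_sqrt_le_mono)
  also have "\<dots> = sqrt 5 * l" using s by (simp add: real_sqrt_mult)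
  finally show ?thesis by (simp add: tdist_def Let_def u_v_def s_l_def)
qed

section \<open>Components of the graph and the good cluster\<close>

lemma sym_rgg: "sym ((rgg_edges n r V)\<^sup>*)"
  by (rule sym_rtrancl) (auto simp: sym_def rgg_edges_def rgg_adj_def tdist_commute)

lemma component_subset: "component n r V x \<subseteq> V"
  by (auto simp: component_def)

lemma component_eq:
  assumes "(x, y) \<in> (rgg_edges n r V)\<^sup>*"
  shows "component n r V x = component n r V y"
proof -
  have "(y, x) \<in> (rgg_edges n r V)\<^sup>*" using assms symD[OF sym_rgg] by blast
  then have "(x, z) \<in> (rgg_edges n r V)\<^sup>* \<longleftrightarrow> (y, z) \<in> (rgg_edges n r V)\<^sup>*" for z
    using assms rtrancl_trans by metis
  then show ?thesis by (simp add: component_def)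
qed

lemma cluster_connected:
  assumes n: "0 < n" "0 < q" and V: "V \<subseteq> torus_box n"
    and r: "sqrt 5 * (sqrt n / q) \<le> r"
    and occ: "\<And>v. v \<in> C \<Longrightarrow> \<exists>p\<in>V. cell_of n q p = v"
    and conn: "conn4 C u v" and p: "p \<in> V" "cell_of n q p = u" and p': "p' \<in> V" "cell_of n q p' = v"
  shows "(p, p') \<in> (rgg_edges n r V)\<^sup>*"
proof -
  have edge: "(x, y) \<in> (rgg_edges n r V)\<^sup>*"
    if "x \<in> V" "y \<in> V" "cell_of n q x = cell_of n q y \<or> adj4 (cell_of n q x) (cell_of n q y)" for x y
  proof (cases "x = y")
    case False
    have "tdist n x y \<le> r" using tdist_of_adjacent_cells[OF n, of x y] V that r by force
    then show ?thesis using that False by (auto simp: rgg_edges_def rgg_adj_def)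
  qed simp
  have "\<forall>p'. p' \<in> V \<longrightarrow> cell_of n q p' = v \<longrightarrow> (p, p') \<in> (rgg_edges n r V)\<^sup>*"
    using conn
  proof (induction rule: conn4_induct)
    case refl
    show ?case
      by (intro allI impI, rule edge[OF p(1)]) (simp_all add: p(2))
  next
    case (step a b)
    have "a \<in> C" by fact
    then have "\<exists>p\<in>V. cell_of n q p = a" by (rule occ)
    then obtain z where z: "z \<in> V" "cell_of n q z = a" by (elim bexE)
    show ?case
    proof (intro allI impI)
      fix p' assume p': "p' \<in> V" "cell_of n q p' = b"
      have "(p, z) \<in> (rgg_edges n r V)\<^sup>*" using step.IH z by blast
      moreover have "adj4 a b" by fact
      then have "(z, p') \<in> (rgg_edges n r V)\<^sup>*" using edge[of z p'] z p' by simp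
      ultimately show "(p, p') \<in> (rgg_edges n r V)\<^sup>*" by (rule rtrancl_trans)
    qed
  qed
  then show ?thesis using p' by blast
qed

text \<open>The landing zone of edges across the seam: cells at toroidal but not planar range 3 lie
  here.\<close>

definition border :: "nat \<Rightarrow> (nat \<times> nat) set" where
  "border q = {v \<in> grid q. fst v < 3 \<or> snd v < 3 \<or> q \<le> fst v + 3 \<or> q \<le> snd v + 3}"

lemma card_border: "card (border q) \<le> 12 * q"
proof -
  have "border q \<subseteq> ({..<3} \<times> {..<q} \<union> {..<q} \<times> {..<3}) \<union> ({q-3..<q} \<times> {..<q} \<union> {..<q} \<times> {q-3..<q})"
    by (auto simp: border_def grid_def)
  then have "card (border q) \<le> card (({..<3} \<times> {..<q} \<union> {..<q} \<times> {..<3}) \<union> ({q-3..<q} \<times> {..<q} \<union> {..<q} \<times> {q-3..<q}))"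
    by (rule card_mono[rotated]) simp
  also have "\<dots> \<le> (card ({..<3::nat} \<times> {..<q}) + card ({..<q} \<times> {..<3::nat})) + (card ({q-3..<q} \<times> {..<q}) + card ({..<q} \<times> {q-3..<q}))"
    by (intro order_trans[OF card_Un_le] add_mono card_Un_le)
  also have "\<dots> = 6 * q + 2 * (q - (q - 3)) * q" by (simp add: card_cartesian_product)
  also have "\<dots> \<le> 6 * q + 2 * 3 * q" by (intro add_left_mono mult_right_mono mult_left_mono) auto
  finally show ?thesis by simp
qed

lemma torus_near_border:
  assumes "u \<in> grid q" "v \<in> grid q" "torus_near q 3 u v" "\<not> near 3 u v"
  shows "v \<in> border q"
  using assms by (auto simp: torus_near_def cnear_def near_def border_def grid_def)

lemma card_le_cells:
  assumes "cell_counts_of n q V c" "A \<subseteq> V" "cell_of n q ` A \<subseteq> T" "finite T"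
  shows "card A \<le> (\<Sum>v\<in>T. c v)"
proof -
  have "A \<subseteq> (\<Union>v\<in>T. {p \<in> V. cell_of n q p = v})" using assms by blast
  then have "card A \<le> card (\<Union>v\<in>T. {p \<in> V. cell_of n q p = v})"
    by (rule card_mono[rotated]) (use assms in \<open>auto simp: cell_counts_of_def\<close>)
  also have "\<dots> \<le> (\<Sum>v\<in>T. card {p \<in> V. cell_of n q p = v})" by (rule card_UN_le[OF assms(4)])
  also have "\<dots> \<le> (\<Sum>v\<in>T. c v)" by (rule sum_mono) (use assms(1) in \<open>auto simp: cell_counts_of_def\<close>)
  finally show ?thesis .
qed

text \<open>All points in cells of the cluster lie in one component \<open>L\<close>. Another
  component never enters the cluster, and along its edges the confining rectangle changes only when
  an edge crosses the seam. So it occupies at most \<open>12 * q + 1\<close> rectangles, each with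
  at most \<open>k\<^sup>2\<close> cells and each cell with at most \<open>M\<close> points.\<close>

lemma percolating_giant:
  assumes n: "0 < n" "0 < q" and c: "cell_counts_of n q V c" and perc: "percolating q k c" and kq: "k < q"
    and M: "\<And>v. v \<in> grid q \<Longrightarrow> real (c v) \<le> M"
    and r: "sqrt 5 * (sqrt n / q) \<le> r" "r \<le> 3 * (sqrt n / q)"
  shows "\<exists>L\<in>components n r V. real (card L) \<ge> (real q)\<^sup>2 / 2 \<and>
    (\<forall>L'\<in>components n r V. L' \<noteq> L \<longrightarrow> real (card L') \<le> (12 * real q + 1) * (real k)\<^sup>2 * M)"
proof -
  define B where "B = {v. c v = 0}"
  have V: "finite V" "V \<subseteq> torus_box n" using c by (simp_all add: cell_counts_of_def)
  have occB: "v \<notin> B \<longleftrightarrow> (\<exists>p\<in>V. cell_of n q p = v)" for v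
  proof -
    have "c v = 0 \<longleftrightarrow> (\<forall>p\<in>V. cell_of n q p \<noteq> v)" using c unfolding cell_counts_of_def by blast
    then show ?thesis unfolding B_def by blast
  qed
  have cg: "cell_of n q p \<in> grid q" if "p \<in> V" for p
    using cell_of_in_grid[OF n] V that by blast
  from percolating_cluster[OF perc kq] obtain C \<beta> where C0: "C \<subseteq> grid q - B" "real (card C) \<ge> (real q)\<^sup>2 / 2"
    "\<forall>u\<in>C. \<forall>v\<in>C. conn4 C u v"
    "\<forall>y\<in>grid q - C. y \<in> class_rect q B (\<beta> y) \<and> card (class_rect q B (\<beta> y)) \<le> k\<^sup>2"
    "\<forall>y\<in>grid q - C. \<forall>z\<in>grid q - C. near 3 y z \<longrightarrow> class_rect q B (\<beta> y) = class_rect q B (\<beta> z)"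
    unfolding B_def[symmetric] by (elim exE conjE)
  note C = C0(1,2) C0(3)[rule_format] C0(4)[rule_format] C0(5)[rule_format]
  have occ: "\<exists>p\<in>V. cell_of n q p = v" if "v \<in> C" for v
    using that C(1) occB by blast
  have "C \<noteq> {}" using C(2) n by auto
  then obtain p0 where p0: "p0 \<in> V" "cell_of n q p0 \<in> C" using occ by blast
  define L where "L = component n r V p0"
  have LV: "L \<subseteq> V" by (simp add: L_def component_subset)
  have Lcomp: "L \<in> components n r V" using p0 by (auto simp: L_def components_def)
  have reach: "(p0, p) \<in> (rgg_edges n r V)\<^sup>*" if "p \<in> V" "cell_of n q p \<in> C" for p
    using cluster_connected[OF n V(2) r(1) occ C(3)[OF p0(2) that(2)] p0(1) refl that(1) refl] .
  have "C \<subseteq> cell_of n q ` L"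
  proof
    fix v assume "v \<in> C"
    then obtain p where p: "p \<in> V" "cell_of n q p = v" using occ by blast
    then have "p \<in> L" using reach[of p] \<open>v \<in> C\<close> by (simp add: L_def component_def)
    then show "v \<in> cell_of n q ` L" using p(2) by blast
  qed
  then have "card C \<le> card L"
    using surj_card_le[of L C "cell_of n q"] finite_subset[OF LV V(1)] by simp
  then have "real (card L) \<ge> (real q)\<^sup>2 / 2" using C(2) by linarith
  moreover have "real (card L') \<le> (12 * real q + 1) * (real k)\<^sup>2 * M" if L': "L' \<in> components n r V" "L' \<noteq> L" for L'
  proof -
    obtain x0 where x0: "x0 \<in> V" "L' = component n r V x0" using L'(1) by (auto simp: components_def)
    have out: "cell_of n q y \<in> grid q - C" if "y \<in> V" "(x0, y) \<in> (rgg_edges n r V)\<^sup>*" for y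
    proof -
      have "cell_of n q y \<notin> C"
      proof
        assume "cell_of n q y \<in> C"
        then have "L = component n r V y" using reach[OF that(1)] component_eq by (simp add: L_def)
        then show False using component_eq[OF that(2)] x0 L'(2) by simp
      qed
      then show ?thesis using cg that by simp
    qed
    \<comment> \<open>The rectangle of the starting point, and one for every border cell in which an
      edge across the seam can arrive.\<close>
    define rects where "rects = insert (class_rect q B (\<beta> (cell_of n q x0))) ((\<lambda>v. class_rect q B (\<beta> v)) ` (border q - C))"
    have in_rects: "y \<in> V \<and> class_rect q B (\<beta> (cell_of n q y)) \<in> rects" if "(x0, y) \<in> (rgg_edges n r V)\<^sup>*" for y
      using that
    proof (induction rule: rtrancl_induct)
      case base
      then show ?case using x0 by (simp add: rects_def)
    next
      case (step y z)
      have yz: "y \<in> V" "z \<in> V" "tdist n y z \<le> r" using step(2) by (auto simp: rgg_edges_def rgg_adj_def)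
      have near: "torus_near q 3 (cell_of n q y) (cell_of n q z)"
        by (rule torus_near_of_tdist[OF n _ _ yz(3)]) (use r(2) V(2) yz in auto)
      have oy: "cell_of n q y \<in> grid q - C" using out[OF yz(1) step(1)] .
      have oz: "cell_of n q z \<in> grid q - C" using out[OF yz(2)] step(1,2) by (meson rtrancl_into_rtrancl)
      show ?case
      proof (cases "near 3 (cell_of n q y) (cell_of n q z)")
        case True
        then show ?thesis using C(5)[OF oy oz] step.IH yz by simp
      next
        case False
        then have "cell_of n q z \<in> border q - C"
          using torus_near_border[OF _ _ near] oy oz by auto
        then show ?thesis using yz by (simp add: rects_def)
      qed
    qed
    have fb: "finite (border q)" by (simp add: border_def)
    have frects: "finite rects" using fb by (simp add: rects_def)
    have rects_card: "finite R \<and> card R \<le> k\<^sup>2" if "R \<in> rects" for R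
    proof -
      have "\<exists>y\<in>grid q - C. R = class_rect q B (\<beta> y)"
        using that out[OF x0(1)] by (auto simp: rects_def border_def)
      then show ?thesis using C(4) by (auto simp: class_rect_def)
    qed
    have "cell_of n q y \<in> \<Union>rects" if "y \<in> L'" for y
    proof -
      have y: "y \<in> V" "(x0, y) \<in> (rgg_edges n r V)\<^sup>*" using that x0 by (auto simp: component_def)
      then show ?thesis using in_rects[OF y(2)] C(4)[OF out[OF y]] by blast
    qed
    then have sub: "cell_of n q ` L' \<subseteq> \<Union>rects \<inter> grid q" using cg x0 component_subset by blast
    have M0: "0 \<le> M" using M[OF cg[OF p0(1)]] by (meson of_nat_0_le_iff order_trans)
    have "card L' \<le> (\<Sum>v\<in>\<Union>rects \<inter> grid q. c v)"
      by (rule card_le_cells[OF c _ sub]) (use x0 component_subset in auto)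
    then have "real (card L') \<le> (\<Sum>v\<in>\<Union>rects \<inter> grid q. real (c v))"
      by (metis of_nat_le_iff of_nat_sum)
    also have "\<dots> \<le> (\<Sum>v\<in>\<Union>rects \<inter> grid q. M)" by (intro sum_mono M) auto
    also have "\<dots> = real (card (\<Union>rects \<inter> grid q)) * M" by simp
    also have "\<dots> \<le> ((12 * real q + 1) * (real k)\<^sup>2) * M"
    proof (rule mult_right_mono[OF _ M0])
      have "card (\<Union>rects \<inter> grid q) \<le> card (\<Union>rects)"
        by (rule card_mono) (use frects rects_card in auto)
      also have "\<dots> \<le> (\<Sum>R\<in>rects. card R)" using card_UN_le[OF frects, of "\<lambda>R. R"] by simp
      also have "\<dots> \<le> (\<Sum>R\<in>rects. k\<^sup>2)" by (intro sum_mono) (use rects_card in auto)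
      also have "\<dots> = card rects * k\<^sup>2" by simp
      also have "\<dots> \<le> (12 * q + 1) * k\<^sup>2"
      proof (rule mult_right_mono)
        have "card rects \<le> Suc (card ((\<lambda>v. class_rect q B (\<beta> v)) ` (border q - C)))"
          unfolding rects_def by (rule card_insert_le_m1) auto
        also have "\<dots> \<le> Suc (card (border q - C))" using card_image_le[of "border q - C" "\<lambda>v. class_rect q B (\<beta> v)"] fb by simp
        also have "\<dots> \<le> Suc (card (border q))" using card_mono[OF fb, of "border q - C"] by simp
        finally show "card rects \<le> 12 * q + 1" using card_border[of q] by linarith
      qed simp
      finally have "real (card (\<Union>rects \<inter> grid q)) \<le> real ((12 * q + 1) * k\<^sup>2)" by (rule of_nat_mono)
      then show "real (card (\<Union>rects \<inter> grid q)) \<le> (12 * real q + 1) * (real k)\<^sup>2" by (simp add: algebra_simps)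
    qed
    finally show ?thesis .
  qed
  ultimately show ?thesis using Lcomp by blast
qed

section \<open>Measurability of graph events\<close>

text \<open>\<open>measure\<close> is 0 outside the sigma-algebra, so no lower bound on \<open>ppp_prob\<close> is possible without measurability.
  The event is a finite union of level sets of the pattern recording which relations hold between
  which indices, since configurations with the same pattern are related by a relation-preserving bijection.\<close>

lemma invariant_event_measurable:
  fixes Q :: "'i \<Rightarrow> real \<times> real \<Rightarrow> real \<times> real \<Rightarrow> bool"
  assumes I: "finite I" and meas: "\<And>t. t \<in> I \<Longrightarrow> {z. Q t (fst z) (snd z)} \<in> sets borel"
    and inv: "\<And>V V' \<phi>. finite V \<Longrightarrow> card V \<le> k \<Longrightarrow> bij_betw \<phi> V V' \<Longrightarrow>
      (\<And>t x y. t \<in> I \<Longrightarrow> x \<in> V \<Longrightarrow> y \<in> V \<Longrightarrow> Q t x y = Q t (\<phi> x) (\<phi> y)) \<Longrightarrow> P V \<Longrightarrow> P V'"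
  shows "{\<omega> \<in> space (unif_points n k). P (\<omega> ` {..<k})} \<in> sets (unif_points n k)"
proof -
  let ?M = "unif_points n k" and ?K = "{..<k}"
  \<comment> \<open>The pattern of a configuration: which indices carry the same point, and which
    relations hold. Coincidences are recorded so that equal patterns give a bijection of point sets
    although the samples may repeat points.\<close>
  define \<sigma> where "\<sigma> = (\<lambda>\<omega> :: nat \<Rightarrow> real \<times> real. ({(i, j) \<in> ?K \<times> ?K. \<omega> i = \<omega> j}, {(i, j, t) \<in> ?K \<times> ?K \<times> I. Q t (\<omega> i) (\<omega> j)}))"
  define E where "E = {\<omega> \<in> space ?M. P (\<omega> ` ?K)}"
  have coord: "(\<lambda>\<omega>. \<omega> i) \<in> measurable ?M borel" if "i \<in> ?K" for i
    unfolding unif_points_def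
    using measurable_component_singleton[OF that, of "\<lambda>_. uniform_measure lborel (torus_box n)"]
    by (simp add: measurable_def)
  have pair: "{\<omega> \<in> space ?M. R (\<omega> i) (\<omega> j)} \<in> sets ?M"
    if "{z. R (fst z) (snd z)} \<in> sets borel" "i \<in> ?K" "j \<in> ?K" for R i j
  proof -
    have "(\<lambda>\<omega>. (\<omega> i, \<omega> j)) \<in> measurable ?M borel"
      by (rule borel_measurable_Pair[OF coord[OF that(2)] coord[OF that(3)]])
    from measurable_sets[OF this that(1)] show ?thesis by (simp add: vimage_def Int_def conj_commute)
  qed
  have eq_meas: "{z :: (real \<times> real) \<times> (real \<times> real). fst z = snd z} \<in> sets borel"
    by (intro borel_closed closed_Collect_eq continuous_intros)
  have iff_meas: "{\<omega> \<in> space ?M. A \<omega> = b} \<in> sets ?M" if "{\<omega> \<in> space ?M. A \<omega>} \<in> sets ?M" for A b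
    using that by (cases b) (auto intro: sets.sets_Collect_neg)
  have level: "{\<omega> \<in> space ?M. \<sigma> \<omega> = \<sigma> \<omega>'} \<in> sets ?M" for \<omega>'
  proof -
    have "{\<omega> \<in> space ?M. \<sigma> \<omega> = \<sigma> \<omega>'} = {\<omega> \<in> space ?M.
        (\<forall>i\<in>?K. \<forall>j\<in>?K. (\<omega> i = \<omega> j) = (\<omega>' i = \<omega>' j)) \<and>
        (\<forall>i\<in>?K. \<forall>j\<in>?K. \<forall>t\<in>I. Q t (\<omega> i) (\<omega> j) = Q t (\<omega>' i) (\<omega>' j))}"
      unfolding \<sigma>_def by (simp add: set_eq_iff) blast
    also have "\<dots> \<in> sets ?M"
      by (intro sets.sets_Collect_conj sets.sets_Collect_finite_All I iff_meas pair meas eq_meas finite_lessThan)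
         auto
    finally show ?thesis .
  qed
  have same: "P (\<omega> ` ?K)" if P: "P (\<omega>' ` ?K)" and eq: "\<sigma> \<omega> = \<sigma> \<omega>'" for \<omega> \<omega>'
  proof -
    \<comment> \<open>A choice of index for each point of \<open>\<omega>'\<close>; composing with
      \<open>\<omega>\<close> maps points to points, independently of the choice because
      coincidences agree.\<close>
    define g where "g = (\<lambda>x. SOME i. i \<in> ?K \<and> \<omega>' i = x)"
    have g: "g (\<omega>' i) \<in> ?K \<and> \<omega>' (g (\<omega>' i)) = \<omega>' i" if "i \<in> ?K" for i
      unfolding g_def by (rule someI[of _ i]) (use that in auto)
    have eq1: "(\<omega> i = \<omega> j) = (\<omega>' i = \<omega>' j)" if "i \<in> ?K" "j \<in> ?K" for i j
    proof -
      have "(i, j) \<in> fst (\<sigma> \<omega>) \<longleftrightarrow> (i, j) \<in> fst (\<sigma> \<omega>')" by (simp add: eq)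
      then show ?thesis using that by (simp add: \<sigma>_def)
    qed
    have eq2: "Q t (\<omega> i) (\<omega> j) = Q t (\<omega>' i) (\<omega>' j)" if "i \<in> ?K" "j \<in> ?K" "t \<in> I" for i j t
    proof -
      have "(i, j, t) \<in> snd (\<sigma> \<omega>) \<longleftrightarrow> (i, j, t) \<in> snd (\<sigma> \<omega>')" by (simp add: eq)
      then show ?thesis using that by (simp add: \<sigma>_def)
    qed
    have \<phi>: "\<omega> (g (\<omega>' i)) = \<omega> i" if "i \<in> ?K" for i
      using eq1[of "g (\<omega>' i)" i] g[OF that] that by simp
    show ?thesis
    proof (rule inv[of "\<omega>' ` ?K" "\<lambda>x. \<omega> (g x)"])
      show "card (\<omega>' ` ?K) \<le> k" using card_image_le[of ?K \<omega>'] by simp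
      have "inj_on (\<lambda>x. \<omega> (g x)) (\<omega>' ` ?K)"
        by (auto simp: inj_on_def \<phi> eq1)
      moreover have "(\<lambda>x. \<omega> (g x)) ` \<omega>' ` ?K = \<omega> ` ?K"
        by (auto simp: image_image \<phi>)
      ultimately show "bij_betw (\<lambda>x. \<omega> (g x)) (\<omega>' ` ?K) (\<omega> ` ?K)" by (simp add: bij_betw_def)
      show "Q t x y = Q t (\<omega> (g x)) (\<omega> (g y))" if "t \<in> I" "x \<in> \<omega>' ` ?K" "y \<in> \<omega>' ` ?K" for t x y
        using that by (auto simp: \<phi> eq2)
    qed (use P in auto)
  qed
  have "\<sigma> ` E \<subseteq> Pow (?K \<times> ?K) \<times> Pow (?K \<times> ?K \<times> I)"
    by (auto simp: \<sigma>_def)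
  then have fin: "finite (\<sigma> ` E)"
    by (rule finite_subset) (use I in auto)
  have "{\<omega> \<in> space ?M. \<sigma> \<omega> = \<tau>} \<in> sets ?M" if "\<tau> \<in> \<sigma> ` E" for \<tau>
    using that level by auto
  then have "(\<Union>\<tau>\<in>\<sigma> ` E. {\<omega> \<in> space ?M. \<sigma> \<omega> = \<tau>}) \<in> sets ?M"
    using fin by (intro sets.finite_UN) auto
  moreover have "E = (\<Union>\<tau>\<in>\<sigma> ` E. {\<omega> \<in> space ?M. \<sigma> \<omega> = \<tau>})"
    using same by (auto simp: E_def)
  ultimately show ?thesis by (simp add: E_def)
qed

section \<open>Invariance of graph events under isomorphism\<close>

definition graph_iso :: "nat \<Rightarrow> real \<Rightarrow> (real \<times> real) set \<Rightarrow> (real \<times> real) set \<Rightarrow> (real \<times> real \<Rightarrow> real \<times> real) \<Rightarrow> bool" where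
  "graph_iso n r V V' \<phi> \<longleftrightarrow> bij_betw \<phi> V V' \<and> (\<forall>x\<in>V. \<forall>y\<in>V. rgg_adj n r V x y = rgg_adj n r V' (\<phi> x) (\<phi> y))"

lemma graph_iso_inv:
  assumes "graph_iso n r V V' \<phi>"
  shows "graph_iso n r V' V (inv_into V \<phi>)"
proof -
  have bij: "bij_betw \<phi> V V'" using assms by (simp add: graph_iso_def)
  have "rgg_adj n r V' x y = rgg_adj n r V (inv_into V \<phi> x) (inv_into V \<phi> y)" if "x \<in> V'" "y \<in> V'" for x y
  proof -
    have "inv_into V \<phi> x \<in> V" "inv_into V \<phi> y \<in> V" "\<phi> (inv_into V \<phi> x) = x" "\<phi> (inv_into V \<phi> y) = y"
      using bij that by (auto simp: bij_betw_def intro: inv_into_into f_inv_into_f)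
    then show ?thesis using assms by (auto simp: graph_iso_def)
  qed
  then show ?thesis using bij_betw_inv_into[OF bij] by (simp add: graph_iso_def)
qed

lemma graph_iso_reach:
  assumes iso: "graph_iso n r V V' \<phi>" and xy: "(x, y) \<in> (rgg_edges n r V)\<^sup>*" and x: "x \<in> V"
  shows "(\<phi> x, \<phi> y) \<in> (rgg_edges n r V')\<^sup>*"
  using xy
proof (induction rule: rtrancl_induct)
  case (step y z)
  have "y \<in> V" "z \<in> V" "rgg_adj n r V y z" using step(2) by (auto simp: rgg_edges_def rgg_adj_def)
  then have "(\<phi> y, \<phi> z) \<in> rgg_edges n r V'" using iso by (simp add: graph_iso_def rgg_edges_def)
  then show ?case using step by (meson rtrancl_into_rtrancl)
qed simp

lemma graph_iso_component:
  assumes iso: "graph_iso n r V V' \<phi>" and x: "x \<in> V"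
  shows "component n r V' (\<phi> x) = \<phi> ` component n r V x"
proof -
  have bij: "bij_betw \<phi> V V'" using iso by (simp add: graph_iso_def)
  have inV: "inv_into V \<phi> (\<phi> z) = z" if "z \<in> V" for z
    using bij that by (auto simp: bij_betw_def inv_into_f_f)
  show ?thesis
  proof (intro equalityI subsetI)
    fix y assume "y \<in> component n r V' (\<phi> x)"
    then have y: "y \<in> V'" "(\<phi> x, y) \<in> (rgg_edges n r V')\<^sup>*" by (auto simp: component_def)
    have "\<phi> x \<in> V'" using bij x by (auto simp: bij_betw_def)
    from graph_iso_reach[OF graph_iso_inv[OF iso] y(2) this]
    have "(x, inv_into V \<phi> y) \<in> (rgg_edges n r V)\<^sup>*" using inV[OF x] by simp
    moreover have "inv_into V \<phi> y \<in> V" "\<phi> (inv_into V \<phi> y) = y"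
      using bij y(1) by (auto simp: bij_betw_def intro: inv_into_into f_inv_into_f)
    ultimately have "inv_into V \<phi> y \<in> component n r V x" by (simp add: component_def)
    then show "y \<in> \<phi> ` component n r V x" using \<open>\<phi> (inv_into V \<phi> y) = y\<close> by (metis image_eqI)
  next
    fix y assume "y \<in> \<phi> ` component n r V x"
    then show "y \<in> component n r V' (\<phi> x)"
      using graph_iso_reach[OF iso _ x] bij by (auto simp: component_def bij_betw_def)
  qed
qed

lemma graph_iso_components:
  assumes "graph_iso n r V V' \<phi>"
  shows "components n r V' = image \<phi> ` components n r V"
proof -
  have "V' = \<phi> ` V" using assms by (simp add: graph_iso_def bij_betw_def)
  then show ?thesis
    using graph_iso_component[OF assms] by (simp add: components_def image_image)
qed

lemma components_subset: "L \<in> components n r V \<Longrightarrow> L \<subseteq> V"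
  by (auto simp: components_def component_def)

lemma graph_iso_card:
  assumes "graph_iso n r V V' \<phi>" "A \<subseteq> V"
  shows "card (\<phi> ` A) = card A"
  using assms by (auto simp: graph_iso_def bij_betw_def intro!: card_image intro: inj_on_subset)

lemma graph_iso_largest:
  assumes iso: "graph_iso n r V V' \<phi>" and L: "L \<subseteq> V"
  shows "is_largest_comp n r V' (\<phi> ` L) = is_largest_comp n r V L"
proof -
  have inj: "inj_on \<phi> V" using iso by (simp add: graph_iso_def bij_betw_def)
  have "L \<in> components n r V" if "\<phi> ` L \<in> components n r V'"
  proof -
    obtain L0 where L0: "L0 \<in> components n r V" "\<phi> ` L = \<phi> ` L0"
      using \<open>\<phi> ` L \<in> components n r V'\<close> graph_iso_components[OF iso] by blast
    then show ?thesis using inj_on_image_eq_iff[OF inj L components_subset[OF L0(1)]] by simp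
  qed
  then have "\<phi> ` L \<in> components n r V' \<longleftrightarrow> L \<in> components n r V"
    using graph_iso_components[OF iso] by blast
  moreover have "(\<forall>L'\<in>components n r V'. card L' \<le> card (\<phi> ` L)) \<longleftrightarrow> (\<forall>L'\<in>components n r V. card (\<phi> ` L') \<le> card (\<phi> ` L))"
    unfolding graph_iso_components[OF iso] by simp
  moreover have "card (\<phi> ` L') = card L'" if "L' \<in> components n r V" for L'
    using graph_iso_card[OF iso components_subset[OF that]] .
  moreover have "card (\<phi> ` L) = card L" by (rule graph_iso_card[OF iso L])
  ultimately show ?thesis by (simp add: is_largest_comp_def)
qed

lemma graph_iso_deg:
  assumes iso: "graph_iso n r V V' \<phi>" and x: "x \<in> V"
  shows "deg n r V' (\<phi> x) = deg n r V x"
proof -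
  have bij: "bij_betw \<phi> V V'" using iso by (simp add: graph_iso_def)
  have "{y \<in> V'. rgg_adj n r V' (\<phi> x) y} = \<phi> ` {y \<in> V. rgg_adj n r V x y}"
    using iso x bij by (auto simp: graph_iso_def bij_betw_def)
  then show ?thesis
    unfolding deg_def using graph_iso_card[OF iso, of "{y \<in> V. rgg_adj n r V x y}"] by auto
qed

lemma graph_iso_deg_set:
  assumes iso: "graph_iso n r V V' \<phi>" and A: "A \<subseteq> V"
  shows "deg_set n r V' (\<phi> ` A) = deg_set n r V A"
proof -
  have "inj_on \<phi> A" using iso A by (auto simp: graph_iso_def bij_betw_def intro: inj_on_subset)
  then have "deg_set n r V' (\<phi> ` A) = (\<Sum>x\<in>A. deg n r V' (\<phi> x))" by (simp add: deg_set_def sum.reindex)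
  also have "\<dots> = deg_set n r V A"
    unfolding deg_set_def by (rule sum.cong) (use graph_iso_deg[OF iso] A in auto)
  finally show ?thesis .
qed

lemma deg_le: "finite V \<Longrightarrow> deg n r V x \<le> card V"
  unfolding deg_def by (intro card_mono) auto

lemma deg_set_le:
  assumes "finite V" "A \<subseteq> V"
  shows "deg_set n r V A \<le> card V * card V"
proof -
  have "deg_set n r V A \<le> (\<Sum>x\<in>A. card V)" unfolding deg_set_def by (intro sum_mono deg_le assms)
  also have "\<dots> \<le> card V * card V" using card_mono[OF assms] by simp
  finally show ?thesis .
qed

lemma borel_measurable_tdist: "(\<lambda>z. tdist n (fst z) (snd z)) \<in> borel_measurable borel"
  unfolding tdist_def Let_def by (intro borel_measurable_continuous_onI continuous_intros)

lemma graph_iso_of_relation: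
  assumes "bij_betw \<phi> V V'"
    and "\<And>x y. x \<in> V \<Longrightarrow> y \<in> V \<Longrightarrow> (tdist n x y \<le> r) = (tdist n (\<phi> x) (\<phi> y) \<le> r)"
  shows "graph_iso n r V V' \<phi>"
  using assms by (auto simp: graph_iso_def rgg_adj_def bij_betw_def inj_on_eq_iff)

definition spread_event :: "nat \<Rightarrow> real \<Rightarrow> real \<Rightarrow> real \<Rightarrow> (real \<times> real) set \<Rightarrow> bool" where
  "spread_event n r t c V \<longleftrightarrow> (\<forall>L. is_largest_comp n r V L \<longrightarrow>
      (\<forall>A \<subseteq> L. stat_pi n r V L A \<ge> t \<longrightarrow>
         (\<exists>x\<in>A. \<exists>y\<in>A. tdist n x y \<ge> c * sqrt (real (deg_set n r V A)))))"

definition giant_event :: "nat \<Rightarrow> real \<Rightarrow> real \<Rightarrow> real \<Rightarrow> (real \<times> real) set \<Rightarrow> bool" where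
  "giant_event n r t e V \<longleftrightarrow> (\<exists>L. is_largest_comp n r V L \<and> real (card L) \<ge> t \<and>
          (\<forall>L' \<in> components n r V. L' \<noteq> L \<longrightarrow> real (card L') \<le> e))"

text \<open>Isomorphism alone does not preserve the distance condition, so
  \<open>c * sqrt m \<le> tdist\<close> is added as a relation for each possible degree sum
  \<open>m\<close>. At most \<open>k\<close> points have degree sum at most \<open>k * k\<close>,
  which keeps the family finite.\<close>

lemma spread_event_measurable:
  "{\<omega> \<in> space (unif_points n k). spread_event n r t c (\<omega> ` {..<k})} \<in> sets (unif_points n k)"
proof -
  define Q where "Q = (\<lambda>m x y. case m of None \<Rightarrow> tdist n x y \<le> r | Some m \<Rightarrow> tdist n x y \<ge> c * sqrt (real m))"
  let ?I = "insert None (Some ` {..k * k})"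
  show ?thesis
  proof (rule invariant_event_measurable[where Q = Q and I = ?I])
    show "{z. Q m (fst z) (snd z)} \<in> sets borel" for m
    proof (cases m)
      case None
      then show ?thesis using borel_measurable_le[OF borel_measurable_tdist borel_measurable_const[of r]]
        by (simp add: Q_def)
    next
      case (Some m)
      then show ?thesis using borel_measurable_le[OF borel_measurable_const borel_measurable_tdist]
        by (simp add: Q_def)
    qed
    fix V V' \<phi>
    assume V: "finite V" "card V \<le> k" and bij: "bij_betw \<phi> V V'"
      and Q: "\<And>m x y. m \<in> ?I \<Longrightarrow> x \<in> V \<Longrightarrow> y \<in> V \<Longrightarrow> Q m x y = Q m (\<phi> x) (\<phi> y)"
      and P: "spread_event n r t c V"
    have iso: "graph_iso n r V V' \<phi>"
      by (rule graph_iso_of_relation[OF bij]) (use Q[of None] in \<open>simp add: Q_def\<close>)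
    have img: "V' = \<phi> ` V" using bij by (simp add: bij_betw_def)
    show "spread_event n r t c V'"
      unfolding spread_event_def
    proof (intro allI impI)
      fix L' A' assume L': "is_largest_comp n r V' L'" and A': "A' \<subseteq> L'" and st: "t \<le> stat_pi n r V' L' A'"
      have L'V: "L' \<subseteq> V'" using L' by (intro components_subset[of L' n r V']) (simp add: is_largest_comp_def)
      then obtain L where L: "L \<subseteq> V" "L' = \<phi> ` L" using img by (meson subset_imageE)
      obtain A where A: "A \<subseteq> L" "A' = \<phi> ` A" using A' L(2) by (meson subset_imageE)
      have AV: "A \<subseteq> V" using A L by blast
      have "is_largest_comp n r V L" using graph_iso_largest[OF iso L(1)] L' L(2) by simp
      moreover have "t \<le> stat_pi n r V L A"
        using st graph_iso_deg_set[OF iso L(1)] graph_iso_deg_set[OF iso AV] by (simp add: stat_pi_def L(2) A(2))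
      ultimately obtain x y where xy: "x \<in> A" "y \<in> A" "tdist n x y \<ge> c * sqrt (real (deg_set n r V A))"
        using P A(1) unfolding spread_event_def by blast
      have "deg_set n r V A \<le> k * k"
        using deg_set_le[OF V(1) AV] mult_mono[OF V(2) V(2)] by (meson le0 order_trans)
      then have "tdist n (\<phi> x) (\<phi> y) \<ge> c * sqrt (real (deg_set n r V A))"
        using Q[of "Some (deg_set n r V A)" x y] xy AV by (auto simp: Q_def)
      then show "\<exists>x\<in>A'. \<exists>y\<in>A'. c * sqrt (real (deg_set n r V' A')) \<le> tdist n x y"
        using xy graph_iso_deg_set[OF iso AV] by (auto simp: A(2))
    qed
  qed simp
qed

lemma giant_event_measurable:
  "{\<omega> \<in> space (unif_points n k). giant_event n r t e (\<omega> ` {..<k})} \<in> sets (unif_points n k)"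
proof (rule invariant_event_measurable[where Q = "\<lambda>_ x y. tdist n x y \<le> r" and I = "{()}"])
  show "{z. tdist n (fst z) (snd z) \<le> r} \<in> sets borel"
    using borel_measurable_le[OF borel_measurable_tdist borel_measurable_const[of r]] by simp
  fix V V' \<phi>
  assume bij: "bij_betw \<phi> V V'" and Q: "\<And>m x y. m \<in> {()} \<Longrightarrow> x \<in> V \<Longrightarrow> y \<in> V \<Longrightarrow> (tdist n x y \<le> r) = (tdist n (\<phi> x) (\<phi> y) \<le> r)"
    and P: "giant_event n r t e V"
  have iso: "graph_iso n r V V' \<phi>"
    by (rule graph_iso_of_relation[OF bij]) (use Q in simp)
  obtain L where L: "is_largest_comp n r V L" "real (card L) \<ge> t"
    "\<forall>L' \<in> components n r V. L' \<noteq> L \<longrightarrow> real (card L') \<le> e" using P unfolding giant_event_def by blast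
  have LV: "L \<subseteq> V" using L(1) by (intro components_subset[of L n r V]) (simp add: is_largest_comp_def)
  have "real (card L') \<le> e" if L': "L' \<in> components n r V'" "L' \<noteq> \<phi> ` L" for L'
  proof -
    obtain L0 where L0: "L0 \<in> components n r V" "L' = \<phi> ` L0"
      using L'(1) graph_iso_components[OF iso] by blast
    then show ?thesis using L(3) L'(2) graph_iso_card[OF iso components_subset[OF L0(1)]] by auto
  qed
  then show "giant_event n r t e V'"
    unfolding giant_event_def
    using graph_iso_largest[OF iso LV] graph_iso_card[OF iso LV] L by (intro exI[of _ "\<phi> ` L"]) auto
qed simp

section \<open>The giant component at large radius\<close>

lemma ppp_prob_True:
  assumes "0 < n"
  shows "ppp_prob n (\<lambda>_. True) = 1"
proof -
  have "ppp_term n (\<lambda>_. True) k = exp (- real n) * real n ^ k / fact k" for k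
  proof -
    interpret prob_space "unif_points n k" by (rule prob_space_unif_points[OF assms])
    show ?thesis using prob_space by (simp add: ppp_term_def)
  qed
  then have "ppp_term n (\<lambda>_. True) sums 1" using poisson_weights_sums[of n] by presburger
  then show ?thesis using ppp_term_sums[OF assms] sums_unique2 by blast
qed

lemma prob_conj_lower:
  "measure_pmf.prob p {c. P c \<and> Q c} \<ge> measure_pmf.prob p {c. P c} - measure_pmf.prob p {c. \<not> Q c}"
proof -
  have "measure_pmf.prob p {c. P c} \<le> measure_pmf.prob p ({c. P c \<and> Q c} \<union> {c. \<not> Q c})"
    by (rule measure_pmf.finite_measure_mono) auto
  also have "\<dots> \<le> measure_pmf.prob p {c. P c \<and> Q c} + measure_pmf.prob p {c. \<not> Q c}"
    by (rule measure_Un_le) auto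
  finally show ?thesis by linarith
qed

lemma tendsto_1_of_lower_bound:
  fixes f g :: "nat \<Rightarrow> real"
  assumes "\<forall>\<^sub>F n in sequentially. f n \<ge> g n" "g \<longlonglongrightarrow> 1" "\<forall>\<^sub>F n in sequentially. f n \<le> 1"
  shows "f \<longlonglongrightarrow> 1"
  by (rule tendsto_sandwich[OF assms(1,3,2) tendsto_const])

lemma exp_1_bounds: "exp 1 - 1 \<le> (2::real)" "2 \<le> exp (1::real)"
  using exp_le exp_ge_add_one_self[of 1] by simp_all

text \<open>The bound by \<open>min e (n / \<rho>\<^sup>2)\<close> does two things: it limits the
  other components by \<open>e\<close>, and it makes the component of the cluster, which has at
  least \<open>n / \<rho>\<^sup>2\<close> points, a largest one.\<close>

lemma giant_event_prob:
  fixes \<rho> :: real and n :: nat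
  assumes \<rho>: "12 < \<rho>" and n: "2 * \<rho> \<le> sqrt n" and e: "(12 * sqrt n + 1) * (2 * ln n + 1)\<^sup>2 * (3 * ln n) \<le> min e (n / \<rho>\<^sup>2)"
    and k: "2 * ln n + 1 < 5 / 2 * sqrt n / \<rho>"
  shows "ppp_prob n (giant_event n \<rho> (n / \<rho>\<^sup>2) e) \<ge>
    1 - 1 / n - 16 * (2 * ln n + 1)\<^sup>2 * (24 * (2 * ln n + 1) + 1)\<^sup>2 * \<rho>\<^sup>2 / n - exp (2 * \<rho>\<^sup>2) / (real n)\<^sup>2"
proof -
  \<comment> \<open>The side \<open>l\<close> then satisfies \<rho>/3 \<le> l \<le> 2\<rho>/5, the
    rounding being absorbed by \<open>2 * \<rho> \<le> sqrt n\<close>. From 5/2 \<ge> sqrt 5 follow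
    both radius conditions, and \<rho> > 12 gives l \<ge> 4, that is, a mean of at least 16 points
    per cell.\<close>
  define q where "q = nat \<lceil>5 / 2 * sqrt n / \<rho>\<rceil>"
  \<comment> \<open>\<open>5 ^ k\<close> is then at least \<open>n\<^sup>2\<close>, enough for a
    union bound over at most \<open>n\<close> cells.\<close>
  define k where "k = nat \<lceil>2 * ln (real n)\<rceil>"
  define l where "l = sqrt n / q"
  define a where "a = real n / (real q)\<^sup>2"
  have s0: "sqrt n > 0" using n \<rho> by linarith
  then have n0: "0 < n" by simp
  have n1: "1 \<le> real n" using n0 by simp
  have ln0: "0 \<le> ln (real n)" using n1 by simp
  have qlo: "5 / 2 * sqrt n / \<rho> \<le> real q" by (simp add: q_def of_nat_ceiling)
  have "real q \<le> 5 / 2 * sqrt n / \<rho> + 1" using s0 \<rho> by (simp add: q_def; linarith)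
  also have "\<dots> \<le> 3 * sqrt n / \<rho>" using n \<rho> by (simp add: field_simps)
  finally have qhi: "real q \<le> 3 * sqrt n / \<rho>" .
  have "0 < 5 / 2 * sqrt n / \<rho>" using s0 \<rho> by simp
  then have q0: "0 < q" using qlo by (metis less_le_trans of_nat_0_less_iff)
  have klo: "2 * ln (real n) \<le> real k" by (simp add: k_def of_nat_ceiling)
  have khi: "real k \<le> 2 * ln n + 1" using ln0 by (simp add: k_def; linarith)
  have kq: "k < q" using khi k qlo by linarith
  have llo: "\<rho> \<le> 3 * l" using qhi q0 \<rho> by (simp add: l_def field_simps)
  have lhi: "l \<le> 2 / 5 * \<rho>" using qlo q0 \<rho> by (simp add: l_def field_simps)
  have l0: "0 < l" using llo \<rho> by linarith
  have al: "a = l\<^sup>2" using n0 by (simp add: a_def l_def power_divide)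
  have "sqrt 5 \<le> sqrt ((5/2)\<^sup>2)" by (intro real_sqrt_le_mono) (simp add: power2_eq_square)
  then have "sqrt 5 * l \<le> 5 / 2 * l" using l0 by (intro mult_right_mono) auto
  then have r1: "sqrt 5 * (sqrt n / q) \<le> \<rho>" using lhi unfolding l_def by linarith
  have r2: "\<rho> \<le> 3 * (sqrt n / q)" using llo by (simp add: l_def)
  have "4 \<le> l" using llo \<rho> by linarith
  then have "4\<^sup>2 \<le> l\<^sup>2" by (intro power_mono) auto
  then have a16: "16 \<le> a" using al by simp
  have a_hi: "a \<le> \<rho>\<^sup>2" unfolding al using lhi l0 \<rho> by (intro power_mono) auto
  have q2: "(real q)\<^sup>2 \<le> real n"
  proof -
    have "3 * sqrt n / \<rho> \<le> 3 * sqrt n / 3" using \<rho> s0 by (intro divide_left_mono) auto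
    then have "real q \<le> sqrt n" using qhi by simp
    then have "(real q)\<^sup>2 \<le> (sqrt n)\<^sup>2" by (intro power_mono) auto
    then show ?thesis by simp
  qed
  have q2lo: "2 * real n / \<rho>\<^sup>2 \<le> (real q)\<^sup>2"
  proof -
    have "(5 / 2 * sqrt n / \<rho>)\<^sup>2 \<le> (real q)\<^sup>2" using qlo s0 \<rho> by (intro power_mono) auto
    moreover have "(5 / 2 * sqrt n / \<rho>)\<^sup>2 = 25 / 4 * (real n / \<rho>\<^sup>2)"
      by (simp add: power_divide power_mult_distrib)
    moreover have "0 \<le> real n / \<rho>\<^sup>2" by simp
    ultimately show ?thesis by linarith
  qed
  have dense: "2401 * exp (- (real n / (real q)\<^sup>2)) \<le> 1 / 5"
  proof -
    \<comment> \<open>A mean of 16 suffices: 2401 / 2^16 is below 1/5.\<close>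
    have "(2::real) ^ 16 \<le> exp 1 ^ 16" using exp_1_bounds by (intro power_mono) auto
    also have "\<dots> = exp 16" by (simp flip: exp_of_nat_mult)
    finally have "65536 \<le> exp (16::real)" by simp
    also have "exp 16 \<le> exp a" using a16 by simp
    finally have "exp (- a) \<le> 1 / 65536" by (simp add: exp_minus divide_simps)
    then show ?thesis by (simp add: a_def)
  qed
  let ?p = "count_law n q"
  \<comment> \<open>With the level 3 ln n, the union bound over at most \<open>n\<close> cells
    leaves an error of order 1/n^2.\<close>
  let ?F = "\<lambda>c. percolating q k c \<and> (\<forall>v\<in>grid q. real (c v) < 3 * ln n)"
  have imp: "giant_event n \<rho> (n / \<rho>\<^sup>2) e V" if c: "cell_counts_of n q V c" and F: "?F c" for V c
  proof -
    have M: "real (c v) \<le> 3 * ln n" if "v \<in> grid q" for v using F that by force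
    from percolating_giant[OF n0 q0 c conjunct1[OF F] kq M r1 r2]
    obtain L where L: "L \<in> components n \<rho> V" "real (card L) \<ge> (real q)\<^sup>2 / 2"
      "\<And>L'. L' \<in> components n \<rho> V \<Longrightarrow> L' \<noteq> L \<Longrightarrow> real (card L') \<le> (12 * real q + 1) * (real k)\<^sup>2 * (3 * ln n)"
      by auto
    have card_L: "n / \<rho>\<^sup>2 \<le> card L" using L(2) q2lo by simp
    have "(12 * real q + 1) * (real k)\<^sup>2 * (3 * ln n) \<le> (12 * sqrt n + 1) * (2 * ln n + 1)\<^sup>2 * (3 * ln n)"
    proof -
      have "real q \<le> sqrt n" using q2 real_le_rsqrt by blast
      then show ?thesis using khi ln0 by (intro mult_right_mono mult_mono power_mono) auto
    qed
    then have small: "real (card L') \<le> e" "real (card L') \<le> card L" if "L' \<in> components n \<rho> V" "L' \<noteq> L" for L'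
      using L(3)[OF that] e card_L by linarith+
    then have "is_largest_comp n \<rho> V L" using L(1) by (auto simp: is_largest_comp_def)
    then show ?thesis using card_L small by (auto simp: giant_event_def)
  qed
  have "ppp_prob n (giant_event n \<rho> (n / \<rho>\<^sup>2) e) \<ge> ppp_prob n (\<lambda>_. True) + measure_pmf.prob ?p {c. ?F c} - 1"
    by (rule ppp_prob_lower_bound[OF n0 q0 giant_event_measurable]) (use imp in blast)
  moreover have "measure_pmf.prob ?p {c. ?F c} \<ge> measure_pmf.prob ?p {c. percolating q k c} -
      measure_pmf.prob ?p {c. \<not> (\<forall>v\<in>grid q. real (c v) < 3 * ln n)}"
    by (rule prob_conj_lower)
  moreover have "measure_pmf.prob ?p {c. \<not> (\<forall>v\<in>grid q. real (c v) < 3 * ln n)} \<le> exp (2 * \<rho>\<^sup>2) / (real n)\<^sup>2"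
  proof -
    have "measure_pmf.prob ?p {c. \<not> (\<forall>v\<in>grid q. real (c v) < 3 * ln n)} =
        measure_pmf.prob ?p {c. \<exists>v\<in>grid q. real (c v) \<ge> 3 * ln n}"
      by (simp add: not_less)
    also have "\<dots> \<le> (real q)\<^sup>2 * exp (a * (exp 1 - 1) - 3 * ln n)"
      unfolding a_def by (rule prob_large_count[OF n0 q0])
    also have "\<dots> \<le> real n * exp (2 * \<rho>\<^sup>2 - 3 * ln n)"
    proof (intro mult_mono q2)
      have "a * (exp 1 - 1) \<le> \<rho>\<^sup>2 * 2" using a_hi a16 exp_1_bounds by (intro mult_mono) auto
      then show "exp (a * (exp 1 - 1) - 3 * ln n) \<le> exp (2 * \<rho>\<^sup>2 - 3 * ln n)" by simp
    qed auto
    also have "exp (2 * \<rho>\<^sup>2 - 3 * ln n) = exp (2 * \<rho>\<^sup>2) / (real n) ^ 3"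
    proof -
      have "exp (3 * ln (real n)) = exp (ln (real n)) ^ 3" by (simp flip: exp_of_nat_mult)
      then show ?thesis using n0 by (simp add: exp_diff)
    qed
    also have "real n * (exp (2 * \<rho>\<^sup>2) / (real n) ^ 3) = exp (2 * \<rho>\<^sup>2) / (real n)\<^sup>2"
      using n0 by (simp add: power2_eq_square power3_eq_cube)
    finally show ?thesis .
  qed
  moreover have "measure_pmf.prob ?p {c. percolating q k c} \<ge>
      1 - 1 / n - 16 * (2 * ln n + 1)\<^sup>2 * (24 * (2 * ln n + 1) + 1)\<^sup>2 * \<rho>\<^sup>2 / n"
  proof -
    have "(real q)\<^sup>2 * (1 / 5) ^ Suc k \<le> real n * (1 / (real n)\<^sup>2)"
    proof (intro mult_mono q2)
      have "exp 1 ^ k \<le> (5::real) ^ k" using exp_1_bounds by (intro power_mono) auto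
      then have "exp (real k) \<le> 5 ^ k" by (simp flip: exp_of_nat_mult)
      moreover have "(real n)\<^sup>2 \<le> exp (real k)"
      proof -
        have "exp (2 * ln (real n)) = exp (ln (real n)) ^ 2" by (simp flip: exp_of_nat_mult)
        then have "exp (2 * ln (real n)) = (real n)\<^sup>2" using n0 by simp
        then show ?thesis using klo by (metis exp_le_cancel_iff)
      qed
      ultimately have "(real n)\<^sup>2 \<le> 5 ^ k" by linarith
      also have "\<dots> \<le> 5 ^ Suc k" by simp
      finally have "1 / 5 ^ Suc k \<le> 1 / (real n)\<^sup>2" using n0 by (intro divide_left_mono) auto
      then show "(1 / 5) ^ Suc k \<le> 1 / (real n)\<^sup>2" by (simp only: power_one_over)
    qed auto
    also have "\<dots> = 1 / n" using n0 by (simp add: power2_eq_square)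
    finally have 1: "(real q)\<^sup>2 * (1 / 5) ^ Suc k \<le> 1 / n" .
    have "16 * (real k)\<^sup>2 * (24 * real k + 1)\<^sup>2 / (real q)\<^sup>2 \<le>
        16 * (2 * ln n + 1)\<^sup>2 * (24 * (2 * ln n + 1) + 1)\<^sup>2 / (real n / \<rho>\<^sup>2)"
    proof (rule frac_le)
      show "16 * (real k)\<^sup>2 * (24 * real k + 1)\<^sup>2 \<le> 16 * (2 * ln n + 1)\<^sup>2 * (24 * (2 * ln n + 1) + 1)\<^sup>2"
        using khi ln0 by (intro mult_mono power_mono) auto
      show "0 < real n / \<rho>\<^sup>2" using n0 \<rho> by simp
      then show "real n / \<rho>\<^sup>2 \<le> (real q)\<^sup>2" using q2lo by simp
    qed simp
    then show ?thesis using prob_percolating[OF n0 q0 dense, of k] 1 by simp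
  qed
  ultimately show ?thesis using ppp_prob_True[OF n0] by linarith
qed

lemma giant_regime_iff:
  "giant_regime \<rho> \<longleftrightarrow> (\<exists>\<theta>>0. \<forall>\<epsilon>>0.
     (\<lambda>n. ppp_prob n (giant_event n \<rho> (\<theta> * real n) (\<epsilon> * real n))) \<longlonglongrightarrow> 1)"
  by (simp only: giant_regime_def giant_event_def[abs_def])

lemma giant_regime_large:
  assumes \<rho>: "12 < \<rho>"
  shows "giant_regime \<rho>"
proof -
  have "(\<lambda>n. ppp_prob n (giant_event n \<rho> (1 / \<rho>\<^sup>2 * real n) (\<epsilon> * real n))) \<longlonglongrightarrow> 1" if \<epsilon>: "0 < \<epsilon>" for \<epsilon>
  proof (rule tendsto_1_of_lower_bound)
    let ?g = "\<lambda>n::nat. 1 - 1 / n - 16 * (2 * ln n + 1)\<^sup>2 * (24 * (2 * ln n + 1) + 1)\<^sup>2 * \<rho>\<^sup>2 / n - exp (2 * \<rho>\<^sup>2) / (real n)\<^sup>2"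
    show "?g \<longlonglongrightarrow> 1" by real_asymp
    have 1: "\<forall>\<^sub>F n::nat in sequentially. 2 * \<rho> \<le> sqrt n" by real_asymp
    have 2: "\<forall>\<^sub>F n::nat in sequentially. 2 * ln n + 1 < 5 / 2 * sqrt n / \<rho>"
      using \<rho> by real_asymp
    have "0 < min \<epsilon> (1 / \<rho>\<^sup>2)" using \<epsilon> \<rho> by simp
    moreover have "\<forall>\<^sub>F n::nat in sequentially. (12 * sqrt n + 1) * (2 * ln n + 1)\<^sup>2 * (3 * ln n) \<le> d * n" if "0 < d" for d :: real
      using that by real_asymp
    ultimately have 3: "\<forall>\<^sub>F n::nat in sequentially. (12 * sqrt n + 1) * (2 * ln n + 1)\<^sup>2 * (3 * ln n) \<le> min \<epsilon> (1 / \<rho>\<^sup>2) * n"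
      by blast
    show "\<forall>\<^sub>F n in sequentially. ?g n \<le> ppp_prob n (giant_event n \<rho> (1 / \<rho>\<^sup>2 * real n) (\<epsilon> * real n))"
      using 1 2 3
    proof eventually_elim
      case (elim n)
      have "min \<epsilon> (1 / \<rho>\<^sup>2) * real n \<le> \<epsilon> * n" "min \<epsilon> (1 / \<rho>\<^sup>2) * real n \<le> 1 / \<rho>\<^sup>2 * n"
        by (intro mult_right_mono; simp)+
      then show ?case using giant_event_prob[OF \<rho> elim(1), of "\<epsilon> * real n"] elim(2,3) by simp
    qed
    show "\<forall>\<^sub>F n in sequentially. ppp_prob n (giant_event n \<rho> (1 / \<rho>\<^sup>2 * real n) (\<epsilon> * real n)) \<le> 1"
      using eventually_gt_at_top[of 0] by eventually_elim (rule ppp_prob_le_1)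
  qed
  moreover have "0 < 1 / \<rho>\<^sup>2" using \<rho> by simp
  ultimately show ?thesis unfolding giant_regime_iff by (intro exI[of _ "1 / \<rho>\<^sup>2"]) blast
qed

lemma giant_regime_above_r_g:
  assumes "r_g < \<rho>"
  shows "giant_regime \<rho>"
proof -
  let ?S = "{r0. \<forall>\<rho>>r0. giant_regime \<rho>}"
  have "12 \<in> ?S" using giant_regime_large by simp
  then have "?S \<noteq> {}" by blast
  moreover have "Inf ?S < \<rho>" using assms by (simp add: r_g_def)
  \<comment> \<open>The set is nonempty, so if all its elements were at least \<rho>, its infimum
    would be at least \<rho> too.\<close>
  ultimately have "\<exists>r0\<in>?S. r0 < \<rho>" by (rule cInf_lessD)
  then show ?thesis by auto
qed

section \<open>Degrees and diameters\<close>

lemma component_mono: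
  assumes "r \<le> r'"
  shows "component n r V x \<subseteq> component n r' V x"
proof -
  have "rgg_edges n r V \<subseteq> rgg_edges n r' V" using assms by (auto simp: rgg_edges_def rgg_adj_def)
  then have "(rgg_edges n r V)\<^sup>* \<subseteq> (rgg_edges n r' V)\<^sup>*" by (rule rtrancl_mono)
  then show ?thesis by (auto simp: component_def)
qed

text \<open>Carries the linear size of a largest component from the constant radius
  \<open>r_min\<close> to the radius r(n).\<close>

lemma largest_comp_card_mono:
  assumes V: "finite V" and r: "r \<le> r'" and L: "is_largest_comp n r V L" and L': "is_largest_comp n r' V L'"
  shows "card L \<le> card L'"
proof -
  obtain x where x: "x \<in> V" "L = component n r V x" using L by (auto simp: is_largest_comp_def components_def)
  have "card L \<le> card (component n r' V x)"
    unfolding x(2) by (rule card_mono[OF finite_subset[OF component_subset V] component_mono[OF r]])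
  also have "\<dots> \<le> card L'" using L' x(1) by (auto simp: is_largest_comp_def components_def)
  finally show ?thesis .
qed

text \<open>A component with two vertices has no isolated vertex, so every degree in it is at least
  1. This turns a linear number of vertices into a linear degree sum.\<close>

lemma deg_set_component_ge:
  assumes V: "finite V" and L: "L \<in> components n r V" and big: "2 \<le> card L"
  shows "card L \<le> deg_set n r V L"
proof -
  obtain x0 where x0: "x0 \<in> V" "L = component n r V x0" using L by (auto simp: components_def)
  have "1 \<le> deg n r V x" if x: "x \<in> L" for x
  proof -
    have "(x0, x) \<in> (rgg_edges n r V)\<^sup>*" using x x0 by (auto simp: component_def)
    then have Lx: "L = component n r V x" using component_eq x0(2) by simp
    obtain z where z: "z \<in> L" "z \<noteq> x"
    proof -
      have "\<not> L \<subseteq> {x}" using big card_mono[of "{x}" L] by auto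
      then show ?thesis using that by blast
    qed
    have "(x, z) \<in> (rgg_edges n r V)\<^sup>*" using z(1) Lx by (auto simp: component_def)
    then obtain y where "(x, y) \<in> rgg_edges n r V"
      using z(2) by (metis converse_rtranclE)
    then have "rgg_adj n r V x y" "y \<in> V" by (auto simp: rgg_edges_def rgg_adj_def)
    then have "{y \<in> V. rgg_adj n r V x y} \<noteq> {}" by blast
    then show ?thesis unfolding deg_def using V by (simp add: Suc_le_eq card_gt_0_iff)
  qed
  then have "(\<Sum>x\<in>L. 1) \<le> deg_set n r V L" unfolding deg_set_def by (intro sum_mono)
  then show ?thesis by simp
qed

section \<open>Degree sums and sums of squared counts\<close>

lemma real_card_torus_ball:
  assumes "u \<in> grid q"
  shows "real (card (torus_ball q R u)) \<le> (2 * real R + 1)\<^sup>2"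
proof -
  have "real (card (torus_ball q R u)) \<le> real ((2 * R + 1)\<^sup>2)" by (rule of_nat_mono[OF card_torus_ball[OF assms]])
  also have "\<dots> = (2 * real R + 1)\<^sup>2" by (simp add: add.commute)
  finally show ?thesis .
qed

lemma torus_ball_mono: "R \<le> R' \<Longrightarrow> torus_ball q R u \<subseteq> torus_ball q R' u"
  by (auto simp: torus_ball_def torus_near_def cnear_def)

lemma torus_ball_full:
  assumes "u \<in> grid q"
  shows "torus_ball q q u = grid q"
  using assms by (auto simp: torus_ball_def torus_near_def cnear_def grid_def)

text \<open>A degree is at most the number of points in the \<open>K\<close>-ball of cells around
  the vertex, so the degree sum is bounded by products of counts of nearby cells. Each product is at
  most the sum of the two squares, and each square occurs at most \<open>(2 * K + 1)\<^sup>2\<close>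
  times on either side.\<close>

lemma deg_set_le_square_sum:
  assumes n: "0 < n" "0 < q" and c: "cell_counts_of n q V c" and r: "r \<le> real K * (sqrt n / q)"
    and A: "A \<subseteq> V" "cell_of n q ` A \<subseteq> torus_ball q R u" and u: "u \<in> grid q"
  shows "real (deg_set n r V A) \<le> 2 * (2 * real K + 1)\<^sup>2 * (\<Sum>w\<in>torus_ball q (R + K) u. (real (c w))\<^sup>2)"
proof -
  have V: "finite V" "V \<subseteq> torus_box n" using c by (simp_all add: cell_counts_of_def)
  have cg: "cell_of n q p \<in> grid q" if "p \<in> V" for p
    using cell_of_in_grid[OF n] V that by blast
  let ?S = "\<lambda>v. \<Sum>w\<in>torus_ball q K v. c w"
  let ?B = "torus_ball q R u" and ?B' = "torus_ball q (R + K) u"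
  have finA: "finite A" by (rule finite_subset[OF A(1) V(1)])
  have "deg n r V x \<le> ?S (cell_of n q x)" if "x \<in> V" for x
    unfolding deg_def
  proof (rule card_le_cells[OF c])
    show "cell_of n q ` {y \<in> V. rgg_adj n r V x y} \<subseteq> torus_ball q K (cell_of n q x)"
    proof
      fix w assume "w \<in> cell_of n q ` {y \<in> V. rgg_adj n r V x y}"
      then obtain y where y: "y \<in> V" "tdist n x y \<le> r" "w = cell_of n q y" by (auto simp: rgg_adj_def)
      have "torus_near q K (cell_of n q x) (cell_of n q y)"
        by (rule torus_near_of_tdist[OF n _ _ y(2) r]) (use V that y in auto)
      then show "w \<in> torus_ball q K (cell_of n q x)" using cg[OF y(1)] y(3) by (simp add: torus_ball_def)
    qed
  qed auto
  then have "deg_set n r V A \<le> (\<Sum>x\<in>A. ?S (cell_of n q x))"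
    unfolding deg_set_def using A(1) by (intro sum_mono) auto
  also have "\<dots> = (\<Sum>v\<in>?B. \<Sum>x\<in>{x \<in> A. cell_of n q x = v}. ?S (cell_of n q x))"
    by (rule sum.group[symmetric]) (use finA A(2) in auto)
  also have "\<dots> = (\<Sum>v\<in>?B. card {x \<in> A. cell_of n q x = v} * ?S v)"
    by (intro sum.cong) auto
  also have "\<dots> \<le> (\<Sum>v\<in>?B. c v * ?S v)"
  proof (intro sum_mono mult_right_mono)
    fix v
    have "card {x \<in> A. cell_of n q x = v} \<le> card {p \<in> V. cell_of n q p = v}"
      by (rule card_mono) (use V A in auto)
    also have "\<dots> \<le> c v" using c unfolding cell_counts_of_def by blast
    finally show "card {x \<in> A. cell_of n q x = v} \<le> c v" .
  qed simp
  finally have "real (deg_set n r V A) \<le> real (\<Sum>v\<in>?B. c v * ?S v)" by (rule of_nat_mono)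
  also have "\<dots> = (\<Sum>v\<in>?B. \<Sum>w\<in>torus_ball q K v. real (c v) * real (c w))"
    by (simp add: sum_distrib_left)
  also have "\<dots> \<le> (\<Sum>v\<in>?B. \<Sum>w\<in>torus_ball q K v. (real (c v))\<^sup>2 + (real (c w))\<^sup>2)"
  proof (intro sum_mono)
    fix v w
    have "0 \<le> (real (c v) - real (c w))\<^sup>2 + (real (c v))\<^sup>2 + (real (c w))\<^sup>2" by simp
    then show "real (c v) * real (c w) \<le> (real (c v))\<^sup>2 + (real (c w))\<^sup>2"
      by (simp add: power2_diff)
  qed
  also have "\<dots> = (\<Sum>v\<in>?B. real (card (torus_ball q K v)) * (real (c v))\<^sup>2) + (\<Sum>v\<in>?B. \<Sum>w\<in>torus_ball q K v. (real (c w))\<^sup>2)"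
    by (simp add: sum.distrib)
  also have "(\<Sum>v\<in>?B. real (card (torus_ball q K v)) * (real (c v))\<^sup>2) \<le> (2 * real K + 1)\<^sup>2 * (\<Sum>w\<in>?B'. (real (c w))\<^sup>2)"
  proof -
    have ball: "real (card (torus_ball q K v)) \<le> (2 * real K + 1)\<^sup>2" if "v \<in> ?B" for v
      by (rule real_card_torus_ball) (use that in \<open>simp add: torus_ball_def\<close>)
    have "(\<Sum>v\<in>?B. real (card (torus_ball q K v)) * (real (c v))\<^sup>2) \<le> (\<Sum>v\<in>?B. (2 * real K + 1)\<^sup>2 * (real (c v))\<^sup>2)"
      by (intro sum_mono mult_right_mono ball) auto
    also have "\<dots> = (2 * real K + 1)\<^sup>2 * (\<Sum>v\<in>?B. (real (c v))\<^sup>2)" by (rule sum_distrib_left[symmetric])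
    also have "\<dots> \<le> (2 * real K + 1)\<^sup>2 * (\<Sum>w\<in>?B'. (real (c w))\<^sup>2)"
      by (intro mult_left_mono sum_mono2 torus_ball_mono) auto
    finally show ?thesis .
  qed
  also have "(\<Sum>v\<in>?B. \<Sum>w\<in>torus_ball q K v. (real (c w))\<^sup>2) \<le> (2 * real K + 1)\<^sup>2 * (\<Sum>w\<in>?B'. (real (c w))\<^sup>2)"
  proof -
    have sub: "torus_ball q K v \<subseteq> ?B'" if "v \<in> ?B" for v
    proof
      fix w assume "w \<in> torus_ball q K v"
      then show "w \<in> ?B'" using that torus_near_trans[OF u, of v w R K] by (simp add: torus_ball_def)
    qed
    \<comment> \<open>Double counting: extending the inner sum to the larger ball allows the sums to
      be exchanged, and symmetry of nearness bounds how often a cell \<open>w\<close> is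
      met.\<close>
    have "(\<Sum>v\<in>?B. \<Sum>w\<in>torus_ball q K v. (real (c w))\<^sup>2) =
        (\<Sum>v\<in>?B. \<Sum>w\<in>?B'. if w \<in> torus_ball q K v then (real (c w))\<^sup>2 else 0)"
      by (intro sum.cong refl sum.mono_neutral_cong_left) (use sub in auto)
    also have "\<dots> = (\<Sum>w\<in>?B'. \<Sum>v\<in>?B. if w \<in> torus_ball q K v then (real (c w))\<^sup>2 else 0)"
      by (rule sum.swap)
    also have "\<dots> = (\<Sum>w\<in>?B'. real (card {v \<in> ?B. w \<in> torus_ball q K v}) * (real (c w))\<^sup>2)"
      by (intro sum.cong refl) (simp add: sum.If_cases Int_def)
    also have "\<dots> \<le> (\<Sum>w\<in>?B'. (2 * real K + 1)\<^sup>2 * (real (c w))\<^sup>2)"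
    proof (intro sum_mono mult_right_mono)
      fix w assume w: "w \<in> ?B'"
      have "card {v \<in> ?B. w \<in> torus_ball q K v} \<le> card (torus_ball q K w)"
        by (rule card_mono) (auto simp: torus_ball_def torus_near_sym)
      moreover have "real (card (torus_ball q K w)) \<le> (2 * real K + 1)\<^sup>2"
        by (rule real_card_torus_ball) (use w in \<open>simp add: torus_ball_def\<close>)
      ultimately show "real (card {v \<in> ?B. w \<in> torus_ball q K v}) \<le> (2 * real K + 1)\<^sup>2" by linarith
    qed simp
    finally show ?thesis by (simp only: sum_distrib_left)
  qed
  finally show ?thesis by simp
qed

text \<open>The summand 9 (ln n)^2 is the product of the truncation level and the exponent of the
  tail bound, both 3 ln n. Restricting to \<open>R \<le> q\<close> leaves finitely many balls for a
  union bound; the ball of radius \<open>q\<close> is already the whole grid.\<close>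

definition balanced :: "nat \<Rightarrow> nat \<Rightarrow> real \<Rightarrow> (nat \<times> nat \<Rightarrow> nat) \<Rightarrow> bool" where
  "balanced n q K c \<longleftrightarrow> (\<forall>u\<in>grid q. \<forall>R\<le>q.
     (\<Sum>w\<in>torus_ball q R u. (real (c w))\<^sup>2) \<le> K * (2 * real R + 1)\<^sup>2 + 9 * (ln n)\<^sup>2)"

text \<open>\<open>n \<le> q\<^sup>2\<close> makes the mean per cell at most 1, which gives a
  constant free of \<open>n\<close> and \<open>q\<close>. There are
  \<open>q\<^sup>2 * (q + 1)\<close> balls, each failing with probability at most n^(-3), so for
  \<open>q\<close> of order sqrt n the error vanishes.\<close>

lemma prob_balanced:
  fixes n q :: nat
  assumes n: "2 \<le> n" and q: "0 < q" "real n \<le> (real q)\<^sup>2"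
  shows "measure_pmf.prob (count_law n q) {c. balanced n q (2 * exp (exp 2)) c} \<ge>
    1 - (real q)\<^sup>2 * (real q + 1) / real n ^ 3 - (real q)\<^sup>2 * exp 2 / real n ^ 3"
proof -
  let ?p = "count_law n q" and ?M = "3 * ln (real n)"
  define a where "a = real n / (real q)\<^sup>2"
  have n0: "0 < n" using n by simp
  have a1: "0 \<le> a" "a \<le> 1" using q by (simp_all add: a_def)
  have M: "0 < ?M" using n by simp
  have e3: "exp (- ?M) = 1 / real n ^ 3"
  proof -
    have "exp ?M = exp (ln (real n)) ^ 3" by (simp flip: exp_of_nat_mult)
    then show ?thesis using n0 by (simp add: exp_minus divide_simps)
  qed
  define K where "K = 2 * exp (a * (exp 2 - 1))"
  have K: "0 \<le> K" "K \<le> 2 * exp (exp 2)"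
  proof -
    have "a * (exp 2 - 1) \<le> 1 * exp 2" using a1 by (intro mult_mono) auto
    then show "K \<le> 2 * exp (exp 2)" by (simp add: K_def)
  qed (simp add: K_def)
  let ?Bad1 = "{c. \<exists>v\<in>grid q. real (c v) \<ge> ?M}"
  let ?Bad2 = "\<lambda>T. {c. (\<forall>v\<in>T. real (c v) \<le> ?M) \<and> (\<Sum>v\<in>T. (real (c v))\<^sup>2) \<ge> K * card T + ?M * ?M}"
  let ?I = "grid q \<times> {..q}"
  have "{c. \<not> balanced n q (2 * exp (exp 2)) c} \<subseteq> ?Bad1 \<union> (\<Union>i\<in>?I. ?Bad2 (torus_ball q (snd i) (fst i)))"
  proof
    fix c assume "c \<in> {c. \<not> balanced n q (2 * exp (exp 2)) c}"
    then obtain u R where uR: "u \<in> grid q" "R \<le> q"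
      "(\<Sum>w\<in>torus_ball q R u. (real (c w))\<^sup>2) > 2 * exp (exp 2) * (2 * real R + 1)\<^sup>2 + 9 * (ln n)\<^sup>2"
      unfolding balanced_def mem_Collect_eq not_all bex_simps by (meson linorder_not_le)
    show "c \<in> ?Bad1 \<union> (\<Union>i\<in>?I. ?Bad2 (torus_ball q (snd i) (fst i)))"
    proof (cases "c \<in> ?Bad1")
      case False
      then have small: "\<forall>v\<in>torus_ball q R u. real (c v) \<le> ?M" by (auto simp: torus_ball_def not_le intro: less_imp_le)
      have "real (card (torus_ball q R u)) \<le> (2 * real R + 1)\<^sup>2" by (rule real_card_torus_ball[OF uR(1)])
      then have "K * card (torus_ball q R u) \<le> 2 * exp (exp 2) * (2 * real R + 1)\<^sup>2"
        using K by (intro mult_mono) auto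
      moreover have "?M * ?M = 9 * (ln n)\<^sup>2" by (simp add: power2_eq_square)
      ultimately have "c \<in> ?Bad2 (torus_ball q (snd (u, R)) (fst (u, R)))" using small uR(3) by simp
      then show ?thesis using uR(1,2) by (intro UnI2 UN_I[of "(u, R)"]) auto
    qed blast
  qed
  then have "measure_pmf.prob ?p {c. \<not> balanced n q (2 * exp (exp 2)) c} \<le>
      measure_pmf.prob ?p (?Bad1 \<union> (\<Union>i\<in>?I. ?Bad2 (torus_ball q (snd i) (fst i))))"
    by (rule measure_pmf.finite_measure_mono) simp
  also have "\<dots> \<le> measure_pmf.prob ?p ?Bad1 + measure_pmf.prob ?p (\<Union>i\<in>?I. ?Bad2 (torus_ball q (snd i) (fst i)))"
    by (rule measure_Un_le) auto
  also have "measure_pmf.prob ?p ?Bad1 \<le> (real q)\<^sup>2 * exp 2 / real n ^ 3"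
  proof -
    have "measure_pmf.prob ?p ?Bad1 \<le> (real q)\<^sup>2 * exp (a * (exp 1 - 1) - ?M)"
      unfolding a_def by (rule prob_large_count[OF n0 q(1)])
    also have "\<dots> \<le> (real q)\<^sup>2 * exp (2 - ?M)"
    proof -
      have "a * (exp 1 - 1) \<le> 1 * 2" using a1 exp_1_bounds by (intro mult_mono) auto
      then show ?thesis by (intro mult_left_mono) auto
    qed
    also have "exp (2 - ?M) = exp 2 * exp (- ?M)" by (simp flip: exp_add)
    finally show ?thesis unfolding e3 by simp
  qed
  also have "measure_pmf.prob ?p (\<Union>i\<in>?I. ?Bad2 (torus_ball q (snd i) (fst i))) \<le> (real q)\<^sup>2 * (real q + 1) / real n ^ 3"
  proof -
    have "measure_pmf.prob ?p (\<Union>i\<in>?I. ?Bad2 (torus_ball q (snd i) (fst i))) \<le>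
        (\<Sum>i\<in>?I. measure_pmf.prob ?p (?Bad2 (torus_ball q (snd i) (fst i))))"
      by (rule measure_pmf.finite_measure_subadditive_finite) auto
    also have "\<dots> \<le> (\<Sum>i\<in>?I. exp (- ?M))"
      unfolding K_def a_def
      by (intro sum_mono prob_large_square_sum[OF n0 q(1) _ M]) (auto simp: torus_ball_def)
    also have "\<dots> = (real q)\<^sup>2 * (real q + 1) / real n ^ 3"
      unfolding e3 by (simp add: card_cartesian_product card_grid power2_eq_square algebra_simps add_divide_distrib)
    finally show ?thesis .
  qed
  finally have "measure_pmf.prob ?p {c. \<not> balanced n q (2 * exp (exp 2)) c} \<le>
      (real q)\<^sup>2 * exp 2 / real n ^ 3 + (real q)\<^sup>2 * (real q + 1) / real n ^ 3" by simp
  moreover have "measure_pmf.prob ?p {c. balanced n q (2 * exp (exp 2)) c} = 1 - measure_pmf.prob ?p {c. \<not> balanced n q (2 * exp (exp 2)) c}"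
    using measure_pmf.prob_compl[of "{c. balanced n q (2 * exp (exp 2)) c}" ?p]
    by (simp add: Compl_eq_Diff_UNIV[symmetric] Collect_neg_eq)
  ultimately show ?thesis by linarith
qed

lemma balanced_ball_sum:
  assumes "balanced n q K c" "u \<in> grid q" "0 \<le> K"
  shows "(\<Sum>w\<in>torus_ball q R u. (real (c w))\<^sup>2) \<le> K * (2 * real R + 1)\<^sup>2 + 9 * (ln n)\<^sup>2"
proof (cases "R \<le> q")
  case False
  have "(\<Sum>w\<in>torus_ball q R u. (real (c w))\<^sup>2) \<le> (\<Sum>w\<in>torus_ball q q u. (real (c w))\<^sup>2)"
    unfolding torus_ball_full[OF assms(2)] by (intro sum_mono2) (auto simp: torus_ball_def)
  also have "\<dots> \<le> K * (2 * real q + 1)\<^sup>2 + 9 * (ln n)\<^sup>2" using assms(1,2) unfolding balanced_def by blast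
  also have "\<dots> \<le> K * (2 * real R + 1)\<^sup>2 + 9 * (ln n)\<^sup>2"
    using False assms(3) by (intro add_right_mono mult_left_mono power_mono) auto
  finally show ?thesis .
qed (use assms in \<open>unfold balanced_def, blast\<close>)

text \<open>A cell side of at least 1/2 places \<open>A\<close> in a ball of \<lceil>2D\<rceil>
  cells around any of its points. One constant \<open>H\<close> dominates the coefficients of both
  terms; the part of the ball size not involving \<open>D\<close> is absorbed into the logarithmic
  term, since ln n \<ge> 1.\<close>

lemma deg_set_le_diameter:
  fixes D :: real
  assumes n: "0 < n" "0 < q" and l: "1 / 2 \<le> sqrt n / q" and c: "cell_counts_of n q V c"
    and bal: "balanced n q K c" "0 \<le> K" and ln: "1 \<le> ln n"
    and r: "r \<le> real m / 2" and A: "A \<subseteq> V" "A \<noteq> {}" and D: "0 \<le> D" "\<And>x y. x \<in> A \<Longrightarrow> y \<in> A \<Longrightarrow> tdist n x y \<le> D"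
  defines "H \<equiv> 2 * (2 * real m + 1)\<^sup>2 * (32 * K + 2 * K * (2 * real m + 3)\<^sup>2 + 9)"
  shows "real (deg_set n r V A) \<le> H * D\<^sup>2 + H * (ln n)\<^sup>2"
proof -
  have V: "V \<subseteq> torus_box n" using c by (simp add: cell_counts_of_def)
  obtain x where x: "x \<in> A" using A by blast
  define u where "u = cell_of n q x"
  have u: "u \<in> grid q" unfolding u_def by (rule cell_of_in_grid[OF n]) (use x A V in blast)
  define R where "R = nat \<lceil>2 * D\<rceil>"
  have Rlo: "2 * D \<le> real R" by (simp add: R_def of_nat_ceiling)
  have Rhi: "real R \<le> 2 * D + 1" using D(1) by (simp add: R_def; linarith)
  have sq: "(x + y)\<^sup>2 \<le> 2 * x\<^sup>2 + 2 * y\<^sup>2" for x y :: real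
    using zero_le_power2[of "x - y"] by (simp add: power2_eq_square algebra_simps)
  have half: "real j / 2 \<le> real j * (sqrt n / q)" for j :: nat
    using mult_left_mono[OF l, of "real j"] by simp
  have sub: "cell_of n q ` A \<subseteq> torus_ball q R u"
  proof
    fix v assume "v \<in> cell_of n q ` A"
    then obtain y where y: "y \<in> A" "v = cell_of n q y" by blast
    have "D \<le> real R * (sqrt n / q)" using Rlo half[of R] by linarith
    then have "torus_near q R u v"
      unfolding u_def y(2) by (intro torus_near_of_tdist[OF n _ _ D(2)[OF x y(1)]]) (use x y A V in auto)
    moreover have "v \<in> grid q" unfolding y(2) by (rule cell_of_in_grid[OF n]) (use y A V in blast)
    ultimately show "v \<in> torus_ball q R u" by (simp add: torus_ball_def)
  qed
  have "r \<le> real m * (sqrt n / q)" using r half[of m] by linarith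
  from deg_set_le_square_sum[OF n c this A(1) sub u]
  have "real (deg_set n r V A) \<le> 2 * (2 * real m + 1)\<^sup>2 * (\<Sum>w\<in>torus_ball q (R + m) u. (real (c w))\<^sup>2)" .
  also have "\<dots> \<le> 2 * (2 * real m + 1)\<^sup>2 * (32 * K * D\<^sup>2 + (2 * K * (2 * real m + 3)\<^sup>2 + 9) * (ln n)\<^sup>2)"
  proof (rule mult_left_mono)
    have "(\<Sum>w\<in>torus_ball q (R + m) u. (real (c w))\<^sup>2) \<le> K * (2 * real (R + m) + 1)\<^sup>2 + 9 * (ln n)\<^sup>2"
      by (rule balanced_ball_sum[OF bal(1) u bal(2)])
    also have "K * (2 * real (R + m) + 1)\<^sup>2 \<le> K * (32 * D\<^sup>2 + 2 * (2 * real m + 3)\<^sup>2)"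
    proof (rule mult_left_mono[OF _ bal(2)])
      \<comment> \<open>From R \<le> 2D + 1. Splitting the square into 2 (4 D)^2 and a constant part
        produces the 32 in \<open>H\<close>.\<close>
      have "(2 * real (R + m) + 1)\<^sup>2 \<le> (4 * D + (2 * real m + 3))\<^sup>2" using Rhi D(1) by (intro power_mono) auto
      also have "\<dots> \<le> 2 * (4 * D)\<^sup>2 + 2 * (2 * real m + 3)\<^sup>2"
        using sq[of "4 * D" "2 * real m + 3"] .
      finally show "(2 * real (R + m) + 1)\<^sup>2 \<le> 32 * D\<^sup>2 + 2 * (2 * real m + 3)\<^sup>2" by (simp add: power_mult_distrib)
    qed
    also have "K * (32 * D\<^sup>2 + 2 * (2 * real m + 3)\<^sup>2) + 9 * (ln n)\<^sup>2 \<le>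
        32 * K * D\<^sup>2 + (2 * K * (2 * real m + 3)\<^sup>2 + 9) * (ln n)\<^sup>2"
    proof -
      have "1 \<le> (ln (real n))\<^sup>2" using ln by simp
      then have "2 * K * (2 * real m + 3)\<^sup>2 * 1 \<le> 2 * K * (2 * real m + 3)\<^sup>2 * (ln n)\<^sup>2"
        using bal(2) by (intro mult_left_mono) auto
      then show ?thesis by (simp add: algebra_simps)
    qed
    finally show "(\<Sum>w\<in>torus_ball q (R + m) u. (real (c w))\<^sup>2) \<le>
        32 * K * D\<^sup>2 + (2 * K * (2 * real m + 3)\<^sup>2 + 9) * (ln n)\<^sup>2" by simp
  qed simp
  also have "\<dots> \<le> 2 * (2 * real m + 1)\<^sup>2 * ((32 * K + 2 * K * (2 * real m + 3)\<^sup>2 + 9) * D\<^sup>2 + (32 * K + 2 * K * (2 * real m + 3)\<^sup>2 + 9) * (ln n)\<^sup>2)"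
    using bal(2) by (intro mult_left_mono add_mono mult_right_mono) auto
  finally show ?thesis by (simp add: H_def algebra_simps)
qed

text \<open>If all distances in \<open>A\<close> were below D = sqrt (deg(A) / (2 H)), the diameter
  bound would give deg(A) \<le> deg(A)/2 + H (ln n)^2, that is, deg(A) \<le> 2 H (ln n)^2. The
  threshold is set so that, with a degree sum of the largest component of at least \<theta> n,
  deg(A) is at least (2 H + 1) (ln n)^2.\<close>

lemma spread_event_of_balanced:
  fixes \<theta> :: real
  assumes n: "0 < n" "0 < q" and l: "1 / 2 \<le> sqrt n / q" and c: "cell_counts_of n q V c"
    and bal: "balanced n q K c" "0 \<le> K" and ln: "1 \<le> ln n"
    and r: "r0 \<le> r" "r \<le> real m / 2" and giant: "giant_event n r0 (\<theta> * n) e V" and \<theta>: "0 < \<theta>" "2 \<le> \<theta> * n"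
  defines "H \<equiv> 2 * (2 * real m + 1)\<^sup>2 * (32 * K + 2 * K * (2 * real m + 3)\<^sup>2 + 9)"
  shows "spread_event n r ((2 * H + 1) / \<theta> * (ln n)\<^sup>2 / n) (1 / sqrt (2 * H)) V"
  unfolding spread_event_def
proof (intro allI impI, rule ccontr)
  fix L A assume L: "is_largest_comp n r V L" and A: "A \<subseteq> L"
    and st: "(2 * H + 1) / \<theta> * (ln n)\<^sup>2 / n \<le> stat_pi n r V L A"
    and no: "\<not> (\<exists>x\<in>A. \<exists>y\<in>A. 1 / sqrt (2 * H) * sqrt (real (deg_set n r V A)) \<le> tdist n x y)"
  have V: "finite V" using c by (simp add: cell_counts_of_def)
  have "9 \<le> 32 * K + 2 * K * (2 * real m + 3)\<^sup>2 + 9" using bal(2) by simp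
  then have H: "0 < H" unfolding H_def by (intro mult_pos_pos) auto
  have Lc: "L \<in> components n r V" using L by (simp add: is_largest_comp_def)
  obtain L0 where L0: "is_largest_comp n r0 V L0" "\<theta> * n \<le> card L0" using giant by (auto simp: giant_event_def)
  have "card L0 \<le> card L" by (rule largest_comp_card_mono[OF V r(1) L0(1) L])
  then have Lbig: "\<theta> * n \<le> card L" using L0(2) by linarith
  then have "2 \<le> card L" using \<theta>(2) by linarith
  from deg_set_component_ge[OF V Lc this] have degL: "\<theta> * n \<le> deg_set n r V L" using Lbig by linarith
  have degL0: "0 < real (deg_set n r V L)" using degL \<theta>(2) by linarith
  have ln2: "0 < (ln (real n))\<^sup>2" using ln by simp
  have "(2 * H + 1) * (ln n)\<^sup>2 = (2 * H + 1) / \<theta> * (ln n)\<^sup>2 / n * (\<theta> * n)"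
    using \<theta>(1) n(1) by simp
  also have "\<dots> \<le> (2 * H + 1) / \<theta> * (ln n)\<^sup>2 / n * deg_set n r V L"
    using degL H \<theta>(1) by (intro mult_left_mono) auto
  also have "\<dots> \<le> stat_pi n r V L A * deg_set n r V L" using st degL0 by (intro mult_right_mono) auto
  also have "\<dots> = deg_set n r V A" using degL0 by (simp add: stat_pi_def)
  finally have lower: "(2 * H + 1) * (ln n)\<^sup>2 \<le> deg_set n r V A" .
  have "0 < (2 * H + 1) * (ln n)\<^sup>2" using H ln2 by (intro mult_pos_pos) auto
  \<comment> \<open>The empty set is excluded by the positive lower bound on the degree sum, so the
    diameter bound applies.\<close>
  then have "A \<noteq> {}" using lower by (auto simp: deg_set_def)
  have AV: "A \<subseteq> V" using A components_subset[OF Lc] by blast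
  define D where "D = 1 / sqrt (2 * H) * sqrt (real (deg_set n r V A))"
  have D0: "0 \<le> D" using H by (simp add: D_def)
  have diam: "tdist n x y \<le> D" if "x \<in> A" "y \<in> A" for x y
    using no that unfolding D_def[symmetric] by (meson linear)
  have "real (deg_set n r V A) \<le> H * D\<^sup>2 + H * (ln n)\<^sup>2"
    unfolding H_def by (rule deg_set_le_diameter[OF n l c bal ln r(2) AV \<open>A \<noteq> {}\<close> D0 diam])
  also have "H * D\<^sup>2 = real (deg_set n r V A) / 2"
    using H by (simp add: D_def power_divide)
  finally have "real (deg_set n r V A) \<le> 2 * H * (ln n)\<^sup>2" by simp
  then show False using lower ln2 by (simp add: algebra_simps)
qed

theorem proposition5p1:
  fixes r_min r_max :: real and r :: "nat \<Rightarrow> real"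
  assumes "r_g < r_min" and "r_min \<le> r_max"
    and "\<And>n. r_min \<le> r n \<and> r n \<le> r_max"
  shows "\<exists>C c :: real. c > 0 \<and>
    (\<lambda>n. ppp_prob n (\<lambda>V. \<forall>L. is_largest_comp n (r n) V L \<longrightarrow>
        (\<forall>A \<subseteq> L. stat_pi n (r n) V L A \<ge> C * (ln (real n))\<^sup>2 / real n \<longrightarrow>
           (\<exists>x\<in>A. \<exists>y\<in>A. tdist n x y \<ge> c * sqrt (real (deg_set n (r n) V A))))))
    \<longlonglongrightarrow> 1"
proof -
  from giant_regime_above_r_g[OF assms(1)]
  obtain \<theta> where \<theta>: "0 < \<theta>"
    and lim_giant: "\<forall>\<epsilon>>0. (\<lambda>n. ppp_prob n (giant_event n r_min (\<theta> * real n) (\<epsilon> * real n))) \<longlonglongrightarrow> 1"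
    unfolding giant_regime_iff by (elim exE conjE)
  \<comment> \<open>An arbitrary positive value of \<epsilon>: what follows draws on the linear
    lower bound for a largest component.\<close>
  note giant = lim_giant[rule_format, OF zero_less_one]
  \<comment> \<open>In cells of side at least 1/2, \<open>m\<close> cells reach as far as
    \<open>r_max\<close>.\<close>
  define m where "m = nat \<lceil>2 * r_max\<rceil>"
  have m: "r_max \<le> real m / 2" using of_nat_ceiling[of "2 * r_max"] by (simp add: m_def)
  define K :: real where "K = 2 * exp (exp 2)"
  define H where "H = 2 * (2 * real m + 1)\<^sup>2 * (32 * K + 2 * K * (2 * real m + 3)\<^sup>2 + 9)"
  have K: "0 \<le> K" by (simp add: K_def)
  have "9 \<le> 32 * K + 2 * K * (2 * real m + 3)\<^sup>2 + 9" using K by simp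
  then have H: "0 < H" unfolding H_def by (intro mult_pos_pos) auto
  \<comment> \<open>The error of \<open>prob_balanced\<close> with \<open>q\<close> replaced by its
    upper bound sqrt n + 1, an explicit function of \<open>n\<close> of order n^(-3/2).\<close>
  let ?e = "\<lambda>n::nat. (sqrt n + 1)\<^sup>2 * ((sqrt n + 1) + 1) / real n ^ 3 + (sqrt n + 1)\<^sup>2 * exp 2 / real n ^ 3"
  let ?P = "\<lambda>n. ppp_prob n (spread_event n (r n) ((2 * H + 1) / \<theta> * (ln n)\<^sup>2 / n) (1 / sqrt (2 * H)))"
  have lim: "?P \<longlonglongrightarrow> 1"
  proof (rule tendsto_1_of_lower_bound)
    have "?e \<longlonglongrightarrow> 0" by real_asymp
    from tendsto_diff[OF giant this]
    show "(\<lambda>n. ppp_prob n (giant_event n r_min (\<theta> * n) (1 * n)) - ?e n) \<longlonglongrightarrow> 1" by simp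
    have ev1: "\<forall>\<^sub>F n::nat in sequentially. 1 \<le> ln n" by real_asymp
    have ev2: "\<forall>\<^sub>F n::nat in sequentially. 2 \<le> \<theta> * n" using \<theta> by real_asymp
    show "\<forall>\<^sub>F n in sequentially. ppp_prob n (giant_event n r_min (\<theta> * n) (1 * n)) - ?e n \<le> ?P n"
      using ev1 ev2 eventually_ge_at_top[of 2]
    proof eventually_elim
      case (elim n)
      \<comment> \<open>Rounding up keeps the mean per cell at most 1, while the side stays at least
        1/2.\<close>
      define q where "q = nat \<lceil>sqrt n\<rceil>"
      have n0: "0 < n" using elim by simp
      have qlo: "sqrt n \<le> q" by (simp add: q_def of_nat_ceiling)
      have qhi: "q \<le> sqrt n + 1" by (simp add: q_def; linarith)
      have s1: "1 \<le> sqrt n" using n0 by simp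
      then have q0: "0 < q" using qlo by linarith
      have nq: "real n \<le> (real q)\<^sup>2" using qlo by (metis real_sqrt_le_iff real_sqrt_pow2_iff of_nat_0_le_iff power_mono real_sqrt_ge_zero)
      have "real q \<le> 2 * sqrt n" using qhi s1 by linarith
      then have l: "1 / 2 \<le> sqrt n / q" using q0 by (simp add: field_simps)
      have "measure_pmf.prob (count_law n q) {c. balanced n q K c} \<ge>
          1 - (real q)\<^sup>2 * (real q + 1) / real n ^ 3 - (real q)\<^sup>2 * exp 2 / real n ^ 3"
        unfolding K_def by (rule prob_balanced[OF elim(3) q0 nq])
      moreover have "(real q)\<^sup>2 * (real q + 1) / real n ^ 3 + (real q)\<^sup>2 * exp 2 / real n ^ 3 \<le> ?e n"
        using qhi by (intro add_mono divide_right_mono mult_mono power_mono) auto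
      ultimately have bal: "measure_pmf.prob (count_law n q) {c. balanced n q K c} \<ge> 1 - ?e n" by linarith
      have "?P n \<ge> ppp_prob n (giant_event n r_min (\<theta> * n) (1 * n)) + measure_pmf.prob (count_law n q) {c. balanced n q K c} - 1"
      proof (rule ppp_prob_lower_bound[OF n0 q0 spread_event_measurable])
        fix V c assume *: "cell_counts_of n q V c" "balanced n q K c" "giant_event n r_min (\<theta> * n) (1 * n) V"
        show "spread_event n (r n) ((2 * H + 1) / \<theta> * (ln n)\<^sup>2 / n) (1 / sqrt (2 * H)) V"
          unfolding H_def
          by (rule spread_event_of_balanced[OF n0 q0 l *(1,2) K elim(1) _ _ *(3) \<theta> elim(2)])
             (use assms(3)[of n] m in auto)
      qed
      then show ?case using bal by linarith
    qed
    show "\<forall>\<^sub>F n in sequentially. ?P n \<le> 1"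
      using eventually_gt_at_top[of 0] by eventually_elim (rule ppp_prob_le_1)
  qed
  have "0 < 1 / sqrt (2 * H)" using H by simp
  with lim[unfolded spread_event_def[abs_def]] show ?thesis by (intro exI conjI)
qed

end
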